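(* For every $m,n\in\mathbb{Z}$, the Okamoto polynomial $Q_{m,n}(x)$ is a monic polynomial of degree $m^2+n^2-mn-m$ with integer coefficients, and $$Q_{m,n}(x)=N_{m,n}\,S_{\lambda(m,n)}\big(x,\tfrac12,0,0,\ldots\big),$$ where $N_{m,n}$ is the positive integer given by the hook-length formula, namely $N_{m,n}=\prod_{s\in\lambda(m,n)}h(s)$, the product of the hook lengths of the partition $\lambda(m,n)$.
   Context: Schur functions: for a partition $\lambda=(\lambda_1\ge\lambda_2\ge\cdots\ge0)$ of length $l(\lambda)$, $S_\lambda(t)=\det\big(p_{\lambda_i-i+j}(t)\big)_{1\le i,j\le l(\lambda)}$, where $\sum_{n\ge0}p_n(t)z^n=\exp(\sum_{k\ge1}t_kz^k)$ and $p_n=0$ for $n<0$; $S_\emptyset=1$. A Maya diagram is a set $M\subset\mathbb{Z}$ containing all sufficiently negative integers and no sufficiently large ones; writing $M=\{\cdots<m_3<m_2<m_1\}$, its partition $\lambda$ is defined by $m_i-m_{i+1}=\lambda_i-\lambda_{i+1}+1$. With $D_l=\{k\in\mathbb{Z}:k<l\}$, let $M(m,n)=3D_m\cup(3D_n+1)\cup(3D_0+2)$ and $\lambda(m,n)$ its partition. The hook length at box $(i,j)$ of $\lambda$ is $\lambda_i+\lambda'_j-i-j+1$. Okamoto polynomials: let $L$ be the field of rational functions over $\mathbb{C}$ in independent indeterminates $\alpha_0,\alpha_1,x,\tau_0,\tau_1,\tau_2,\tau_0',\tau_1',\tau_2'$, indices mod 3, $\alpha_2:=3-\alpha_0-\alpha_1$,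 with derivation $'$: $\alpha_i'=0$, $x'=1$, $(\tau_i)'=\tau_i'$, $(\tau_i')'=\tau_i(F_i''+(F_i')^2)$, $F_j'=\tau_j'/\tau_j$, $F_i''=-x(F_{i+1}'-F_{i+2}')-(F_i'-F_{i+1}')(F_i'-F_{i+2}')-(\alpha_{i+1}-\alpha_{i+2})/3$. Differential automorphisms $s_0,s_1,s_2,\pi$ of $L$: $s_i(x)=\pi(x)=x$, $s_i(\alpha_i)=-\alpha_i$, $s_i(\alpha_j)=\alpha_j+\alpha_i$ ($j\ne i$), $\pi(\alpha_j)=\alpha_{j+1}$, $s_i(\tau_i)=(\tau_{i+1}'\tau_{i+2}-\tau_{i+1}\tau_{i+2}'+x\tau_{i+1}\tau_{i+2})/\tau_i$, $s_i(\tau_j)=\tau_j$ ($j\ne i$), $\pi(\tau_j)=\tau_{j+1}$. With $T_1=\pi s_2s_1$, $T_2=s_1\pi s_2$, $\tau_{m,n}:=T_1^mT_2^n(\tau_0)$, and $Q_{m,n}(x)$ is the evaluation of $\tau_{m,n}$ at $\alpha_0=\alpha_1=\alpha_2=1$, $\tau_0=\tau_1=\tau_2=1$ ($\tau_j'=0$). *)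

theory Defs
  imports "HOL-Computational_Algebra.Polynomial" "HOL-Computational_Algebra.Fraction_Field"
          "Jordan_Normal_Form.Determinant"
begin

text \<open>p_n(t) for t_1 = x, t_2 = 1/2, t_k = 0 (k >= 3): coefficient of z^n in
  exp(x z + z^2/2), i.e. the sum over a + 2b = n of x^a/a! * (1/2)^b/b!.
  p_n = 0 for n < 0. Polynomials in the variable x.\<close>
definition okp :: "int \<Rightarrow> complex poly" where
  "okp k = (if k < 0 then 0 else
     (\<Sum>(a,b)\<in>{(a,b). a + 2*b = nat k}.
         smult ((1/2)^b / (fact a * fact b)) ([:0,1:] ^ a)))"

definition is_partition :: "nat list \<Rightarrow> bool" where
  "is_partition lam \<longleftrightarrow> sorted_wrt (\<ge>) lam \<and> 0 \<notin> set lam"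

definition part :: "nat list \<Rightarrow> nat \<Rightarrow> nat" where
  "part lam i = (if 1 \<le> i \<and> i \<le> length lam then lam ! (i - 1) else 0)"

definition schur :: "nat list \<Rightarrow> complex poly" where
  "schur lam = det (mat (length lam) (length lam)
      (\<lambda>(i,j). okp (int (part lam (i+1)) - int (i+1) + int (j+1))))"

definition conj_part :: "nat list \<Rightarrow> nat \<Rightarrow> nat" where
  "conj_part lam j = card {i. 1 \<le> i \<and> i \<le> length lam \<and> j \<le> part lam i}"

definition young_boxes :: "nat list \<Rightarrow> (nat \<times> nat) set" where
  "young_boxes lam = {(i,j). 1 \<le> i \<and> i \<le> length lam \<and> 1 \<le> j \<and> j \<le> part lam i}"

definition hook :: "nat list \<Rightarrow> nat \<Rightarrow> nat \<Rightarrow> int" where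
  "hook lam i j = int (part lam i) + int (conj_part lam j) - int i - int j + 1"

definition hook_product :: "nat list \<Rightarrow> int" where
  "hook_product lam = (\<Prod>(i,j)\<in>young_boxes lam. hook lam i j)"

text \<open>maya_elem M i = m_{i+1}, the (i+1)-th largest element of M.\<close>
primrec maya_elem :: "int set \<Rightarrow> nat \<Rightarrow> int" where
  "maya_elem M 0 = (GREATEST k. k \<in> M)"
| "maya_elem M (Suc i) = (GREATEST k. k \<in> M \<and> k < maya_elem M i)"

definition maya_partition :: "int set \<Rightarrow> nat list" where
  "maya_partition M = (THE lam. is_partition lam \<and>
     (\<forall>i\<ge>1. maya_elem M (i - 1) - maya_elem M i
              = int (part lam i) - int (part lam (i+1)) + 1))"

definition D_set :: "int \<Rightarrow> int set" where
  "D_set l = {k. k < l}"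

definition maya_mn :: "int \<Rightarrow> int \<Rightarrow> int set" where
  "maya_mn m n = ((\<lambda>k. 3*k) ` D_set m) \<union> ((\<lambda>k. 3*k+1) ` D_set n) \<union> ((\<lambda>k. 3*k+2) ` D_set 0)"

definition lambda_mn :: "int \<Rightarrow> int \<Rightarrow> nat list" where
  "lambda_mn m n = maya_partition (maya_mn m n)"

text \<open>Polynomial ring over C in the nine indeterminates, nested; variables from the
  innermost level outwards: alpha_0, alpha_1, x, tau_0, tau_1, tau_2, tau_0', tau_1', tau_2'.\<close>
type_synonym P1 = "complex poly"
type_synonym P2 = "P1 poly"
type_synonym P3 = "P2 poly"
type_synonym P4 = "P3 poly"
type_synonym P5 = "P4 poly"
type_synonym P6 = "P5 poly"
type_synonym P7 = "P6 poly"
type_synonym P8 = "P7 poly"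
type_synonym P9 = "P8 poly"
type_synonym L = "P9 fract"

definition lc :: "'a::zero \<Rightarrow> 'a poly" where "lc a = [:a:]"

definition X1 :: P1 where "X1 = [:0,1:]"
definition X2 :: P2 where "X2 = [:0,1:]"
definition X3 :: P3 where "X3 = [:0,1:]"
definition X4 :: P4 where "X4 = [:0,1:]"
definition X5 :: P5 where "X5 = [:0,1:]"
definition X6 :: P6 where "X6 = [:0,1:]"
definition X7 :: P7 where "X7 = [:0,1:]"
definition X8 :: P8 where "X8 = [:0,1:]"
definition X9 :: P9 where "X9 = [:0,1:]"

definition cL :: "complex \<Rightarrow> L" where
  "cL c = Fract (lc (lc (lc (lc (lc (lc (lc (lc (lc c))))))))) 1"

definition gA0 :: L where "gA0 = Fract (lc (lc (lc (lc (lc (lc (lc (lc X1)))))))) 1"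
definition gA1 :: L where "gA1 = Fract (lc (lc (lc (lc (lc (lc (lc X2))))))) 1"
definition gx  :: L where "gx  = Fract (lc (lc (lc (lc (lc (lc X3)))))) 1"
definition gT0 :: L where "gT0 = Fract (lc (lc (lc (lc (lc X4))))) 1"
definition gT1 :: L where "gT1 = Fract (lc (lc (lc (lc X5)))) 1"
definition gT2 :: L where "gT2 = Fract (lc (lc (lc X6))) 1"
definition gT0' :: L where "gT0' = Fract (lc (lc X7)) 1"
definition gT1' :: L where "gT1' = Fract (lc X8) 1"
definition gT2' :: L where "gT2' = Fract X9 1"

definition alpha :: "nat \<Rightarrow> L" where
  "alpha j = (if j mod 3 = 0 then gA0 else if j mod 3 = 1 then gA1 else cL 3 - gA0 - gA1)"

definition tau :: "nat \<Rightarrow> L" where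
  "tau j = (if j mod 3 = 0 then gT0 else if j mod 3 = 1 then gT1 else gT2)"

definition taup :: "nat \<Rightarrow> L" where
  "taup j = (if j mod 3 = 0 then gT0' else if j mod 3 = 1 then gT1' else gT2')"

definition Fp :: "nat \<Rightarrow> L" where "Fp j = taup j / tau j"

definition Fpp :: "nat \<Rightarrow> L" where
  "Fpp i = - gx * (Fp (i+1) - Fp (i+2)) - (Fp i - Fp (i+1)) * (Fp i - Fp (i+2))
           - (alpha (i+1) - alpha (i+2)) / cL 3"

definition is_derivation :: "(L \<Rightarrow> L) \<Rightarrow> bool" where
  "is_derivation D \<longleftrightarrow> (\<forall>a b. D (a + b) = D a + D b) \<and> (\<forall>a b. D (a * b) = a * D b + D a * b)
     \<and> (\<forall>c. D (cL c) = 0)"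

definition DL :: "L \<Rightarrow> L" where
  "DL = (THE D. is_derivation D \<and> D gA0 = 0 \<and> D gA1 = 0 \<and> D gx = 1 \<and>
          (\<forall>j<3. D (tau j) = taup j \<and> D (taup j) = tau j * (Fpp j + (Fp j)^2)))"

definition diff_auto :: "(L \<Rightarrow> L) \<Rightarrow> bool" where
  "diff_auto \<sigma> \<longleftrightarrow> bij \<sigma> \<and> (\<forall>a b. \<sigma> (a + b) = \<sigma> a + \<sigma> b) \<and> (\<forall>a b. \<sigma> (a * b) = \<sigma> a * \<sigma> b)
     \<and> (\<forall>c. \<sigma> (cL c) = cL c) \<and> (\<forall>f. \<sigma> (DL f) = DL (\<sigma> f))"

definition s_auto :: "nat \<Rightarrow> L \<Rightarrow> L" where
  "s_auto i = (THE \<sigma>. diff_auto \<sigma> \<and> \<sigma> gx = gx \<and> \<sigma> (alpha i) = - alpha i \<and>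
      (\<forall>j<3. j \<noteq> i mod 3 \<longrightarrow> \<sigma> (alpha j) = alpha j + alpha i) \<and>
      \<sigma> (tau i) = (taup (i+1) * tau (i+2) - tau (i+1) * taup (i+2) + gx * tau (i+1) * tau (i+2)) / tau i \<and>
      (\<forall>j<3. j \<noteq> i mod 3 \<longrightarrow> \<sigma> (tau j) = tau j))"

definition pi_auto :: "L \<Rightarrow> L" where
  "pi_auto = (THE \<sigma>. diff_auto \<sigma> \<and> \<sigma> gx = gx \<and>
      (\<forall>j<3. \<sigma> (alpha j) = alpha (j+1) \<and> \<sigma> (tau j) = tau (j+1)))"

definition T1 :: "L \<Rightarrow> L" where "T1 = pi_auto \<circ> s_auto 2 \<circ> s_auto 1"
definition T2 :: "L \<Rightarrow> L" where "T2 = s_auto 1 \<circ> pi_auto \<circ> s_auto 2"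

definition zpow :: "('a \<Rightarrow> 'a) \<Rightarrow> int \<Rightarrow> 'a \<Rightarrow> 'a" where
  "zpow f k = (if 0 \<le> k then f ^^ nat k else (Hilbert_Choice.inv f) ^^ nat (- k))"

definition tau_mn :: "int \<Rightarrow> int \<Rightarrow> L" where
  "tau_mn m n = zpow T1 m (zpow T2 n (tau 0))"

section \<open>Evaluation at alpha_i = 1, tau_i = 1, tau_i' = 0\<close>

definition evx :: "('a::zero \<Rightarrow> 'b::comm_semiring_0) \<Rightarrow> 'b \<Rightarrow> 'a poly \<Rightarrow> 'b" where
  "evx h a p = poly (map_poly h p) a"

definition ev :: "P9 \<Rightarrow> complex poly" where
  "ev = evx (evx (evx (evx (evx (evx (evx (evx (evx (\<lambda>c. [:c:]) 1) 1) [:0,1:]) 1) 1) 1) 0) 0) 0"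

definition evaluates_to :: "L \<Rightarrow> complex poly \<Rightarrow> bool" where
  "evaluates_to f Q \<longleftrightarrow> (\<exists>p q. f = Fract p q \<and> ev q \<noteq> 0 \<and> ev p = Q * ev q)"

definition okamoto_Q :: "int \<Rightarrow> int \<Rightarrow> complex poly" where
  "okamoto_Q m n = (THE Q. evaluates_to (tau_mn m n) Q)"

end

theory Submission
  imports Defs
begin

text \<open>With \<open>f\<^sub>j = F'\<^sub>j\<^sub>+\<^sub>1 - F'\<^sub>j\<^sub>+\<^sub>2 + x\<close> the reflections act by \<open>s\<^sub>i(F'\<^sub>i) = F'\<^sub>i + \<alpha>\<^sub>i / f\<^sub>i\<close>, and
  \<open>T\<^sub>1(\<tau>\<^sub>1) \<tau>\<^sub>0\<close> is a quadratic differential polynomial in \<open>\<tau>\<^sub>1\<close>. Since \<open>T\<^sub>1\<close>, \<open>T\<^sub>2\<close> are commuting differential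
  automorphisms, this single identity gives a Toda equation for \<open>\<tau>\<^sub>m\<^sub>,\<^sub>n\<close> in each of the two lattice directions.
  Evaluation is a differential homomorphism, so the \<open>Q\<^sub>m\<^sub>,\<^sub>n\<close> satisfy the same equations with the numerical
  constants \<open>2m - n - 1\<close> and \<open>2n - m\<close>, and are determined by their values on a unit square.

  On the other side, \<open>S\<^sub>\<lambda>\<close> is up to sign the Wronskian of the \<open>p\<^sub>h\<close>, where \<open>h\<close> runs through the elements of the Maya
  diagram above some bound. In \<open>M(m,n)\<close> only the top elements of the three residue classes mod \<open>3\<close> can be
  raised by \<open>3\<close> without a collision, and the sums over all raised determinants weighted by \<open>1\<close>, \<open>h\<close>, \<open>h\<^sup>2\<close> can be
  computed; hence raising one top element acts as a first order operator in \<open>x\<close>. Inserted in Jacobi's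
  determinant identity this is again the Toda equation, up to a constant. The constant is \<open>1\<close> for the monic
  multiples of the \<open>S\<^sub>\<lambda>\<close>, which are the \<open>N S\<^sub>\<lambda>\<close> because the leading coefficient of \<open>S\<^sub>\<lambda>\<close> is the reciprocal of the
  hook product. Degree and integrality follow by induction from the Toda equation.\<close>

section \<open>Substitution homomorphisms and their extension to the function field\<close>

text \<open>Two obstacles shape the proof. \<open>DL\<close>, \<open>s_auto\<close> and
  \<open>pi_auto\<close> are definite descriptions, so each needs existence and uniqueness: maps are
  prescribed on the generators of \<open>P9\<close>, extended to fractions and shown to be
  invertible. And evaluation is partial on \<open>L\<close>: a fraction has a value only if some
  denominator survives, while \<open>tau_mn\<close> is not known in advance to be polynomial.
  Existence of values is therefore imported from the Schur side, which supplies nonzero polynomials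
  with the same recurrence; a Toda step, divided by a known nonzero value, carries the evaluation to
  the next lattice point. On the Schur side the weight is the quadratic
  \<open>(h - h1) * (h - h2)\<close>, which vanishes at the other two top elements. Raising then
  gives a polynomial proportional to \<open>U = W' + G W\<close>, where \<open>G' = x^2 + c\<close>.
  Jacobi's identity produces the Wronskian
  \<open>W U' - W' U = W W'' - W'^2 + (x^2 + c) W^2\<close>, and this is the Toda form.\<close>

instance fract :: ("{idom, ring_char_0}") field_char_0
proof
  show "inj (of_nat :: nat \<Rightarrow> 'a fract)"
    by (rule injI) (simp add: eq_fract flip: Fract_of_nat_eq)
qed

definition ring_morph :: "('a::comm_ring_1 \<Rightarrow> 'b::comm_ring_1) \<Rightarrow> bool" where
  "ring_morph h \<longleftrightarrow> h 1 = 1 \<and> (\<forall>a b. h (a + b) = h a + h b) \<and> (\<forall>a b. h (a * b) = h a * h b)"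

lemma ring_morphI:
  assumes "h 1 = 1" "\<And>a b. h (a + b) = h a + h b" "\<And>a b. h (a * b) = h a * h b"
  shows "ring_morph h"
  using assms by (simp add: ring_morph_def)

lemma ring_morphD:
  assumes "ring_morph h"
  shows "h 1 = 1" "h (a + b) = h a + h b" "h (a * b) = h a * h b" "h 0 = 0"
    "h (- a) = - h a" "h (a - b) = h a - h b"
proof -
  show *: "h 1 = 1" "\<And>a b. h (a + b) = h a + h b" "h (a * b) = h a * h b"
    using assms by (auto simp: ring_morph_def)
  show 0: "h 0 = 0" using *(2)[of 0 0] by simp
  show m: "h (- a) = - h a" for a using *(2)[of a "-a"] 0 by (simp add: minus_unique)
  show "h (a - b) = h a - h b" using *(2)[of a "-b"] m[of b] by simp
qed

lemma ring_morph_evx: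
  fixes h :: "'a::comm_ring_1 \<Rightarrow> 'b::comm_ring_1"
  assumes h: "ring_morph h"
  shows "ring_morph (evx h a)"
proof -
  note H = ring_morphD[OF h]
  have *: "evx h a (pCons c p) = h c + a * evx h a p" for c p
    by (simp add: evx_def map_poly_pCons H)
  have add: "evx h a (p + q) = evx h a p + evx h a q" for p q
    by (induction p q rule: poly_induct2) (simp_all add: * H evx_def[of _ _ 0] algebra_simps)
  have smult: "evx h a (smult c p) = h c * evx h a p" for c p
    by (induction p) (simp_all add: * H evx_def[of _ _ 0] algebra_simps)
  have "evx h a (p * q) = evx h a p * evx h a q" for p q
    by (induction p) (simp_all add: * H evx_def[of _ _ 0] add smult algebra_simps)
  moreover have "evx h a 1 = 1" by (simp add: evx_def H)
  ultimately show ?thesis using add by (intro ring_morphI)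
qed

lemma evx_lc: "ring_morph h \<Longrightarrow> evx h a (lc c) = h c"
  by (simp add: evx_def lc_def map_poly_pCons ring_morphD)

lemma evx_X: "ring_morph h \<Longrightarrow> evx h a [:0,1:] = a"
  by (simp add: evx_def map_poly_pCons ring_morphD)

text \<open>\<open>pCons c p\<close> is \<open>lc c + [:0,1:] * p\<close>, so closure under ring
  operations suffices. The predicate \<open>S\<close> lives on the target ring, which makes one
  induction principle serve every homomorphism; with \<open>h\<close> the identity it speaks of
  polynomials themselves.\<close>

lemma poly_generated:
  fixes h :: "'a::comm_ring_1 poly \<Rightarrow> 'b::comm_ring_1"
  assumes h: "ring_morph h"
    and closed: "\<And>a b. S a \<Longrightarrow> S b \<Longrightarrow> S (a + b)" "\<And>a b. S a \<Longrightarrow> S b \<Longrightarrow> S (a * b)"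
    and const: "\<And>c. S (h (lc c))" and X: "S (h [:0,1:])"
  shows "S (h p)"
proof (induction p)
  case 0
  show ?case using const[of 0] by (simp add: lc_def)
next
  case (pCons c p)
  have "pCons c p = lc c + [:0,1:] * p" by (simp add: lc_def)
  then have "h (pCons c p) = h (lc c) + h [:0,1:] * h p"
    using ring_morphD[OF h] by metis
  then show ?case using const X pCons closed by simp
qed

lemma lc_hom: "lc (1::'a::comm_ring_1) = 1" "lc (a + b) = lc a + lc b" "lc (a * b) = lc a * lc (b::'a)"
  by (simp_all add: lc_def one_pCons)

lemma ring_morph_comp_lc: "ring_morph h \<Longrightarrow> ring_morph (\<lambda>c. h (lc c))"
  by (rule ring_morphI) (simp_all only: lc_hom ring_morphD)

definition ev9 :: "(complex \<Rightarrow> 'a) \<Rightarrow> 'a \<Rightarrow> 'a \<Rightarrow> 'a \<Rightarrow> 'a \<Rightarrow> 'a \<Rightarrow> 'a \<Rightarrow> 'a \<Rightarrow> 'a \<Rightarrow> 'a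
    \<Rightarrow> P9 \<Rightarrow> 'a::comm_ring_1" where
  "ev9 k a0 a1 x t0 t1 t2 u0 u1 u2 =
     evx (evx (evx (evx (evx (evx (evx (evx (evx k a0) a1) x) t0) t1) t2) u0) u1) u2"

definition pA0 :: P9 where "pA0 = lc (lc (lc (lc (lc (lc (lc (lc X1)))))))"
definition pA1 :: P9 where "pA1 = lc (lc (lc (lc (lc (lc (lc X2))))))"
definition px :: P9 where "px = lc (lc (lc (lc (lc (lc X3)))))"
definition pT0 :: P9 where "pT0 = lc (lc (lc (lc (lc X4))))"
definition pT1 :: P9 where "pT1 = lc (lc (lc (lc X5)))"
definition pT2 :: P9 where "pT2 = lc (lc (lc X6))"
definition pT0' :: P9 where "pT0' = lc (lc X7)"
definition pT1' :: P9 where "pT1' = lc X8"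
definition pT2' :: P9 where "pT2' = X9"
definition pC :: "complex \<Rightarrow> P9" where "pC c = lc (lc (lc (lc (lc (lc (lc (lc (lc c))))))))"

lemma ring_morph_ev9:
  "ring_morph k \<Longrightarrow> ring_morph (ev9 k a0 a1 x t0 t1 t2 u0 u1 u2)"
  unfolding ev9_def by (intro ring_morph_evx)

lemma ev9_gens:
  assumes "ring_morph k"
  shows "ev9 k a0 a1 x t0 t1 t2 u0 u1 u2 pA0 = a0"
    "ev9 k a0 a1 x t0 t1 t2 u0 u1 u2 pA1 = a1"
    "ev9 k a0 a1 x t0 t1 t2 u0 u1 u2 px = x"
    "ev9 k a0 a1 x t0 t1 t2 u0 u1 u2 pT0 = t0"
    "ev9 k a0 a1 x t0 t1 t2 u0 u1 u2 pT1 = t1"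
    "ev9 k a0 a1 x t0 t1 t2 u0 u1 u2 pT2 = t2"
    "ev9 k a0 a1 x t0 t1 t2 u0 u1 u2 pT0' = u0"
    "ev9 k a0 a1 x t0 t1 t2 u0 u1 u2 pT1' = u1"
    "ev9 k a0 a1 x t0 t1 t2 u0 u1 u2 pT2' = u2"
    "ev9 k a0 a1 x t0 t1 t2 u0 u1 u2 (pC c) = k c"
  unfolding ev9_def pA0_def pA1_def px_def pT0_def pT1_def pT2_def pT0'_def pT1'_def pT2'_def pC_def
    X1_def X2_def X3_def X4_def X5_def X6_def X7_def X8_def X9_def
  by (simp_all only: evx_lc evx_X ring_morph_evx assms)

lemma P9_generated:
  fixes h :: "P9 \<Rightarrow> 'b::comm_ring_1"
  assumes h: "ring_morph h"
    and closed: "\<And>a b. S a \<Longrightarrow> S b \<Longrightarrow> S (a + b)" "\<And>a b. S a \<Longrightarrow> S b \<Longrightarrow> S (a * b)"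
    and gens: "\<And>c. S (h (pC c))" "S (h pA0)" "S (h pA1)" "S (h px)" "S (h pT0)" "S (h pT1)" "S (h pT2)"
      "S (h pT0')" "S (h pT1')" "S (h pT2')"
  shows "S (h p)"
proof -
  note G = gens[unfolded pC_def pA0_def pA1_def px_def pT0_def pT1_def pT2_def pT0'_def pT1'_def pT2'_def
      X1_def X2_def X3_def X4_def X5_def X6_def X7_def X8_def X9_def]
  have 8: "ring_morph (\<lambda>c. h (lc c))" using h by (rule ring_morph_comp_lc)
  have 7: "ring_morph (\<lambda>c. h (lc (lc c)))" using 8 by (rule ring_morph_comp_lc)
  have 6: "ring_morph (\<lambda>c. h (lc (lc (lc c))))" using 7 by (rule ring_morph_comp_lc)
  have 5: "ring_morph (\<lambda>c. h (lc (lc (lc (lc c)))))" using 6 by (rule ring_morph_comp_lc)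
  have 4: "ring_morph (\<lambda>c. h (lc (lc (lc (lc (lc c))))))" using 5 by (rule ring_morph_comp_lc)
  have 3: "ring_morph (\<lambda>c. h (lc (lc (lc (lc (lc (lc c)))))))" using 4 by (rule ring_morph_comp_lc)
  have 2: "ring_morph (\<lambda>c. h (lc (lc (lc (lc (lc (lc (lc c))))))))" using 3 by (rule ring_morph_comp_lc)
  have 1: "ring_morph (\<lambda>c. h (lc (lc (lc (lc (lc (lc (lc (lc c)))))))))" using 2 by (rule ring_morph_comp_lc)
  have g1: "S (h (lc (lc (lc (lc (lc (lc (lc (lc p)))))))))" for p by (rule poly_generated[where S = S]) (rule 1 G(1) G(2) closed | assumption)+
  have g2: "S (h (lc (lc (lc (lc (lc (lc (lc p))))))))" for p by (rule poly_generated[where S = S]) (rule 2 g1 G(3) closed | assumption)+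
  have g3: "S (h (lc (lc (lc (lc (lc (lc p)))))))" for p by (rule poly_generated[where S = S]) (rule 3 g2 G(4) closed | assumption)+
  have g4: "S (h (lc (lc (lc (lc (lc p))))))" for p by (rule poly_generated[where S = S]) (rule 4 g3 G(5) closed | assumption)+
  have g5: "S (h (lc (lc (lc (lc p)))))" for p by (rule poly_generated[where S = S]) (rule 5 g4 G(6) closed | assumption)+
  have g6: "S (h (lc (lc (lc p))))" for p by (rule poly_generated[where S = S]) (rule 6 g5 G(7) closed | assumption)+
  have g7: "S (h (lc (lc p)))" for p by (rule poly_generated[where S = S]) (rule 7 g6 G(8) closed | assumption)+
  have g8: "S (h (lc p))" for p by (rule poly_generated[where S = S]) (rule 8 g7 G(9) closed | assumption)+
  show ?thesis by (rule poly_generated[where S = S]) (rule h g8 G(10) closed | assumption)+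
qed

section \<open>Passage to the fraction field\<close>

definition incl :: "P9 \<Rightarrow> L" where "incl p = Fract p 1"

lemma ring_morph_incl: "ring_morph incl"
  by (rule ring_morphI) (simp_all add: incl_def One_fract_def)

lemma incl_gens:
  "incl (pC c) = cL c" "incl pA0 = gA0" "incl pA1 = gA1" "incl px = gx"
  "incl pT0 = gT0" "incl pT1 = gT1" "incl pT2 = gT2"
  "incl pT0' = gT0'" "incl pT1' = gT1'" "incl pT2' = gT2'"
  by (simp_all only: incl_def cL_def gA0_def gA1_def gx_def gT0_def gT1_def gT2_def gT0'_def gT1'_def gT2'_def
     pC_def pA0_def pA1_def px_def pT0_def pT1_def pT2_def pT0'_def pT1'_def pT2'_def)

lemma incl_eq_0_iff: "incl p = 0 \<longleftrightarrow> p = 0"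
  by (simp add: incl_def Zero_fract_def eq_fract)

lemma Fract_incl: "q \<noteq> 0 \<Longrightarrow> Fract p q = incl p / incl q"
  by (simp add: incl_def)

lemma L_generated:
  assumes add: "\<And>a b. S a \<Longrightarrow> S b \<Longrightarrow> S (a + b)" and mult: "\<And>a b. S a \<Longrightarrow> S b \<Longrightarrow> S (a * b)"
    and divi: "\<And>a b. S a \<Longrightarrow> S b \<Longrightarrow> b \<noteq> 0 \<Longrightarrow> S (a / b)"
    and gens: "\<And>c. S (cL c)" "S gA0" "S gA1" "S gx" "S gT0" "S gT1" "S gT2" "S gT0'" "S gT1'" "S gT2'"
  shows "S f"
proof (cases f)
  case (Fract p q)
  have "S (incl r)" for r
    using add mult by (rule P9_generated[OF ring_morph_incl, where S = S]) (simp_all add: incl_gens gens)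
  moreover have "f = incl p / incl q" "incl q \<noteq> 0"
    using Fract by (simp_all add: Fract_incl incl_eq_0_iff)
  ultimately show ?thesis using divi by simp
qed

lemma ring_morph_cL: "ring_morph cL"
proof -
  have c: "cL = (\<lambda>c. incl (lc (lc (lc (lc (lc (lc (lc (lc (lc c))))))))))"
    by (simp add: fun_eq_iff cL_def incl_def)
  show ?thesis unfolding c by (intro ring_morph_comp_lc ring_morph_incl)
qed

lemmas cL_hom = ring_morphD[OF ring_morph_cL]

lemma cL_inj: "cL c = 0 \<longleftrightarrow> c = 0"
  by (simp add: incl_gens(1)[symmetric] incl_eq_0_iff pC_def lc_def)

lemma cL_of_nat: "cL (of_nat n) = of_nat n"
  by (induction n) (simp_all add: cL_hom)

lemma cL_of_int: "cL (of_int n) = of_int n"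
  by (cases n) (simp_all add: cL_hom cL_of_nat)

lemma cL_numeral: "cL (numeral n) = numeral n"
  using cL_of_nat[of "numeral n"] by simp

text \<open>Graph of the partial extension of \<open>e\<close> to the localisation at its kernel.
  For \<open>e = ev\<close> this is \<open>evaluates_to\<close>, so a single calculus serves the
  evaluation and the construction of the automorphisms.\<close>

definition ext :: "(P9 \<Rightarrow> 'a::idom) \<Rightarrow> L \<Rightarrow> 'a \<Rightarrow> bool" where
  "ext e f y \<longleftrightarrow> (\<exists>p q. f = Fract p q \<and> e q \<noteq> 0 \<and> e p = y * e q)"

lemma extE:
  assumes "ring_morph e" "ext e f y"
  obtains p q where "f = Fract p q" "e q \<noteq> 0" "e p = y * e q" "q \<noteq> 0"
  using assms ring_morphD(4)[OF assms(1)] unfolding ext_def by metis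

lemma ext_incl: "ring_morph e \<Longrightarrow> ext e (incl p) (e p)"
  unfolding ext_def incl_def by (intro exI[of _ p] exI[of _ 1]) (simp add: ring_morphD)

lemma ext_add: assumes e: "ring_morph e" and "ext e f y" "ext e g z" shows "ext e (f + g) (y + z)"
proof -
  from extE[OF e assms(2)] obtain p q where 1: "f = Fract p q" "e q \<noteq> 0" "e p = y * e q" "q \<noteq> 0" .
  from extE[OF e assms(3)] obtain r s where 2: "g = Fract r s" "e s \<noteq> 0" "e r = z * e s" "s \<noteq> 0" .
  show ?thesis unfolding ext_def
    by (rule exI[of _ "p * s + r * q"], rule exI[of _ "q * s"])
      (use 1 2 in \<open>simp add: ring_morphD[OF e] algebra_simps\<close>)
qed

lemma ext_mult: assumes e: "ring_morph e" and "ext e f y" "ext e g z" shows "ext e (f * g) (y * z)"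
proof -
  from extE[OF e assms(2)] obtain p q where 1: "f = Fract p q" "e q \<noteq> 0" "e p = y * e q" "q \<noteq> 0" .
  from extE[OF e assms(3)] obtain r s where 2: "g = Fract r s" "e s \<noteq> 0" "e r = z * e s" "s \<noteq> 0" .
  show ?thesis unfolding ext_def
    by (rule exI[of _ "p * r"], rule exI[of _ "q * s"])
      (use 1 2 in \<open>simp add: ring_morphD[OF e] algebra_simps\<close>)
qed

lemma ext_const: "ring_morph e \<Longrightarrow> ext e (cL c) (e (pC c))"
  using ext_incl[of e "pC c"] by (simp add: incl_gens)

lemma ext_uminus: assumes e: "ring_morph e" and "ext e f y" shows "ext e (- f) (- y)"
proof -
  from extE[OF e assms(2)] obtain p q where 1: "f = Fract p q" "e q \<noteq> 0" "e p = y * e q" "q \<noteq> 0" .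
  show ?thesis unfolding ext_def
    by (rule exI[of _ "- p"], rule exI[of _ "q"])
      (use 1 in \<open>simp add: ring_morphD[OF e] algebra_simps\<close>)
qed

lemma ext_diff: assumes e: "ring_morph e" and "ext e f y" "ext e g z" shows "ext e (f - g) (y - z)"
  using ext_add[OF e assms(2) ext_uminus[OF e assms(3)]] by simp

text \<open>Stated with a multiplication because \<open>'a\<close> need not be a field.\<close>

lemma ext_divide:
  assumes e: "ring_morph e" and "ext e f (y * z)" "ext e g z" "z \<noteq> 0" shows "ext e (f / g) y"
proof -
  from extE[OF e assms(2)] obtain p q where 1: "f = Fract p q" "e q \<noteq> 0" "e p = y * z * e q" "q \<noteq> 0" .
  from extE[OF e assms(3)] obtain r s where 2: "g = Fract r s" "e s \<noteq> 0" "e r = z * e s" "s \<noteq> 0" .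
  have "r \<noteq> 0" using 2 assms(4) ring_morphD(4)[OF e] by auto
  then show ?thesis unfolding ext_def
    by (intro exI[of _ "p * s"] exI[of _ "q * r"])
      (use 1 2 assms(4) in \<open>simp add: ring_morphD[OF e] algebra_simps\<close>)
qed

lemma ext_unique: assumes e: "ring_morph e" and "ext e f y" "ext e f z" shows "y = z"
proof -
  from extE[OF e assms(2)] obtain p q where 1: "f = Fract p q" "e q \<noteq> 0" "e p = y * e q" "q \<noteq> 0" .
  from extE[OF e assms(3)] obtain r s where 2: "f = Fract r s" "e s \<noteq> 0" "e r = z * e s" "s \<noteq> 0" .
  have "p * s = r * q" using 1 2 by (simp add: eq_fract)
  then have "e p * e s = e r * e q" using ring_morphD(3)[OF e] by metis
  then show ?thesis using 1 2 by simp
qed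

lemma ext_div:
  fixes y :: "'a::field"
  assumes e: "ring_morph e" and "ext e f y" "ext e g z" "z \<noteq> 0" shows "ext e (f / g) (y / z)"
  using assms by (intro ext_divide) auto

section \<open>Endomorphisms of the function field over the constants\<close>

definition field_morph :: "(L \<Rightarrow> L) \<Rightarrow> bool" where
  "field_morph \<sigma> \<longleftrightarrow> ring_morph \<sigma> \<and> (\<forall>c. \<sigma> (cL c) = cL c)"

lemma field_morphD:
  assumes "field_morph \<sigma>"
  shows "\<sigma> 1 = 1" "\<sigma> (a + b) = \<sigma> a + \<sigma> b" "\<sigma> (a * b) = \<sigma> a * \<sigma> b" "\<sigma> 0 = 0"
    "\<sigma> (- a) = - \<sigma> a" "\<sigma> (a - b) = \<sigma> a - \<sigma> b" "\<sigma> (cL c) = cL c" "\<sigma> (a / b) = \<sigma> a / \<sigma> b"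
    "\<sigma> a = 0 \<longleftrightarrow> a = 0" "\<sigma> (a ^ n) = \<sigma> a ^ n"
proof -
  have r: "ring_morph \<sigma>" using assms by (simp add: field_morph_def)
  note R = ring_morphD[OF r]
  show "\<sigma> 1 = 1" "\<sigma> (a + b) = \<sigma> a + \<sigma> b" "\<sigma> (a * b) = \<sigma> a * \<sigma> b" "\<sigma> 0 = 0"
    "\<sigma> (- a) = - \<sigma> a" "\<sigma> (a - b) = \<sigma> a - \<sigma> b" "\<sigma> (cL c) = cL c"
    using R assms by (auto simp: field_morph_def)
  show z: "\<sigma> a = 0 \<longleftrightarrow> a = 0" for a
  proof
    assume "\<sigma> a = 0"
    show "a = 0"
    proof (rule ccontr)
      assume "a \<noteq> 0"
      then have "\<sigma> (a * inverse a) = 1" using R by simp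
      then show False using R(3) \<open>\<sigma> a = 0\<close> by simp
    qed
  qed (simp add: R)
  show "\<sigma> (a / b) = \<sigma> a / \<sigma> b"
  proof (cases "b = 0")
    case False
    then have "\<sigma> (a / b) * \<sigma> b = \<sigma> a" using R(3)[of "a / b" b] by simp
    then show ?thesis using z[of b] False by (simp add: field_simps)
  qed (simp add: R)
  show "\<sigma> (a ^ n) = \<sigma> a ^ n" by (induction n) (simp_all add: R)
qed

lemma field_morph_comp: "field_morph \<sigma> \<Longrightarrow> field_morph \<rho> \<Longrightarrow> field_morph (\<sigma> \<circ> \<rho>)"
  by (simp add: field_morph_def ring_morph_def)

lemma field_morph_numeral: "field_morph \<sigma> \<Longrightarrow> \<sigma> (numeral n) = numeral n"
  using field_morphD(7)[of \<sigma> "numeral n"] by (simp add: cL_numeral)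

lemma field_morph_eqI:
  assumes s: "field_morph \<sigma>" and r: "field_morph \<rho>"
    and gens: "\<sigma> gA0 = \<rho> gA0" "\<sigma> gA1 = \<rho> gA1" "\<sigma> gx = \<rho> gx" "\<sigma> gT0 = \<rho> gT0" "\<sigma> gT1 = \<rho> gT1" "\<sigma> gT2 = \<rho> gT2"
      "\<sigma> gT0' = \<rho> gT0'" "\<sigma> gT1' = \<rho> gT1'" "\<sigma> gT2' = \<rho> gT2'"
  shows "\<sigma> = \<rho>"
proof
  fix f show "\<sigma> f = \<rho> f"
    by (rule L_generated[where S = "\<lambda>f. \<sigma> f = \<rho> f"])
      (simp_all add: field_morphD[OF s] field_morphD[OF r] gens)
qed

text \<open>A homomorphism from the polynomial ring to \<open>L\<close> is injective, hence extends to \<open>L\<close>, as soon as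
  some localised evaluation inverts it on the generators.\<close>

lemma field_morph_extend:
  fixes e e' :: "P9 \<Rightarrow> L"
  assumes e: "ring_morph e" and e': "ring_morph e'" and c: "\<And>c. e (pC c) = cL c" "\<And>c. e' (pC c) = cL c"
    and gens: "ext e' (e pA0) gA0" "ext e' (e pA1) gA1" "ext e' (e px) gx"
      "ext e' (e pT0) gT0" "ext e' (e pT1) gT1" "ext e' (e pT2) gT2"
      "ext e' (e pT0') gT0'" "ext e' (e pT1') gT1'" "ext e' (e pT2') gT2'"
  obtains \<sigma> where "field_morph \<sigma>" "\<And>p. \<sigma> (incl p) = e p"
proof -
  have "ext e' (e p) (incl p)" for p
  proof -
    have *: "ext e' (e (p + q)) (incl (p + q)) \<and> ext e' (e (p * q)) (incl (p * q))"
      if "ext e' (e p) (incl p)" "ext e' (e q) (incl q)" for p q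
      using that ext_add[OF e'] ext_mult[OF e'] ring_morphD[OF e] ring_morphD[OF ring_morph_incl] by metis
    have id: "ring_morph (\<lambda>p::P9. p)" by (simp add: ring_morph_def)
    show ?thesis
      by (rule P9_generated[OF id, where S = "\<lambda>p. ext e' (e p) (incl p)"])
        (use * in \<open>auto simp: incl_gens gens c ext_const[OF e', unfolded c]\<close>)
  qed
  note inv = this
  have inj: "e p \<noteq> 0" if "p \<noteq> 0" for p
  proof
    assume "e p = 0"
    then have "ext e' 0 (incl p)" using inv[of p] by simp
    moreover have "ext e' 0 0" using ext_incl[OF e', of 0] ring_morphD[OF e'] ring_morphD[OF ring_morph_incl] by metis
    ultimately have "incl p = 0" using ext_unique[OF e'] by blast
    then show False using that by (simp add: incl_eq_0_iff)
  qed
  have tot: "\<exists>y. ext e f y" for f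
  proof (cases f)
    case (Fract p q)
    then show ?thesis using inj[of q] unfolding ext_def
      by (intro exI[of _ "e p / e q"] exI[of _ p] exI[of _ q]) auto
  qed
  define \<sigma> where "\<sigma> f = (SOME y. ext e f y)" for f
  have \<sigma>: "ext e f (\<sigma> f)" for f unfolding \<sigma>_def using tot by (rule someI_ex)
  have \<sigma>_eq: "\<sigma> f = y" if "ext e f y" for f y using \<sigma> that ext_unique[OF e] by blast
  have i: "\<sigma> (incl p) = e p" for p by (rule \<sigma>_eq) (rule ext_incl[OF e])
  have "field_morph \<sigma>" unfolding field_morph_def ring_morph_def
  proof (intro conjI allI)
    show "\<sigma> 1 = 1" using i[of 1] ring_morphD[OF e] ring_morphD[OF ring_morph_incl] by simp
    show "\<sigma> (a + b) = \<sigma> a + \<sigma> b" for a b by (intro \<sigma>_eq ext_add e \<sigma>)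
    show "\<sigma> (a * b) = \<sigma> a * \<sigma> b" for a b by (intro \<sigma>_eq ext_mult e \<sigma>)
    show "\<sigma> (cL d) = cL d" for d using i[of "pC d"] by (simp add: incl_gens c)
  qed
  then show ?thesis using i that by blast
qed

section \<open>The derivation and the evaluation\<close>

text \<open>The coefficient of \<open>\<epsilon>\<close> in a homomorphism to \<open>L[\<epsilon>]\<close> whose constant term is the inclusion is a
  derivation.\<close>

definition dual :: "P9 \<Rightarrow> L poly" where
  "dual = ev9 (\<lambda>c. [:cL c:]) [:gA0:] [:gA1:] [:gx, 1:] [:gT0, gT0':] [:gT1, gT1':] [:gT2, gT2':]
     [:gT0', tau 0 * (Fpp 0 + (Fp 0)^2):] [:gT1', tau 1 * (Fpp 1 + (Fp 1)^2):] [:gT2', tau 2 * (Fpp 2 + (Fp 2)^2):]"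

lemma ring_morph_const_dual: "ring_morph (\<lambda>c. [:cL c:])"
  unfolding lc_def[symmetric] by (rule ring_morphI) (simp_all only: lc_hom cL_hom)

lemma ring_morph_dual: "ring_morph dual"
  unfolding dual_def by (intro ring_morph_ev9 ring_morph_const_dual)

lemma dual_gens:
  "dual (pC c) = [:cL c:]" "dual pA0 = [:gA0:]" "dual pA1 = [:gA1:]" "dual px = [:gx, 1:]"
  "dual pT0 = [:gT0, gT0':]" "dual pT1 = [:gT1, gT1':]" "dual pT2 = [:gT2, gT2':]"
  "dual pT0' = [:gT0', tau 0 * (Fpp 0 + (Fp 0)^2):]" "dual pT1' = [:gT1', tau 1 * (Fpp 1 + (Fp 1)^2):]"
  "dual pT2' = [:gT2', tau 2 * (Fpp 2 + (Fp 2)^2):]"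
  by (simp_all only: dual_def ev9_gens[OF ring_morph_const_dual])

lemma coeff_dual_0: "coeff (dual p) 0 = incl p"
proof -
  have id: "ring_morph (\<lambda>p::P9. p)" by (simp add: ring_morph_def)
  show ?thesis
    by (rule P9_generated[OF id, where S = "\<lambda>p. coeff (dual p) 0 = incl p"])
      (simp_all add: ring_morphD[OF ring_morph_dual] ring_morphD[OF ring_morph_incl] dual_gens
        incl_gens coeff_mult_0)
qed

definition deriv_P9 :: "P9 \<Rightarrow> L" where "deriv_P9 p = coeff (dual p) 1"

lemma deriv_P9_add: "deriv_P9 (p + q) = deriv_P9 p + deriv_P9 q"
  by (simp add: deriv_P9_def ring_morphD[OF ring_morph_dual])

lemma deriv_P9_mult: "deriv_P9 (p * q) = incl p * deriv_P9 q + deriv_P9 p * incl q"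
  by (simp add: deriv_P9_def ring_morphD[OF ring_morph_dual] coeff_mult coeff_dual_0)

lemma deriv_P9_gens:
  "deriv_P9 (pC c) = 0" "deriv_P9 pA0 = 0" "deriv_P9 pA1 = 0" "deriv_P9 px = 1" "deriv_P9 pT0 = gT0'" "deriv_P9 pT1 = gT1'" "deriv_P9 pT2 = gT2'"
  "deriv_P9 pT0' = tau 0 * (Fpp 0 + (Fp 0)^2)" "deriv_P9 pT1' = tau 1 * (Fpp 1 + (Fp 1)^2)" "deriv_P9 pT2' = tau 2 * (Fpp 2 + (Fp 2)^2)"
  by (simp_all add: deriv_P9_def dual_gens)

definition deriv_L :: "L \<Rightarrow> L" where
  "deriv_L f = (SOME y. \<exists>p q. q \<noteq> 0 \<and> f = Fract p q \<and> y * (incl q)^2 = deriv_P9 p * incl q - incl p * deriv_P9 q)"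

text \<open>Independence of the quotient rule from the representative: \<open>E(2)\<close> says that
  \<open>p / q\<close> and \<open>r / s\<close> agree, \<open>E(1)\<close> is its derivative.
  Denominators are cleared so that a ring identity suffices.\<close>

lemma quotient_rule_consistent:
  fixes p q r s dp dq dr ds :: "'a::comm_ring_1"
  assumes E: "p * ds + dp * s = r * dq + dr * q" "p * s = r * q"
  shows "(dr * s - r * ds) * q^2 = (dp * q - p * dq) * s^2"
proof -
  have "(dp * q - p * dq) * s^2 = (dp * s) * (q * s) - (p * s) * (dq * s)"
    by (simp add: power2_eq_square algebra_simps)
  also have "dp * s = r * dq + dr * q - p * ds" using E(1) by (simp add: algebra_simps)
  also have "(r * dq + dr * q - p * ds) * (q * s) - (p * s) * (dq * s)
     = (r * q) * (dq * s) + dr * q^2 * s - (p * s) * (ds * q) - (p * s) * (dq * s)"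
    by (simp add: power2_eq_square algebra_simps)
  also have "\<dots> = (dr * s - r * ds) * q^2" unfolding E(2) by (simp add: power2_eq_square algebra_simps)
  finally show ?thesis ..
qed

lemma deriv_L_Fract:
  assumes "q \<noteq> 0" shows "deriv_L (Fract p q) * (incl q)^2 = deriv_P9 p * incl q - incl p * deriv_P9 q"
proof -
  let ?P = "\<lambda>y. \<exists>r s. s \<noteq> 0 \<and> Fract p q = Fract r s \<and> y * (incl s)^2 = deriv_P9 r * incl s - incl r * deriv_P9 s"
  have "?P ((deriv_P9 p * incl q - incl p * deriv_P9 q) / (incl q)^2)"
    using assms by (intro exI[of _ p] exI[of _ q]) (simp add: incl_eq_0_iff)
  then have "?P (deriv_L (Fract p q))" unfolding deriv_L_def by (rule someI)
  then obtain r s where rs: "s \<noteq> 0" "Fract p q = Fract r s"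
    "deriv_L (Fract p q) * (incl s)^2 = deriv_P9 r * incl s - incl r * deriv_P9 s" by blast
  define y where "y = deriv_L (Fract p q)"
  have "p * s = r * q" using rs assms by (simp add: eq_fract)
  then have "deriv_P9 (p * s) = deriv_P9 (r * q)" "incl (p * s) = incl (r * q)" by simp_all
  then have E: "incl p * deriv_P9 s + deriv_P9 p * incl s = incl r * deriv_P9 q + deriv_P9 r * incl q" "incl p * incl s = incl r * incl q"
    by (simp_all add: deriv_P9_mult ring_morphD[OF ring_morph_incl])
  have "y * (incl q)^2 * (incl s)^2 = deriv_L (Fract p q) * (incl s)^2 * (incl q)^2"
    by (simp add: y_def ac_simps)
  also have "\<dots> = (deriv_P9 r * incl s - incl r * deriv_P9 s) * (incl q)^2" unfolding rs(3) ..
  also have "\<dots> = (deriv_P9 p * incl q - incl p * deriv_P9 q) * (incl s)^2" using quotient_rule_consistent[OF E] .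
  finally have "y * (incl q)^2 = deriv_P9 p * incl q - incl p * deriv_P9 q" using rs(1) incl_eq_0_iff by simp
  then show ?thesis by (simp add: y_def)
qed

lemma deriv_L_unique: "f = Fract p q \<Longrightarrow> q \<noteq> 0 \<Longrightarrow> y * (incl q)^2 = deriv_P9 p * incl q - incl p * deriv_P9 q \<Longrightarrow> deriv_L f = y"
  using deriv_L_Fract[of q p] incl_eq_0_iff[of q] by (metis mult_right_cancel power_not_zero)

lemma deriv_L_incl: "deriv_L (incl p) = deriv_P9 p"
proof (rule deriv_L_unique)
  have "deriv_P9 (1 * 1) = deriv_P9 1 + deriv_P9 1" unfolding deriv_P9_mult by (simp add: ring_morphD[OF ring_morph_incl])
  then have "deriv_P9 1 + 0 = deriv_P9 1 + deriv_P9 1" by simp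
  then have "deriv_P9 1 = 0" by (simp only: add_left_cancel)
  then show "deriv_P9 p * (incl 1)^2 = deriv_P9 p * incl 1 - incl p * deriv_P9 1" by (simp add: ring_morphD[OF ring_morph_incl])
qed (simp_all add: incl_def)

lemma deriv_L_derivation: "is_derivation deriv_L"
  unfolding is_derivation_def
proof (intro conjI allI)
  note I = ring_morphD[OF ring_morph_incl]
  fix a b :: L
  obtain p q where a: "a = Fract p q" "q \<noteq> 0" by (cases a)
  obtain r s where b: "b = Fract r s" "s \<noteq> 0" by (cases b)
  have D: "deriv_L a * (incl q)^2 = deriv_P9 p * incl q - incl p * deriv_P9 q" "deriv_L b * (incl s)^2 = deriv_P9 r * incl s - incl r * deriv_P9 s"
    using a b deriv_L_Fract by auto
  have V: "a * incl q = incl p" "b * incl s = incl r" using a b by (simp_all add: Fract_incl incl_eq_0_iff)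
  show "deriv_L (a + b) = deriv_L a + deriv_L b"
  proof (rule deriv_L_unique)
    show "a + b = Fract (p * s + r * q) (q * s)" using a b by simp
    show "q * s \<noteq> 0" using a b by simp
    have "(deriv_L a + deriv_L b) * (incl (q * s))^2 = (deriv_L a * (incl q)^2) * (incl s)^2 + (deriv_L b * (incl s)^2) * (incl q)^2"
      by (simp add: I algebra_simps)
    also have "\<dots> = deriv_P9 (p * s + r * q) * incl (q * s) - incl (p * s + r * q) * deriv_P9 (q * s)"
      unfolding D by (simp add: I deriv_P9_mult deriv_P9_add power2_eq_square algebra_simps)
    finally show "(deriv_L a + deriv_L b) * (incl (q * s))\<^sup>2 = deriv_P9 (p * s + r * q) * incl (q * s) - incl (p * s + r * q) * deriv_P9 (q * s)" .
  qed
  show "deriv_L (a * b) = a * deriv_L b + deriv_L a * b"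
  proof (rule deriv_L_unique)
    show "a * b = Fract (p * r) (q * s)" using a b by simp
    show "q * s \<noteq> 0" using a b by simp
    have "(a * deriv_L b + deriv_L a * b) * (incl (q * s))^2 = (a * incl q) * incl q * (deriv_L b * (incl s)^2) + (deriv_L a * (incl q)^2) * (b * incl s) * incl s"
      by (simp add: I power2_eq_square algebra_simps)
    also have "\<dots> = deriv_P9 (p * r) * incl (q * s) - incl (p * r) * deriv_P9 (q * s)"
      unfolding D V by (simp add: I deriv_P9_mult deriv_P9_add power2_eq_square algebra_simps)
    finally show "(a * deriv_L b + deriv_L a * b) * (incl (q * s))^2 = deriv_P9 (p * r) * incl (q * s) - incl (p * r) * deriv_P9 (q * s)" .
  qed
next
  fix c show "deriv_L (cL c) = 0" using deriv_L_incl[of "pC c"] by (simp add: incl_gens deriv_P9_gens)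
qed

lemma is_derivationD:
  assumes "is_derivation D"
  shows "D (a + b) = D a + D b" "D (a * b) = a * D b + D a * b" "D (cL c) = 0" "D (- a) = - D a"
    "D (a - b) = D a - D b" "b \<noteq> 0 \<Longrightarrow> D (a / b) = (D a * b - a * D b) / b^2"
proof -
  show *: "D (a + b) = D a + D b" "D (a * b) = a * D b + D a * b" "D (cL c) = 0" for a b c
    using assms by (auto simp: is_derivation_def)
  have "D 0 = 0" using *(3)[of 0] by (simp add: cL_hom)
  then show m: "D (- a) = - D a" for a using *(1)[of a "-a"] by (simp add: minus_unique)
  show "D (a - b) = D a - D b" using *(1)[of a "-b"] m[of b] by simp
  assume b: "b \<noteq> 0"
  have "D (a / b * b) = a / b * D b + D (a / b) * b" by (rule *)
  then show "D (a / b) = (D a * b - a * D b) / b^2" using b by (simp add: field_simps power2_eq_square)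
qed

lemma derivation_eqI:
  assumes "is_derivation D" "is_derivation D'"
    and gens: "D gA0 = D' gA0" "D gA1 = D' gA1" "D gx = D' gx" "D gT0 = D' gT0" "D gT1 = D' gT1" "D gT2 = D' gT2"
      "D gT0' = D' gT0'" "D gT1' = D' gT1'" "D gT2' = D' gT2'"
  shows "D = D'"
proof
  fix f show "D f = D' f"
    by (rule L_generated[where S = "\<lambda>f. D f = D' f"])
      (simp_all add: is_derivationD[OF assms(1)] is_derivationD[OF assms(2)] gens)
qed

lemma all_lt_3: "(\<forall>j<3. P j) \<longleftrightarrow> P 0 \<and> P 1 \<and> P (2::nat)"
  by (simp add: numeral_3_eq_3 numeral_2_eq_2 All_less_Suc) blast

lemma tau_simps: "tau 0 = gT0" "tau 1 = gT1" "tau 2 = gT2" "tau (Suc 0) = gT1"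
    "taup 0 = gT0'" "taup 1 = gT1'" "taup 2 = gT2'" "taup (Suc 0) = gT1'"
    "alpha 0 = gA0" "alpha 1 = gA1" "alpha 2 = cL 3 - gA0 - gA1" "alpha (Suc 0) = gA1"
  by (simp_all add: tau_def taup_def alpha_def)

text \<open>\<open>deriv_L\<close> gives existence. Uniqueness holds because the quotient rule
  determines a derivation by its values on generators of the field.\<close>

lemma DL_spec:
  "is_derivation DL \<and> DL gA0 = 0 \<and> DL gA1 = 0 \<and> DL gx = 1 \<and>
     (\<forall>j<3. DL (tau j) = taup j \<and> DL (taup j) = tau j * (Fpp j + (Fp j)^2))"
proof -
  have "\<forall>j<3. deriv_L (tau j) = taup j \<and> deriv_L (taup j) = tau j * (Fpp j + (Fp j)^2)"
    using deriv_L_incl[of pT0] deriv_L_incl[of pT1] deriv_L_incl[of pT2] deriv_L_incl[of pT0'] deriv_L_incl[of pT1'] deriv_L_incl[of pT2']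
    by (simp only: all_lt_3 incl_gens deriv_P9_gens tau_simps simp_thms)
  then have Q: "is_derivation deriv_L \<and> deriv_L gA0 = 0 \<and> deriv_L gA1 = 0 \<and> deriv_L gx = 1 \<and>
     (\<forall>j<3. deriv_L (tau j) = taup j \<and> deriv_L (taup j) = tau j * (Fpp j + (Fp j)^2))"
    using deriv_L_derivation deriv_L_incl[of pA0] deriv_L_incl[of pA1] deriv_L_incl[of px] by (simp only: incl_gens deriv_P9_gens simp_thms)
  have "\<exists>!D. is_derivation D \<and> D gA0 = 0 \<and> D gA1 = 0 \<and> D gx = 1 \<and>
     (\<forall>j<3. D (tau j) = taup j \<and> D (taup j) = tau j * (Fpp j + (Fp j)^2))"
  proof (rule ex1I)
    show "is_derivation deriv_L \<and> deriv_L gA0 = 0 \<and> deriv_L gA1 = 0 \<and> deriv_L gx = 1 \<and>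
     (\<forall>j<3. deriv_L (tau j) = taup j \<and> deriv_L (taup j) = tau j * (Fpp j + (Fp j)^2))" by (rule Q)
    fix D
    assume D: "is_derivation D \<and> D gA0 = 0 \<and> D gA1 = 0 \<and> D gx = 1 \<and>
     (\<forall>j<3. D (tau j) = taup j \<and> D (taup j) = tau j * (Fpp j + (Fp j)^2))"
    show "D = deriv_L"
      by (rule derivation_eqI) (use Q D in \<open>simp_all only: all_lt_3 tau_simps simp_thms\<close>)
  qed
  from theI'[OF this] show ?thesis unfolding DL_def[symmetric] .
qed

lemmas DL_derivation = DL_spec[THEN conjunct1]
lemmas DL_simps = is_derivationD[OF DL_derivation]

lemma DL_gens: "DL gA0 = 0" "DL gA1 = 0" "DL gx = 1" "DL (alpha j) = 0" "DL (tau j) = taup j"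
   "DL (taup j) = tau j * (Fpp j + (Fp j)^2)"
proof -
  show 1: "DL gA0 = 0" "DL gA1 = 0" "DL gx = 1" using DL_spec by auto
  show "DL (alpha j) = 0" by (simp add: alpha_def DL_simps 1)
  have m: "j mod 3 < 3" by simp
  have "tau (j mod 3) = tau j" "taup (j mod 3) = taup j" "Fp (j mod 3) = Fp j" "Fpp (j mod 3) = Fpp j"
  proof -
    show *: "tau (j mod 3) = tau j" "taup (j mod 3) = taup j" "Fp (j mod 3) = Fp j" for j
      by (simp_all add: tau_def taup_def Fp_def)
    have "Fp (j mod 3 + i) = Fp (j + i)" "alpha (j mod 3 + i) = alpha (j + i)" for i
      using * by (simp_all add: Fp_def tau_def taup_def alpha_def mod_add_left_eq)
    then show "Fpp (j mod 3) = Fpp j" unfolding Fpp_def by (simp only: *)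
  qed
  then show "DL (tau j) = taup j" "DL (taup j) = tau j * (Fpp j + (Fp j)^2)"
    using DL_spec m by metis+
qed

section \<open>The evaluation at the symmetric point\<close>

lemma evaluates_to_ext: "evaluates_to = ext ev"
  by (simp add: fun_eq_iff evaluates_to_def ext_def)

lemma ev_eq_ev9: "ev = ev9 (\<lambda>c. [:c:]) 1 1 [:0,1:] 1 1 1 0 0 0"
  by (simp add: ev_def ev9_def)

lemma ring_morph_const_poly: "ring_morph (\<lambda>c. [:c:] :: 'a::comm_ring_1 poly)"
  by (rule ring_morphI) (simp_all add: one_pCons)

lemma ring_morph_ev: "ring_morph ev"
  unfolding ev_eq_ev9 by (intro ring_morph_ev9 ring_morph_const_poly)

lemma ev_gens:
  "ev (pC c) = [:c:]" "ev pA0 = 1" "ev pA1 = 1" "ev px = [:0,1:]" "ev pT0 = 1" "ev pT1 = 1" "ev pT2 = 1"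
  "ev pT0' = 0" "ev pT1' = 0" "ev pT2' = 0"
  by (simp_all only: ev_eq_ev9 ev9_gens[OF ring_morph_const_poly])

lemma evaluates_to_gens:
  "evaluates_to (cL c) [:c:]" "evaluates_to (alpha j) 1" "evaluates_to gx [:0,1:]"
  "evaluates_to (tau j) 1" "evaluates_to (taup j) 0"
proof -
  have i: "ext ev (incl p) (ev p)" for p by (rule ext_incl[OF ring_morph_ev])
  note G = i[of "pC _", unfolded incl_gens ev_gens] i[of pA0, unfolded incl_gens ev_gens]
    i[of pA1, unfolded incl_gens ev_gens] i[of px, unfolded incl_gens ev_gens]
    i[of pT0, unfolded incl_gens ev_gens] i[of pT1, unfolded incl_gens ev_gens]
    i[of pT2, unfolded incl_gens ev_gens] i[of pT0', unfolded incl_gens ev_gens]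
    i[of pT1', unfolded incl_gens ev_gens] i[of pT2', unfolded incl_gens ev_gens]
  have "ext ev (cL 3 - gA0 - gA1) ([:3:] - 1 - 1)" by (intro ext_diff ring_morph_ev G)
  then have "ext ev (cL 3 - gA0 - gA1) 1" by (simp add: one_pCons)
  then show "evaluates_to (cL c) [:c:]" "evaluates_to (alpha j) 1" "evaluates_to gx [:0,1:]"
    "evaluates_to (tau j) 1" "evaluates_to (taup j) 0"
    unfolding evaluates_to_ext using G by (auto simp: alpha_def tau_def taup_def)
qed

lemmas evaluates_to_ring =
  ext_add[OF ring_morph_ev, folded evaluates_to_ext] ext_mult[OF ring_morph_ev, folded evaluates_to_ext]
  ext_diff[OF ring_morph_ev, folded evaluates_to_ext] ext_uminus[OF ring_morph_ev, folded evaluates_to_ext]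

lemmas evaluates_to_divide = ext_divide[OF ring_morph_ev, folded evaluates_to_ext]
lemmas evaluates_to_unique = ext_unique[OF ring_morph_ev, folded evaluates_to_ext]

lemma evaluates_to_Fp: "evaluates_to (Fp j) 0"
  unfolding Fp_def by (rule evaluates_to_divide[where z = 1]) (simp_all add: evaluates_to_gens)

text \<open>All \<open>Fp\<close> and all differences of the \<open>alpha\<close> vanish at the
  chosen point. Hence constant tau functions are consistent with the equation for the second
  derivatives there, which is what makes evaluation compatible with \<open>DL\<close>.\<close>

lemma evaluates_to_Fpp: "evaluates_to (Fpp j) 0"
proof -
  have c: "evaluates_to ((alpha (j+1) - alpha (j+2)) / cL 3) 0"
    using evaluates_to_ring(3)[OF evaluates_to_gens(2) evaluates_to_gens(2), of "j+1" "j+2"]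
    by (intro evaluates_to_divide[OF _ evaluates_to_gens(1)]) simp_all
  have "evaluates_to (Fpp j) (- [:0,1:] * (0 - 0) - (0 - 0) * (0 - 0) - 0)"
    unfolding Fpp_def by (intro evaluates_to_ring evaluates_to_gens evaluates_to_Fp c)
  then show ?thesis by simp
qed

text \<open>The evaluation is a differential homomorphism: the derivatives of the nine generators evaluate to
  the derivatives of their values.\<close>

lemma evaluates_to_DL:
  assumes "evaluates_to f Q" shows "evaluates_to (DL f) (pderiv Q)"
proof -
  define S where "S f \<longleftrightarrow> (\<exists>y. evaluates_to f y \<and> evaluates_to (DL f) (pderiv y))" for f
  have z: "evaluates_to 0 0" using evaluates_to_gens(1)[of 0] by (simp add: cL_hom)
  have o: "evaluates_to 1 1" using evaluates_to_gens(1)[of 1] by (simp add: cL_hom one_pCons)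
  have A: "S (a + b)" if "S a" "S b" for a b
    using that evaluates_to_ring(1) unfolding S_def DL_simps by (metis pderiv_add)
  have M: "S (a * b)" if "S a" "S b" for a b
  proof -
    obtain y where y: "evaluates_to a y" "evaluates_to (DL a) (pderiv y)" using \<open>S a\<close> by (auto simp: S_def)
    obtain z where z: "evaluates_to b z" "evaluates_to (DL b) (pderiv z)" using \<open>S b\<close> by (auto simp: S_def)
    have "evaluates_to (DL (a * b)) (y * pderiv z + pderiv y * z)" unfolding DL_simps
      by (intro evaluates_to_ring y z)
    moreover have "evaluates_to (a * b) (y * z)" by (intro evaluates_to_ring y z)
    ultimately show ?thesis unfolding S_def by (auto simp: pderiv_mult algebra_simps)
  qed
  have C: "S (cL c)" for c unfolding S_def using evaluates_to_gens(1)[of c] z by (auto simp: DL_simps intro!: exI[of _ "[:c:]"])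
  have al: "S (alpha j)" for j unfolding S_def using evaluates_to_gens(2)[of j] z by (auto simp: DL_gens intro!: exI[of _ 1])
  have x: "S gx" unfolding S_def using evaluates_to_gens(3) o by (auto simp: DL_gens pderiv_pCons one_pCons intro!: exI[of _ "[:0,1:]"])
  have t: "S (tau j)" for j unfolding S_def using evaluates_to_gens(4,5)[of j] by (auto simp: DL_gens intro!: exI[of _ 1])
  have t': "S (taup j)" for j
  proof -
    have "evaluates_to (DL (taup j)) (1 * (0 + 0 * 0))" unfolding DL_gens power2_eq_square
      by (intro evaluates_to_ring evaluates_to_gens evaluates_to_Fp evaluates_to_Fpp)
    then show ?thesis unfolding S_def using evaluates_to_gens(5)[of j] by (auto intro!: exI[of _ 0])
  qed
  have S: "S (incl p)" for p
    by (rule P9_generated[OF ring_morph_incl, where S = S])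
      (use A M C al[of 0] al[of 1] x t[of 0] t[of 1] t[of 2] t'[of 0] t'[of 1] t'[of 2] in \<open>simp_all add: tau_simps incl_gens\<close>)
  obtain p q where pq: "f = Fract p q" "ev q \<noteq> 0" "ev p = Q * ev q" "q \<noteq> 0"
    using extE[OF ring_morph_ev assms[unfolded evaluates_to_ext]] .
  have E: "evaluates_to (incl p) (ev p)" for p
    using ext_incl[OF ring_morph_ev, folded evaluates_to_ext] .
  have D: "evaluates_to (DL (incl p)) (pderiv (ev p))" for p
    using S[of p] E[of p] evaluates_to_unique unfolding S_def by metis
  have f: "DL f = (DL (incl p) * incl q - incl p * DL (incl q)) / (incl q * incl q)"
    using pq by (simp add: Fract_incl DL_simps incl_eq_0_iff power2_eq_square)
  show ?thesis unfolding f
  proof (rule evaluates_to_divide)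
    have "evaluates_to (DL (incl p) * incl q - incl p * DL (incl q)) (pderiv (ev p) * ev q - ev p * pderiv (ev q))"
      by (intro evaluates_to_ring E D)
    also have "pderiv (ev p) * ev q - ev p * pderiv (ev q) = pderiv Q * (ev q * ev q)"
      unfolding pq by (simp add: pderiv_mult algebra_simps)
    finally show "evaluates_to (DL (incl p) * incl q - incl p * DL (incl q)) (pderiv Q * (ev q * ev q))" .
    show "evaluates_to (incl q * incl q) (ev q * ev q)" by (intro evaluates_to_ring E)
  qed (use pq in simp)
qed

section \<open>The differential automorphisms\<close>

lemma periodic:
  "alpha (j + 3) = alpha j" "tau (j + 3) = tau j" "taup (j + 3) = taup j" "Fp (j + 3) = Fp j"
  "alpha (Suc (Suc (Suc j))) = alpha j" "tau (Suc (Suc (Suc j))) = tau j"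
  "taup (Suc (Suc (Suc j))) = taup j" "Fp (Suc (Suc (Suc j))) = Fp j"
proof -
  have *: "Suc (Suc (Suc j)) mod 3 = j mod 3" for j by presburger
  show "alpha (j + 3) = alpha j" "tau (j + 3) = tau j" "taup (j + 3) = taup j" "Fp (j + 3) = Fp j"
    "alpha (Suc (Suc (Suc j))) = alpha j" "tau (Suc (Suc (Suc j))) = tau j"
    "taup (Suc (Suc (Suc j))) = taup j" "Fp (Suc (Suc (Suc j))) = Fp j"
    by (simp_all add: Fp_def tau_def taup_def alpha_def *)
qed

lemma periodic_numeral: "alpha 3 = alpha 0" "tau 3 = tau 0" "taup 3 = taup 0" "Fp 3 = Fp 0"
  "alpha 4 = alpha 1" "tau 4 = tau 1" "taup 4 = taup 1" "Fp 4 = Fp 1"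
  "alpha 5 = alpha 2" "tau 5 = tau 2" "taup 5 = taup 2" "Fp 5 = Fp 2"
  using periodic(1-4)[of 0] periodic(1-4)[of 1] periodic(1-4)[of 2] by simp_all

text \<open>Since \<open>0\<close> evaluates only to \<open>0\<close>, evaluation certifies that the
  denominators occurring below are nonzero in \<open>L\<close>.\<close>

lemma nz_if_evaluates: "evaluates_to f Q \<Longrightarrow> Q \<noteq> 0 \<Longrightarrow> f \<noteq> 0"
  using evaluates_to_unique evaluates_to_gens(1)[of 0] by (auto simp: cL_hom)

lemma tau_nz: "tau j \<noteq> 0"
  using nz_if_evaluates[OF evaluates_to_gens(4)] by simp

text \<open>The variables of the symmetric form of the fourth Painleve equation. Three consecutive
  ones add up to \<open>3 * gx\<close>, and by \<open>DL_fF\<close> they satisfy a closed system of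
  first order equations.\<close>

definition fF :: "nat \<Rightarrow> L" where "fF j = Fp (j + 1) - Fp (j + 2) + gx"

lemma fF_nz: "fF j \<noteq> 0"
proof -
  have "evaluates_to (fF j) (0 - 0 + [:0,1:])"
    unfolding fF_def by (intro evaluates_to_ring evaluates_to_Fp evaluates_to_gens)
  then show ?thesis by (rule nz_if_evaluates) simp
qed

lemma alpha_sum: "alpha j + alpha (j + 1) + alpha (j + 2) = 3"
proof -
  have "j mod 3 = 0 \<or> j mod 3 = 1 \<or> j mod 3 = 2" by presburger
  moreover have "(j + 1) mod 3 = (j mod 3 + 1) mod 3" "(j + 2) mod 3 = (j mod 3 + 2) mod 3" by presburger+
  ultimately show ?thesis by (auto simp: alpha_def cL_numeral)
qed

lemma taup_eq: "taup j = tau j * Fp j"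
  using tau_nz by (simp add: Fp_def)

lemma DL_Fp: "DL (Fp j) = Fpp j"
proof -
  have "DL (Fp j) = (tau j * (Fpp j + (Fp j)^2) * tau j - taup j * taup j) / (tau j)^2"
    unfolding Fp_def[of j] DL_simps(6)[OF tau_nz] DL_gens ..
  then show ?thesis
    unfolding taup_eq[of j] using tau_nz[of j] by (simp add: field_simps power2_eq_square)
qed

text \<open>The quadratic part of \<open>Fpp\<close> factors once \<open>gx^2\<close> is added. The
  same product of two \<open>fF\<close> occurs in \<open>T1 (tau 1)\<close>, and this coincidence is
  the source of the Toda equation.\<close>

lemma Fpp_eq: "Fpp i = fF (i + 1) * fF (i + 2) - gx^2 - (alpha (i + 1) - alpha (i + 2)) / 3"
  by (simp add: Fpp_def fF_def cL_numeral periodic power2_eq_square algebra_simps)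

lemma DL_fF: "DL (fF j) = alpha j + fF j * (fF (j + 2) - fF (j + 1))"
proof -
  have a: "alpha j = 3 - alpha (j + 1) - alpha (j + 2)" using alpha_sum[of j] by (simp add: algebra_simps)
  have "DL (fF j) = Fpp (j + 1) - Fpp (j + 2) + 1"
    by (simp add: fF_def DL_simps DL_Fp DL_gens)
  also have "\<dots> = alpha j + fF j * (fF (j + 2) - fF (j + 1))"
    unfolding Fpp_eq by (simp add: periodic fF_def a field_simps)
  finally show ?thesis .
qed

lemma diff_autoI:
  assumes "field_morph \<sigma>" "field_morph \<rho>" "\<sigma> \<circ> \<rho> = id" "\<rho> \<circ> \<sigma> = id"
    and "\<And>f. \<sigma> (DL f) = DL (\<sigma> f)"
  shows "diff_auto \<sigma>"
  unfolding diff_auto_def using assms o_bij[of \<rho> \<sigma>] by (simp add: field_morphD[OF assms(1)])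

lemma diff_auto_morph: "diff_auto \<sigma> \<Longrightarrow> field_morph \<sigma>"
  using ring_morphD(1)[OF ring_morph_cL]
  by (simp add: diff_auto_def field_morph_def ring_morph_def) metis

lemma diff_auto_DL: "diff_auto \<sigma> \<Longrightarrow> \<sigma> (DL f) = DL (\<sigma> f)"
  by (simp add: diff_auto_def)

lemma diff_auto_comp: "diff_auto \<sigma> \<Longrightarrow> diff_auto \<rho> \<Longrightarrow> diff_auto (\<sigma> \<circ> \<rho>)"
  unfolding diff_auto_def by (simp add: bij_comp)

lemma diff_auto_inv: assumes "diff_auto \<sigma>" shows "diff_auto (Hilbert_Choice.inv \<sigma>)"
proof -
  have b: "bij \<sigma>" and s: "surj \<sigma>" and i: "inj \<sigma>" using assms by (auto simp: diff_auto_def bij_is_surj bij_is_inj)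
  have e: "Hilbert_Choice.inv \<sigma> y = x \<longleftrightarrow> \<sigma> x = y" for x y using b by (metis inv_f_f bij_inv_eq_iff i)
  have "\<sigma> (Hilbert_Choice.inv \<sigma> y) = y" for y using s by (rule surj_f_inv_f)
  then show ?thesis using assms b unfolding diff_auto_def by (auto simp: bij_imp_bij_inv e)
qed

lemma diff_auto_id: "diff_auto id" by (simp add: diff_auto_def)

lemma diff_auto_taup: "diff_auto \<sigma> \<Longrightarrow> \<sigma> (taup j) = DL (\<sigma> (tau j))"
  by (simp add: diff_auto_DL flip: DL_gens(5))

text \<open>\<open>taup\<close> is the derivative of \<open>tau\<close>, so its image is forced.
  Consequently the descriptions of \<open>s_auto\<close> and \<open>pi_auto\<close> have at most one
  solution.\<close>

lemma diff_auto_eqI: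
  assumes s: "diff_auto \<sigma>" and r: "diff_auto \<rho>" and "\<sigma> gx = \<rho> gx"
    and a: "\<And>j. j < 3 \<Longrightarrow> \<sigma> (alpha j) = \<rho> (alpha j)" and t: "\<And>j. j < 3 \<Longrightarrow> \<sigma> (tau j) = \<rho> (tau j)"
  shows "\<sigma> = \<rho>"
proof -
  have A: "\<forall>j<3. \<sigma> (alpha j) = \<rho> (alpha j) \<and> \<sigma> (tau j) = \<rho> (tau j) \<and> \<sigma> (taup j) = \<rho> (taup j)"
    using a t diff_auto_taup[OF s] diff_auto_taup[OF r] by simp
  show ?thesis
    by (rule field_morph_eqI[OF diff_auto_morph[OF s] diff_auto_morph[OF r]])
      (use A assms(3) in \<open>simp_all only: all_lt_3 tau_simps simp_thms\<close>)
qed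

text \<open>Because \<open>taup j = tau j * Fp j\<close>, commuting on \<open>tau j\<close> and on
  \<open>Fp j\<close> yields commuting on \<open>taup j\<close>. The second order condition is
  thereby reduced to one about \<open>Fpp\<close>.\<close>

lemma commutes_with_DL:
  assumes s: "field_morph \<sigma>" and x: "\<sigma> gx = gx" and A: "DL (\<sigma> gA0) = 0" "DL (\<sigma> gA1) = 0"
    and t: "\<And>j. j < 3 \<Longrightarrow> \<sigma> (taup j) = DL (\<sigma> (tau j))"
    and F: "\<And>j. j < 3 \<Longrightarrow> \<sigma> (Fpp j) = DL (\<sigma> (Fp j))"
  shows "\<sigma> (DL f) = DL (\<sigma> f)"
proof -
  note S = field_morphD[OF s]
  have M: "\<sigma> (DL (a * b)) = DL (\<sigma> (a * b))" if "\<sigma> (DL a) = DL (\<sigma> a)" "\<sigma> (DL b) = DL (\<sigma> b)" for a b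
    using that by (simp add: S DL_simps)
  have t1: "\<forall>j<3. \<sigma> (DL (tau j)) = DL (\<sigma> (tau j))" using t by (simp add: DL_gens)
  have t2: "\<forall>j<3. \<sigma> (DL (taup j)) = DL (\<sigma> (taup j))"
    using t1 F unfolding taup_eq by (auto intro!: M simp: DL_Fp)
  show ?thesis
  proof (rule L_generated[where S = "\<lambda>f. \<sigma> (DL f) = DL (\<sigma> f)"])
    show "\<sigma> (DL (a / b)) = DL (\<sigma> (a / b))" if "\<sigma> (DL a) = DL (\<sigma> a)" "\<sigma> (DL b) = DL (\<sigma> b)" "b \<noteq> 0" for a b
      using that by (simp add: S DL_simps)
  qed (use M t1[unfolded all_lt_3 tau_simps] t2[unfolded all_lt_3 tau_simps]
      in \<open>simp_all add: S DL_simps DL_gens(1-3) x A\<close>)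
qed

section \<open>Construction of the rotation and the reflections\<close>

lemma pi_exists:
  obtains \<sigma> where "diff_auto \<sigma>" "\<sigma> gx = gx" "\<And>j. j < 3 \<Longrightarrow> \<sigma> (alpha j) = alpha (j+1)"
     "\<And>j. j < 3 \<Longrightarrow> \<sigma> (tau j) = tau (j+1)"
proof -
  define e where "e = ev9 cL gA1 (cL 3 - gA0 - gA1) gx gT1 gT2 gT0 gT1' gT2' gT0'"
  \<comment> \<open>The backward rotation. It certifies the injectivity of \<open>e\<close> in
    \<open>field_morph_extend\<close>, and its own extension is the inverse automorphism.\<close>
  define e' where "e' = ev9 cL (cL 3 - gA0 - gA1) gA0 gx gT2 gT0 gT1 gT2' gT0' gT1'"
  have e: "ring_morph e" "ring_morph e'" unfolding e_def e'_def by (intro ring_morph_ev9 ring_morph_cL)+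
  have g: "e (pC c) = cL c" "e pA0 = gA1" "e pA1 = cL 3 - gA0 - gA1" "e px = gx" "e pT0 = gT1" "e pT1 = gT2"
    "e pT2 = gT0" "e pT0' = gT1'" "e pT1' = gT2'" "e pT2' = gT0'" for c
    unfolding e_def by (rule ev9_gens[OF ring_morph_cL])+
  have g': "e' (pC c) = cL c" "e' pA0 = cL 3 - gA0 - gA1" "e' pA1 = gA0" "e' px = gx" "e' pT0 = gT2" "e' pT1 = gT0"
    "e' pT2 = gT1" "e' pT0' = gT2'" "e' pT1' = gT0'" "e' pT2' = gT1'" for c
    unfolding e'_def by (rule ev9_gens[OF ring_morph_cL])+
  have i: "ext e (incl p) (e p)" "ext e' (incl p) (e' p)" for p by (intro ext_incl e)+
  note G = i(1)[of "pC _", unfolded incl_gens g] i(1)[of pA0, unfolded incl_gens g] i(1)[of pA1, unfolded incl_gens g]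
    i(1)[of px, unfolded incl_gens g] i(1)[of pT0, unfolded incl_gens g] i(1)[of pT1, unfolded incl_gens g]
    i(1)[of pT2, unfolded incl_gens g] i(1)[of pT0', unfolded incl_gens g] i(1)[of pT1', unfolded incl_gens g]
    i(1)[of pT2', unfolded incl_gens g]
  note G' = i(2)[of "pC _", unfolded incl_gens g'] i(2)[of pA0, unfolded incl_gens g'] i(2)[of pA1, unfolded incl_gens g']
    i(2)[of px, unfolded incl_gens g'] i(2)[of pT0, unfolded incl_gens g'] i(2)[of pT1, unfolded incl_gens g']
    i(2)[of pT2, unfolded incl_gens g'] i(2)[of pT0', unfolded incl_gens g'] i(2)[of pT1', unfolded incl_gens g']
    i(2)[of pT2', unfolded incl_gens g']
  have a: "ext e (cL 3 - gA0 - gA1) gA0"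
    using ext_diff[OF e(1) ext_diff[OF e(1) G(1) G(2)] G(3), of 3] by simp
  have a': "ext e' (cL 3 - gA0 - gA1) gA1"
    using ext_diff[OF e(2) ext_diff[OF e(2) G'(1) G'(2)] G'(3), of 3] by simp
  obtain \<sigma> where s: "field_morph \<sigma>" "\<And>p. \<sigma> (incl p) = e p"
    by (rule field_morph_extend[OF e g(1) g'(1)]) (use G' a' in \<open>simp_all only: g\<close>)
  obtain \<rho> where r: "field_morph \<rho>" "\<And>p. \<rho> (incl p) = e' p"
    by (rule field_morph_extend[OF e(2,1) g'(1) g(1)]) (use G a in \<open>simp_all only: g'\<close>)
  note sv = s(2)[of pA0, unfolded incl_gens g] s(2)[of pA1, unfolded incl_gens g]
    s(2)[of px, unfolded incl_gens g] s(2)[of pT0, unfolded incl_gens g] s(2)[of pT1, unfolded incl_gens g]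
    s(2)[of pT2, unfolded incl_gens g] s(2)[of pT0', unfolded incl_gens g] s(2)[of pT1', unfolded incl_gens g]
    s(2)[of pT2', unfolded incl_gens g]
  note rv = r(2)[of pA0, unfolded incl_gens g'] r(2)[of pA1, unfolded incl_gens g']
    r(2)[of px, unfolded incl_gens g'] r(2)[of pT0, unfolded incl_gens g'] r(2)[of pT1, unfolded incl_gens g']
    r(2)[of pT2, unfolded incl_gens g'] r(2)[of pT0', unfolded incl_gens g'] r(2)[of pT1', unfolded incl_gens g']
    r(2)[of pT2', unfolded incl_gens g']
  have id: "field_morph id" by (simp add: field_morph_def ring_morph_def)
  have c1: "\<sigma> \<circ> \<rho> = id"
    by (rule field_morph_eqI[OF field_morph_comp[OF s(1) r(1)] id]) (simp_all add: sv rv field_morphD[OF s(1)])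
  have c2: "\<rho> \<circ> \<sigma> = id"
    by (rule field_morph_eqI[OF field_morph_comp[OF r(1) s(1)] id]) (simp_all add: sv rv field_morphD[OF r(1)])
  have al: "\<forall>j<3. \<sigma> (alpha j) = alpha (j+1)"
    by (simp add: all_lt_3 tau_simps sv field_morphD[OF s(1)] periodic_numeral numeral_2_eq_2[symmetric])
  have ta: "\<forall>j<3. \<sigma> (tau j) = tau (j+1)"
    by (simp add: all_lt_3 tau_simps sv periodic_numeral numeral_2_eq_2[symmetric])
  have tp: "\<forall>j<3. \<sigma> (taup j) = taup (j+1)"
    by (simp add: all_lt_3 tau_simps sv periodic_numeral numeral_2_eq_2[symmetric])
  have F: "\<forall>j<3. \<sigma> (Fp j) = Fp (j+1)" using ta tp by (simp add: Fp_def field_morphD[OF s(1)])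
  have FF: "\<forall>j<3. \<sigma> (Fpp j) = Fpp (j+1)"
    using F al unfolding Fpp_def all_lt_3
    by (simp add: field_morphD[OF s(1)] sv periodic periodic_numeral numeral_2_eq_2[symmetric])
  have "\<sigma> (DL f) = DL (\<sigma> f)" for f
    by (rule commutes_with_DL[OF s(1)])
      (use F FF ta tp in \<open>simp_all add: sv DL_gens DL_Fp DL_simps\<close>)
  then have "diff_auto \<sigma>" by (rule diff_autoI[OF s(1) r(1) c1 c2])
  then show ?thesis using that sv(3) al ta by simp
qed

text \<open>The reflection is an involution, so \<open>e\<close> is its own inverse certificate.
  Only index 1 is constructed by hand; index 2 follows by conjugation with the rotation.\<close>

lemma s1_exists:
  obtains \<sigma> where "diff_auto \<sigma>" "\<sigma> gx = gx" "\<sigma> (alpha 0) = alpha 0 + alpha 1"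
     "\<sigma> (alpha 1) = - alpha 1" "\<sigma> (alpha 2) = alpha 2 + alpha 1"
     "\<sigma> (tau 0) = tau 0" "\<sigma> (tau 2) = tau 2" "\<sigma> (tau 1) = fF 1 * tau 2 * tau 0 / tau 1"
proof -
  define N where "N = gT2' * gT0 - gT2 * gT0' + gx * gT2 * gT0"
  define s where "s = N / gT1"
  \<comment> \<open>The value forced on the derivative of \<open>s\<close>, as confirmed in
    \<open>tp\<close>: the derivative of \<open>fF 1\<close> contributes the term with
    \<open>gA1\<close>, and everything else combines to \<open>N * gT1'\<close>.\<close>
  define s' where "s' = (N * gT1' + gA1 * gT2 * gT0 * gT1) / (gT1 * gT1)"
  define e where "e = ev9 cL (gA0 + gA1) (- gA1) gx gT0 s gT2 gT0' s' gT2'"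
  have nz: "gT0 \<noteq> 0" "gT1 \<noteq> 0" "gT2 \<noteq> 0" using tau_nz[of 0] tau_nz[of 1] tau_nz[of 2] by (simp_all add: tau_simps)
  have N: "N = fF 1 * gT2 * gT0"
    using nz by (simp add: N_def fF_def Fp_def[of 2] periodic_numeral numeral_2_eq_2[symmetric] Fp_def[of 0] tau_simps field_simps)
  have N0: "N \<noteq> 0" unfolding N using fF_nz nz by simp
  have e: "ring_morph e" unfolding e_def by (intro ring_morph_ev9 ring_morph_cL)
  have g: "e (pC c) = cL c" "e pA0 = gA0 + gA1" "e pA1 = - gA1" "e px = gx" "e pT0 = gT0" "e pT1 = s"
    "e pT2 = gT2" "e pT0' = gT0'" "e pT1' = s'" "e pT2' = gT2'" for c
    unfolding e_def by (rule ev9_gens[OF ring_morph_cL])+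
  have i: "ext e (incl p) (e p)" for p by (intro ext_incl e)
  note G = i[of "pC _", unfolded incl_gens g] i[of pA0, unfolded incl_gens g] i[of pA1, unfolded incl_gens g]
    i[of px, unfolded incl_gens g] i[of pT0, unfolded incl_gens g] i[of pT1, unfolded incl_gens g]
    i[of pT2, unfolded incl_gens g] i[of pT0', unfolded incl_gens g] i[of pT1', unfolded incl_gens g]
    i[of pT2', unfolded incl_gens g]
  note ring = ext_add[OF e] ext_mult[OF e] ext_diff[OF e] ext_uminus[OF e]
  have s0: "s \<noteq> 0" using N0 nz by (simp add: s_def)
  have eN: "ext e N N" unfolding N_def by (intro ring G)
  have "ext e s (N / s)" unfolding s_def[of ] using s0 by (intro ext_div e eN G(6)[unfolded s_def]) (simp add: s_def)
  also have "N / s = gT1" using N0 nz by (simp add: s_def)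
  finally have es: "ext e s gT1" .
  have "ext e s' ((N * s' + (- gA1) * gT2 * gT0 * s) / (s * s))" unfolding s'_def[of]
    using s0 by (intro ext_div ring e eN G(3,5-8) G(9)[unfolded s'_def]) simp
  also have "(N * s' + (- gA1) * gT2 * gT0 * s) / (s * s) = gT1'"
    using N0 nz by (simp add: s_def s'_def field_simps)
  finally have es': "ext e s' gT1'" .
  have ea: "ext e (gA0 + gA1) gA0" using ring(1)[OF G(2) G(3)] by simp
  have ea': "ext e (- gA1) gA1" using ring(4)[OF G(3)] by simp
  obtain \<sigma> where sg: "field_morph \<sigma>" "\<And>p. \<sigma> (incl p) = e p"
    by (rule field_morph_extend[OF e e g(1) g(1)]) (use G es es' ea ea' in \<open>simp_all only: g\<close>)
  note S = field_morphD[OF sg(1)]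
  note sv = sg(2)[of pA0, unfolded incl_gens g] sg(2)[of pA1, unfolded incl_gens g]
    sg(2)[of px, unfolded incl_gens g] sg(2)[of pT0, unfolded incl_gens g] sg(2)[of pT1, unfolded incl_gens g]
    sg(2)[of pT2, unfolded incl_gens g] sg(2)[of pT0', unfolded incl_gens g] sg(2)[of pT1', unfolded incl_gens g]
    sg(2)[of pT2', unfolded incl_gens g]
  have id: "field_morph id" by (simp add: field_morph_def ring_morph_def)
  have SN: "\<sigma> N = N" by (simp only: N_def S sv)
  have ss: "\<sigma> s = gT1" using N0 nz by (simp add: s_def S SN sv(5))
  have ss': "\<sigma> s' = gT1'"
    using N0 nz by (simp add: s'_def S SN sv) (simp add: s_def s'_def field_simps)
  have c: "\<sigma> \<circ> \<sigma> = id"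
    by (rule field_morph_eqI[OF field_morph_comp[OF sg(1) sg(1)] id]) (simp_all add: sv S ss ss')
  \<comment> \<open>The amount by which the reflection shifts \<open>Fp 1\<close>. Writing
    \<open>gA1\<close> as \<open>g * fF 1\<close> keeps the check of \<open>FF\<close> free of the
    denominator \<open>fF 1\<close>, and \<open>gd\<close> is the Riccati equation that this check
    requires.\<close>
  define g where "g = gA1 / fF 1"
  have gA: "gA1 = g * fF 1" using fF_nz by (simp add: g_def)
  have f1: "fF 1 = Fp 2 - Fp 0 + gx" by (simp add: fF_def periodic_numeral numeral_2_eq_2[symmetric])
  have F0: "\<sigma> (Fp 0) = Fp 0" and F2: "\<sigma> (Fp 2) = Fp 2" by (simp_all add: Fp_def tau_simps S sv)
  have F1: "\<sigma> (Fp 1) = Fp 1 + g"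
    using nz fF_nz[of 1] by (simp add: Fp_def tau_simps S sv) (simp add: s_def s'_def N g_def field_simps)
  have gd: "DL g = g * (fF 2 - fF 0) - g^2"
  proof -
    have d: "DL (fF 1) = g * fF 1 + fF 1 * (fF 0 - fF 2)"
      using DL_fF[of 1] by (simp add: tau_simps gA fF_def periodic_numeral periodic numeral_2_eq_2[symmetric])
    show ?thesis unfolding g_def DL_simps(6)[OF fF_nz] d DL_gens
      using fF_nz[of 1] by (simp add: g_def field_simps power2_eq_square)
  qed
  have FF: "\<forall>j<3. \<sigma> (Fpp j) = DL (\<sigma> (Fp j))"
    unfolding all_lt_3 F0 F1 F2 DL_simps DL_Fp gd
    unfolding Fpp_def
    by (simp add: S periodic_numeral numeral_2_eq_2[symmetric] F0 F1[simplified] F2 sv tau_simps cL_numeral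
        field_morph_numeral[OF sg(1)])
       (simp add: fF_def periodic_numeral periodic numeral_2_eq_2[symmetric] gA f1[simplified] field_simps power2_eq_square)
  have tp: "\<forall>j<3. \<sigma> (taup j) = DL (\<sigma> (tau j))"
  proof -
    have "DL (fF 1) = gA1 + fF 1 * (fF 0 - fF 2)"
      using DL_fF[of 1] by (simp add: tau_simps fF_def periodic_numeral periodic numeral_2_eq_2[symmetric])
    also have "fF 0 - fF 2 = 2 * Fp 1 - Fp 2 - Fp 0"
      by (simp add: fF_def periodic_numeral periodic numeral_2_eq_2[symmetric])
    finally have d: "DL (fF 1) = gA1 + fF 1 * (2 * Fp 1 - Fp 2 - Fp 0)" .
    have p: "gT0' = gT0 * Fp 0" "gT1' = gT1 * Fp 1" "gT2' = gT2 * Fp 2"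
      using taup_eq[of 0] taup_eq[of 1] taup_eq[of 2] by (simp_all add: tau_simps)
    have D: "DL gT0 = gT0'" "DL gT1 = gT1'" "DL gT2 = gT2'"
      using DL_gens(5)[of 0] DL_gens(5)[of 1] DL_gens(5)[of 2] by (simp_all add: tau_simps)
    have "s' = DL s" unfolding s_def DL_simps(6)[OF nz(2)] N DL_simps D d
      using nz by (simp add: s'_def N p[simplified] field_simps power2_eq_square)
    then show ?thesis by (simp only: all_lt_3 tau_simps sv D)
  qed
  have "\<sigma> (DL f) = DL (\<sigma> f)" for f
    by (rule commutes_with_DL[OF sg(1)])
      (use FF tp in \<open>simp_all add: sv DL_gens DL_simps\<close>)
  then have "diff_auto \<sigma>" by (rule diff_autoI[OF sg(1) sg(1) c c])
  moreover have "\<sigma> (tau 1) = fF 1 * tau 2 * tau 0 / tau 1" by (simp add: tau_simps sv s_def N)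
  ultimately show ?thesis using that sv by (simp add: tau_simps S)
qed

lemma pi_spec_ex1:
  "\<exists>!\<sigma>. diff_auto \<sigma> \<and> \<sigma> gx = gx \<and> (\<forall>j<3. \<sigma> (alpha j) = alpha (j+1) \<and> \<sigma> (tau j) = tau (j+1))"
proof -
  obtain \<sigma> where s: "diff_auto \<sigma>" "\<sigma> gx = gx" "\<And>j. j < 3 \<Longrightarrow> \<sigma> (alpha j) = alpha (j+1)"
     "\<And>j. j < 3 \<Longrightarrow> \<sigma> (tau j) = tau (j+1)"
    by (rule pi_exists) auto
  show ?thesis
  proof (rule ex1I[of _ \<sigma>])
    fix \<rho> assume r: "diff_auto \<rho> \<and> \<rho> gx = gx \<and> (\<forall>j<3. \<rho> (alpha j) = alpha (j+1) \<and> \<rho> (tau j) = tau (j+1))"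
    then show "\<rho> = \<sigma>" using s by (intro diff_auto_eqI) auto
  qed (use s in auto)
qed

lemma pi_spec:
  "diff_auto pi_auto" "pi_auto gx = gx" "pi_auto (alpha j) = alpha (j+1)" "pi_auto (tau j) = tau (j+1)"
proof -
  note s = theI'[OF pi_spec_ex1, folded pi_auto_def]
  have m: "alpha (j mod 3) = alpha j" "tau (j mod 3) = tau j" "j mod 3 < 3" for j
    by (simp_all add: alpha_def tau_def)
  have m': "alpha (j mod 3 + 1) = alpha (j + 1)" "tau (j mod 3 + 1) = tau (j + 1)"
    using m(1,2)[of "j mod 3 + 1"] m(1,2)[of "j + 1"] by (simp_all add: mod_simps)
  show "diff_auto pi_auto" "pi_auto gx = gx" using s by auto
  show "pi_auto (alpha j) = alpha (j+1)" "pi_auto (tau j) = tau (j+1)"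
    using s m m' by metis+
qed

text \<open>The specification of \<open>s_auto\<close> with indices relative to \<open>i\<close>, so
  that conjugation by the rotation merely shifts \<open>i\<close>; the bilinear numerator is
  factored by \<open>fF_tau_tau\<close>.\<close>

definition is_reflection :: "nat \<Rightarrow> (L \<Rightarrow> L) \<Rightarrow> bool" where
  "is_reflection i \<sigma> \<longleftrightarrow> diff_auto \<sigma> \<and> \<sigma> gx = gx \<and> \<sigma> (alpha i) = - alpha i \<and>
      \<sigma> (alpha (i+1)) = alpha (i+1) + alpha i \<and> \<sigma> (alpha (i+2)) = alpha (i+2) + alpha i \<and>
      \<sigma> (tau i) = fF i * tau (i+1) * tau (i+2) / tau i \<and>
      \<sigma> (tau (i+1)) = tau (i+1) \<and> \<sigma> (tau (i+2)) = tau (i+2)"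

lemma fF_tau_tau:
  "taup (i+1) * tau (i+2) - tau (i+1) * taup (i+2) + gx * tau (i+1) * tau (i+2) = fF i * tau (i+1) * tau (i+2)"
  unfolding taup_eq fF_def by (simp add: algebra_simps)

lemma s_auto_eqI:
  assumes c: "is_reflection i \<sigma>" and i: "i = 1 \<or> i = 2"
  shows "s_auto i = \<sigma>"
proof -
  let ?P = "\<lambda>\<sigma>. diff_auto \<sigma> \<and> \<sigma> gx = gx \<and> \<sigma> (alpha i) = - alpha i \<and>
      (\<forall>j<3. j \<noteq> i mod 3 \<longrightarrow> \<sigma> (alpha j) = alpha j + alpha i) \<and>
      \<sigma> (tau i) = (taup (i+1) * tau (i+2) - tau (i+1) * taup (i+2) + gx * tau (i+1) * tau (i+2)) / tau i \<and>
      (\<forall>j<3. j \<noteq> i mod 3 \<longrightarrow> \<sigma> (tau j) = tau j)"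
  have P: "?P \<sigma>"
    using c i unfolding is_reflection_def fF_tau_tau all_lt_3
    by (auto simp: periodic_numeral numeral_2_eq_2[symmetric])
  have U: "\<rho> = \<sigma>" if r: "?P \<rho>" for \<rho>
  proof (rule diff_auto_eqI)
    show "\<rho> (alpha j) = \<sigma> (alpha j)" "\<rho> (tau j) = \<sigma> (tau j)" if "j < 3" for j
      using r P i that by (cases "j = i mod 3"; auto)+
  qed (use r P in auto)
  show ?thesis unfolding s_auto_def by (rule the_equality[of ?P, OF P U])
qed

lemma is_reflection_1: "is_reflection 1 (s_auto 1)"
proof -
  obtain \<sigma> where s: "diff_auto \<sigma>" "\<sigma> gx = gx" "\<sigma> (alpha 0) = alpha 0 + alpha 1"
     "\<sigma> (alpha 1) = - alpha 1" "\<sigma> (alpha 2) = alpha 2 + alpha 1"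
     "\<sigma> (tau 0) = tau 0" "\<sigma> (tau 2) = tau 2" "\<sigma> (tau 1) = fF 1 * tau 2 * tau 0 / tau 1"
    by (rule s1_exists) auto
  then have "is_reflection 1 \<sigma>" by (simp add: is_reflection_def periodic_numeral numeral_2_eq_2[symmetric])
  then show ?thesis using s_auto_eqI[of 1 \<sigma>] by simp
qed

lemma diff_auto_Fp: "diff_auto \<sigma> \<Longrightarrow> \<sigma> (Fp j) = DL (\<sigma> (tau j)) / \<sigma> (tau j)"
  by (simp add: Fp_def field_morphD[OF diff_auto_morph] diff_auto_taup)

lemma pi_Fp: "pi_auto (Fp j) = Fp (j+1)"
  using diff_auto_Fp[OF pi_spec(1), of j] by (simp add: pi_spec DL_gens Fp_def)

lemma pi_fF: "pi_auto (fF j) = fF (j+1)"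
  by (simp add: fF_def field_morphD[OF diff_auto_morph[OF pi_spec(1)]] pi_Fp[simplified] pi_spec)

lemma pi_inv: "Hilbert_Choice.inv pi_auto (pi_auto f) = f" "pi_auto (Hilbert_Choice.inv pi_auto f) = f"
  using pi_spec(1) by (simp_all add: diff_auto_def bij_is_inj bij_is_surj surj_f_inv_f)

text \<open>The conjugate of \<open>s_auto 1\<close> by the rotation meets the specification for
  index 2, hence is \<open>s_auto 2\<close> by uniqueness; the commutation relation is this equality
  rewritten.\<close>

lemma is_reflection_2: "is_reflection 2 (s_auto 2)" and pi_s1: "pi_auto \<circ> s_auto 1 = s_auto 2 \<circ> pi_auto"
proof -
  let ?s = "pi_auto \<circ> s_auto 1 \<circ> Hilbert_Choice.inv pi_auto"
  have *: "?s (pi_auto f) = pi_auto (s_auto 1 f)" for f by (simp add: pi_inv)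
  note c = is_reflection_1[unfolded is_reflection_def]
  note M = field_morphD[OF diff_auto_morph[OF pi_spec(1)]]
  have "is_reflection 2 ?s" unfolding is_reflection_def
  proof (intro conjI)
    show "diff_auto ?s" using c pi_spec(1) by (intro diff_auto_comp diff_auto_inv) auto
    show "?s gx = gx" using *[of gx] c pi_spec by simp
    show "?s (alpha 2) = - alpha 2"
      using *[of "alpha 1"] c pi_spec(3)[of 1] M by (simp add: numeral_2_eq_2)
    show "?s (alpha (2 + 1)) = alpha (2 + 1) + alpha 2"
      using *[of "alpha (1+1)"] c pi_spec(3)[of 1] pi_spec(3)[of 2] M by (simp add: numeral_2_eq_2)
    show "?s (alpha (2 + 2)) = alpha (2 + 2) + alpha 2"
      using *[of "alpha (1+2)"] c pi_spec(3)[of 1] pi_spec(3)[of 3] M by (simp add: numeral_eq_Suc)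
    show "?s (tau 2) = fF 2 * tau (2 + 1) * tau (2 + 2) / tau 2"
      using *[of "tau 1"] c pi_spec(4)[of 1] pi_spec(4)[of 2] pi_spec(4)[of 3] pi_fF[of 1] M by (simp add: numeral_eq_Suc)
    show "?s (tau (2 + 1)) = tau (2 + 1)"
      using *[of "tau 2"] c pi_spec(4)[of 2] by (simp add: numeral_eq_Suc)
    show "?s (tau (2 + 2)) = tau (2 + 2)"
      using *[of "tau 3"] c pi_spec(4)[of 3] by (simp add: numeral_eq_Suc)
  qed
  moreover from s_auto_eqI[OF this] have e: "s_auto 2 = ?s" by simp
  ultimately show "is_reflection 2 (s_auto 2)" by simp
  show "pi_auto \<circ> s_auto 1 = s_auto 2 \<circ> pi_auto" unfolding e using * by (simp add: fun_eq_iff)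
qed

text \<open>\<open>Fp i\<close> is the logarithmic derivative of \<open>tau i\<close>, so its image
  is that of \<open>fF i * tau (i+1) * tau (i+2) / tau i\<close>. By \<open>DL_fF\<close> the factor
  \<open>fF i\<close> contributes \<open>alpha i / fF i + 2 * Fp i - Fp (i+1) - Fp (i+2)\<close>,
  and the neighbours cancel.\<close>

lemma is_reflection_Fp:
  assumes "is_reflection i \<sigma>"
  shows "\<sigma> (Fp i) = Fp i + alpha i / fF i" "\<sigma> (Fp (i+1)) = Fp (i+1)" "\<sigma> (Fp (i+2)) = Fp (i+2)"
    "\<sigma> (fF i) = fF i" "\<sigma> (fF (i+1)) = fF (i+1) - alpha i / fF i" "\<sigma> (fF (i+2)) = fF (i+2) + alpha i / fF i"
proof -
  have d: "diff_auto \<sigma>" and x: "\<sigma> gx = gx" using assms by (auto simp: is_reflection_def)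
  note M = field_morphD[OF diff_auto_morph[OF d]]
  note F = diff_auto_Fp[OF d]
  show 12: "\<sigma> (Fp (i+1)) = Fp (i+1)" "\<sigma> (Fp (i+2)) = Fp (i+2)"
    unfolding F using assms by (simp_all add: is_reflection_def DL_gens Fp_def)
  have p: "taup j = tau j * Fp j" for j by (rule taup_eq)
  have f: "fF (i+2) - fF (i+1) = 2 * Fp i - Fp (i+1) - Fp (i+2)"
    by (simp add: fF_def periodic)
  have "DL (fF i * tau (i+1) * tau (i+2) / tau i) = (fF i * tau (i+1) * tau (i+2) / tau i) * (alpha i / fF i + Fp i)"
    unfolding DL_simps(6)[OF tau_nz] DL_simps DL_fF DL_gens f p using tau_nz[of i] fF_nz[of i]
    by (simp add: field_simps power2_eq_square)
  then show 0: "\<sigma> (Fp i) = Fp i + alpha i / fF i"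
    unfolding F using assms tau_nz[of i] tau_nz[of "i+1"] tau_nz[of "i+2"] fF_nz[of i] by (simp add: is_reflection_def)
  show "\<sigma> (fF i) = fF i" unfolding fF_def M 12 x ..
  show "\<sigma> (fF (i+1)) = fF (i+1) - alpha i / fF i" "\<sigma> (fF (i+2)) = fF (i+2) + alpha i / fF i"
    using 0 12 by (simp_all add: fF_def[of "Suc i"] fF_def[of "Suc (Suc i)"] M x periodic)
qed

section \<open>The Toda equations for the tau functions\<close>

abbreviation s1 where "s1 \<equiv> s_auto 1"
abbreviation s2 where "s2 \<equiv> s_auto 2"

lemma diff_autos: "diff_auto pi_auto" "diff_auto s1" "diff_auto s2"
  using pi_spec(1) is_reflection_1 is_reflection_2 by (auto simp: is_reflection_def)

lemmas pi_s1_s2_morphs = diff_autos[THEN diff_auto_morph]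
lemmas pi_hom = field_morphD[OF pi_s1_s2_morphs(1)]
lemmas s1_hom = field_morphD[OF pi_s1_s2_morphs(2)]
lemmas s2_hom = field_morphD[OF pi_s1_s2_morphs(3)]

lemma pi_vals:
  "pi_auto gx = gx" "pi_auto (alpha 0) = alpha 1" "pi_auto (alpha 1) = alpha 2" "pi_auto (alpha 2) = alpha 0"
  "pi_auto (tau 0) = tau 1" "pi_auto (tau 1) = tau 2" "pi_auto (tau 2) = tau 0"
  "pi_auto (fF 0) = fF 1" "pi_auto (fF 1) = fF 2" "pi_auto (fF 2) = fF 0"
  using pi_spec(2) pi_spec(3)[of 0] pi_spec(3)[of 1] pi_spec(3)[of 2] pi_spec(4)[of 0] pi_spec(4)[of 1] pi_spec(4)[of 2]
    pi_fF[of 0] pi_fF[of 1] pi_fF[of 2]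
  by (simp_all add: periodic_numeral numeral_2_eq_2[symmetric])
    (simp add: fF_def periodic_numeral periodic numeral_2_eq_2[symmetric])

lemma fF_periodic: "fF 3 = fF 0" "fF 4 = fF 1"
  by (simp_all add: fF_def periodic_numeral periodic numeral_eq_Suc)

lemma s1_vals:
  "s1 gx = gx" "s1 (alpha 0) = alpha 0 + alpha 1" "s1 (alpha 1) = - alpha 1" "s1 (alpha 2) = alpha 2 + alpha 1"
  "s1 (tau 0) = tau 0" "s1 (tau 1) = fF 1 * tau 2 * tau 0 / tau 1" "s1 (tau 2) = tau 2"
  "s1 (fF 1) = fF 1" "s1 (fF 2) = fF 2 - alpha 1 / fF 1" "s1 (fF 0) = fF 0 + alpha 1 / fF 1"
  using is_reflection_1[unfolded is_reflection_def] is_reflection_Fp(4-6)[OF is_reflection_1]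
  by (simp_all add: periodic_numeral fF_periodic numeral_2_eq_2[symmetric] numeral_3_eq_3[symmetric])

lemma s2_vals:
  "s2 gx = gx" "s2 (alpha 0) = alpha 0 + alpha 2" "s2 (alpha 1) = alpha 1 + alpha 2" "s2 (alpha 2) = - alpha 2"
  "s2 (tau 0) = tau 0" "s2 (tau 1) = tau 1" "s2 (tau 2) = fF 2 * tau 0 * tau 1 / tau 2"
  "s2 (fF 2) = fF 2" "s2 (fF 0) = fF 0 - alpha 2 / fF 2" "s2 (fF 1) = fF 1 + alpha 2 / fF 2"
  using is_reflection_2[unfolded is_reflection_def] is_reflection_Fp(4-6)[OF is_reflection_2]
  by (simp_all add: periodic_numeral fF_periodic numeral_2_eq_2[symmetric] numeral_3_eq_3[symmetric])

lemma diff_auto_eqI_gens: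
  assumes "diff_auto \<sigma>" "diff_auto \<rho>" "\<sigma> gx = \<rho> gx"
    "\<sigma> (alpha 0) = \<rho> (alpha 0)" "\<sigma> (alpha 1) = \<rho> (alpha 1)" "\<sigma> (alpha 2) = \<rho> (alpha 2)"
    "\<sigma> (tau 0) = \<rho> (tau 0)" "\<sigma> (tau 1) = \<rho> (tau 1)" "\<sigma> (tau 2) = \<rho> (tau 2)"
  shows "\<sigma> = \<rho>"
proof -
  have *: "\<forall>j<3. \<sigma> (alpha j) = \<rho> (alpha j)" "\<forall>j<3. \<sigma> (tau j) = \<rho> (tau j)"
    unfolding all_lt_3 using assms by blast+
  then show ?thesis using assms by (intro diff_auto_eqI) auto
qed

lemmas tau_fF_nz = tau_nz[of 0] tau_nz[of 1] tau_nz[of 2] fF_nz[of 0] fF_nz[of 1] fF_nz[of 2]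

lemma s1_s1: "s1 \<circ> s1 = id"
  by (rule diff_auto_eqI_gens) (use tau_fF_nz in \<open>simp_all add: diff_auto_comp diff_auto_id diff_autos s1_vals s1_hom del: One_nat_def\<close>)

lemma pi_pi_pi: "pi_auto \<circ> pi_auto \<circ> pi_auto = id"
  by (rule diff_auto_eqI_gens) (simp_all add: diff_auto_comp diff_auto_id diff_autos pi_vals pi_hom del: One_nat_def)

lemma s2_s1_tau1: "s2 (s1 (tau 1)) = (fF 1 * fF 2 + alpha 2) * tau 0 * tau 0 / tau 2"
  using tau_fF_nz unfolding s1_vals s2_hom s2_vals by (simp add: field_simps)

lemma s1_s2_tau2: "s1 (s2 (tau 2)) = (fF 1 * fF 2 - alpha 1) * tau 0 * tau 0 / tau 1"
  using tau_fF_nz unfolding s2_vals s1_hom s1_vals by (simp add: field_simps)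

lemma braid: "s1 \<circ> s2 \<circ> s1 = s2 \<circ> s1 \<circ> s2"
proof (rule diff_auto_eqI_gens)
  \<comment> \<open>Since \<open>s2\<close> fixes \<open>tau 1\<close>, the right side of the braid
    relation at \<open>tau 1\<close> is \<open>s2 (s1 (tau 1))\<close>, and the claim is its
    invariance under \<open>s1\<close>. The case of \<open>tau 2\<close> is symmetric.\<close>
  have "s1 (s2 (s1 (tau 1))) = s2 (s1 (tau 1))"
    unfolding s2_s1_tau1 unfolding s1_hom s1_vals using tau_fF_nz by (simp add: field_simps)
  then show "(s1 \<circ> s2 \<circ> s1) (tau 1) = (s2 \<circ> s1 \<circ> s2) (tau 1)"
    by (simp only: o_apply s2_vals)
  have "s2 (s1 (s2 (tau 2))) = s1 (s2 (tau 2))"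
    unfolding s1_s2_tau2 unfolding s2_hom s2_vals using tau_fF_nz by (simp add: field_simps)
  then show "(s1 \<circ> s2 \<circ> s1) (tau 2) = (s2 \<circ> s1 \<circ> s2) (tau 2)"
    by (simp only: o_apply s1_vals)
qed (simp_all only: o_apply s1_vals s2_vals s1_hom s2_hom diff_auto_comp diff_autos, simp_all)

lemma T_diff_auto: "diff_auto T1" "diff_auto T2"
  unfolding T1_def T2_def by (intro diff_auto_comp diff_autos)+

text \<open>Moving every rotation to the left reduces both products to
  \<open>pi_auto \<circ> pi_auto \<circ> s1 \<circ> s2\<close>; the braid relation enters only for
  \<open>T2 \<circ> T1\<close>.\<close>

lemma T1_T2: "T1 \<circ> T2 = T2 \<circ> T1"
proof -
  have p: "s2 (pi_auto f) = pi_auto (s1 f)" for f using fun_cong[OF pi_s1, of f] by simp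
  have s: "s1 (s1 f) = f" for f using fun_cong[OF s1_s1, of f] by simp
  have q: "pi_auto (pi_auto (pi_auto f)) = f" for f using fun_cong[OF pi_pi_pi, of f] by simp
  have b: "s1 (s2 (s1 f)) = s2 (s1 (s2 f))" for f using fun_cong[OF braid, of f] by simp
  have r: "s1 (pi_auto (pi_auto f)) = pi_auto (pi_auto (s2 f))" for f
  proof -
    define g where "g = pi_auto (pi_auto f)"
    have f: "f = pi_auto g" by (simp add: g_def q)
    show ?thesis unfolding f p q ..
  qed
  show ?thesis
  proof
    fix f
    have "T1 (T2 f) = pi_auto (pi_auto (s1 (s2 f)))" by (simp add: T1_def T2_def s p del: One_nat_def)
    moreover have "T2 (T1 f) = pi_auto (pi_auto (s1 (s2 f)))"
      unfolding T1_def T2_def o_apply p r b[symmetric] s ..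
    ultimately show "(T1 \<circ> T2) f = (T2 \<circ> T1) f" by simp
  qed
qed

lemma alpha_2: "alpha 2 = 3 - alpha 0 - alpha 1"
  using alpha_sum[of 0] by (simp add: numeral_2_eq_2[symmetric] algebra_simps)

lemma T1_vals: "T1 gx = gx" "T1 (alpha 0) = alpha 0 + 3" "T1 (alpha 1) = alpha 1 - 3" "T1 (tau 0) = tau 1"
  "T1 (tau 1) = (fF 2 * fF 0 + alpha 0) * tau 1 * tau 1 / tau 0"
proof -
  show "T1 gx = gx" unfolding T1_def o_apply s1_vals s2_vals pi_vals ..
  show "T1 (alpha 0) = alpha 0 + 3" "T1 (alpha 1) = alpha 1 - 3"
    unfolding T1_def o_apply s1_vals s2_vals pi_vals s1_hom s2_hom pi_hom by (simp_all add: alpha_2)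
  show "T1 (tau 0) = tau 1" unfolding T1_def o_apply s1_vals s2_vals pi_vals ..
  show "T1 (tau 1) = (fF 2 * fF 0 + alpha 0) * tau 1 * tau 1 / tau 0"
    unfolding T1_def o_apply s2_s1_tau1 pi_hom pi_vals ..
qed

lemma T2_vals: "T2 gx = gx" "T2 (alpha 0) = alpha 0" "T2 (alpha 1) = alpha 1 + 3" "T2 (tau 0) = s1 (tau 1)"
  "T2 (tau 1) = tau 2" "T2 (T2 (tau 0)) = s1 (T1 (tau 1))"
proof -
  show "T2 gx = gx" unfolding T2_def o_apply s1_vals s2_vals pi_vals ..
  show "T2 (alpha 0) = alpha 0" "T2 (alpha 1) = alpha 1 + 3"
    unfolding T2_def o_apply s1_vals s2_vals pi_vals s1_hom s2_hom pi_hom by (simp_all add: alpha_2)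
  show 0: "T2 (tau 0) = s1 (tau 1)" unfolding T2_def o_apply s1_vals s2_vals pi_vals ..
  show "T2 (tau 1) = tau 2" unfolding T2_def o_apply s1_vals s2_vals pi_vals ..
  show "T2 (T2 (tau 0)) = s1 (T1 (tau 1))" unfolding 0 unfolding T1_def T2_def by simp
qed

text \<open>This is \<open>t * t\<close> times \<open>(log t)'' + gx^2 + k\<close>, with
  denominators cleared.\<close>

definition toda :: "L \<Rightarrow> L \<Rightarrow> L" where
  "toda k t = t * DL (DL t) - DL t * DL t + (gx * gx + k) * (t * t)"

lemma toda_diff_auto:
  assumes "diff_auto \<sigma>" "\<sigma> gx = gx" shows "\<sigma> (toda k t) = toda (\<sigma> k) (\<sigma> t)"
  unfolding toda_def by (simp only: field_morphD[OF diff_auto_morph[OF assms(1)]] diff_auto_DL[OF assms(1)] assms(2))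

text \<open>By \<open>Fpp_eq\<close> the constant must be
  \<open>alpha 0 + (alpha 2 - alpha 0) / 3\<close>, where \<open>alpha 0\<close> comes from
  \<open>T1 (tau 1)\<close>; the sum rule for the \<open>alpha\<close> gives the stated
  form.\<close>

lemma toda_tau1: "T1 (tau 1) * tau 0 = toda ((3 + alpha 0 - alpha 1) / 3) (tau 1)"
proof -
  have "toda ((3 + alpha 0 - alpha 1) / 3) (tau 1) = (Fpp 1 + gx^2 + (3 + alpha 0 - alpha 1) / 3) * tau 1 * tau 1"
    unfolding toda_def DL_gens unfolding taup_eq by (simp add: power2_eq_square algebra_simps)
  also have "Fpp 1 = fF 2 * fF 0 - gx^2 - (alpha 2 - alpha 0) / 3"
    using Fpp_eq[of 1] by (simp add: fF_periodic periodic_numeral numeral_2_eq_2[symmetric] numeral_3_eq_3[symmetric])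
  also have "fF 2 * fF 0 - gx^2 - (alpha 2 - alpha 0) / 3 + gx^2 + (3 + alpha 0 - alpha 1) / 3 = fF 2 * fF 0 + alpha 0"
    by (simp add: alpha_2 field_simps)
  finally show ?thesis unfolding T1_vals using tau_fF_nz(1) by simp
qed

lemma toda_T1: "T1 (T1 (tau 0)) * tau 0 = toda ((3 + alpha 0 - alpha 1) / 3) (T1 (tau 0))"
  unfolding T1_vals(4) by (rule toda_tau1)

text \<open>The second direction is the \<open>s1\<close> image of the first: \<open>s1\<close>
  sends \<open>T1 (tau 1)\<close> to \<open>T2 (T2 (tau 0))\<close> and \<open>tau 1\<close> to
  \<open>T2 (tau 0)\<close>, and it fixes \<open>tau 0\<close> and \<open>gx\<close>. Only the
  constant changes.\<close>

lemma toda_T2: "T2 (T2 (tau 0)) * tau 0 = toda ((3 + alpha 0 + 2 * alpha 1) / 3) (T2 (tau 0))"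
proof -
  have "T2 (T2 (tau 0)) * tau 0 = s1 (T1 (tau 1) * tau 0)"
    by (simp only: T2_vals(6) s1_hom(3) s1_vals(5))
  also have "\<dots> = toda (s1 ((3 + alpha 0 - alpha 1) / 3)) (s1 (tau 1))"
    unfolding toda_tau1 by (rule toda_diff_auto[OF diff_autos(2) s1_vals(1)])
  also have "s1 ((3 + alpha 0 - alpha 1) / 3) = (3 + alpha 0 + 2 * alpha 1) / 3"
    unfolding s1_hom s1_vals field_morph_numeral[OF pi_s1_s2_morphs(2)] by simp
  finally show ?thesis unfolding T2_vals(4) .
qed

section \<open>Integer powers and lattice translations\<close>

lemma zpow_0: "zpow f 0 = id"
  by (simp add: zpow_def)

lemma zpow_plus1:
  assumes "bij f" shows "zpow f (k + 1) = f \<circ> zpow f k" "zpow f (k + 1) = zpow f k \<circ> f"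
proof -
  have "zpow f (k + 1) = f \<circ> zpow f k \<and> zpow f (k + 1) = zpow f k \<circ> f"
  proof (cases "0 \<le> k")
    case True
    then have "nat (k + 1) = Suc (nat k)" by simp
    then show ?thesis using True by (simp add: zpow_def funpow_Suc_right del: funpow.simps) (simp add: funpow_swap1 fun_eq_iff)
  next
    case False
    define j where "j = nat (- k - 1)"
    have k: "k = - 1 - int j" using False by (simp add: j_def)
    have n: "nat (- k) = Suc j" "nat (- (k + 1)) = j" using k by auto
    have z: "zpow f (k + 1) = Hilbert_Choice.inv f ^^ j"
      using k n by (cases "j = 0") (auto simp: zpow_def)
    have y: "zpow f k = Hilbert_Choice.inv f ^^ Suc j" using False n by (simp add: zpow_def del: funpow.simps)
    have "f (Hilbert_Choice.inv f x) = x" "Hilbert_Choice.inv f (f x) = x" for x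
      using assms by (simp_all add: bij_is_inj bij_is_surj surj_f_inv_f)
    then have "f \<circ> Hilbert_Choice.inv f ^^ Suc j = Hilbert_Choice.inv f ^^ j"
      "Hilbert_Choice.inv f ^^ Suc j \<circ> f = Hilbert_Choice.inv f ^^ j"
      unfolding fun_eq_iff by (simp, simp only: funpow_Suc_right o_apply) simp
    then show ?thesis unfolding z y by simp
  qed
  then show "zpow f (k + 1) = f \<circ> zpow f k" "zpow f (k + 1) = zpow f k \<circ> f" by auto
qed

lemma diff_auto_zpow: assumes "diff_auto f" shows "diff_auto (zpow f k)"
proof -
  have "diff_auto (g ^^ n)" if "diff_auto g" for g n
    by (induction n) (simp_all only: funpow.simps diff_auto_id diff_auto_comp that)
  then show ?thesis using assms diff_auto_inv by (simp add: zpow_def)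
qed

lemma diff_auto_bij: "diff_auto f \<Longrightarrow> bij f" by (simp add: diff_auto_def)

lemma zpow_fixed:
  assumes f: "bij f" and "f a = a" shows "zpow f k a = a"
proof (induction k rule: int_induct[where k = 0])
  case base
  show ?case by (simp add: zpow_0)
next
  case (step1 i)
  then show ?case using zpow_plus1(2)[OF f, of i] assms by simp
next
  case (step2 i)
  then show ?case using zpow_plus1(2)[OF f, of "i - 1"] assms by simp
qed

lemma zpow_translation:
  assumes f: "diff_auto f" and "f a = a + cL c" shows "zpow f k a = a + cL (of_int k * c)"
proof -
  have h: "zpow f k (a + cL c) = zpow f k a + cL c" for k
    using field_morphD[OF diff_auto_morph[OF diff_auto_zpow[OF f]]] by simp
  note z = zpow_plus1(2)[OF diff_auto_bij[OF f]]
  show ?thesis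
  proof (induction k rule: int_induct[where k = 0])
    case base
    show ?case by (simp add: zpow_0 cL_hom)
  next
    case (step1 i)
    have "zpow f (i + 1) a = zpow f i a + cL c" unfolding z using h assms(2) by simp
    then show ?case using step1 by (simp add: algebra_simps cL_hom)
  next
    case (step2 i)
    have "zpow f (i - 1 + 1) a = zpow f (i - 1) a + cL c" unfolding z using h assms(2) by simp
    then have "zpow f (i - 1) a = zpow f i a - cL c" by simp
    then show ?case using step2 by (simp add: algebra_simps cL_hom)
  qed
qed

lemma zpow_commute:
  assumes f: "bij f" and "f \<circ> g = g \<circ> f" shows "zpow f k (g a) = g (zpow f k a)"
proof (induction k arbitrary: a rule: int_induct[where k = 0])
  case base
  show ?case by (simp add: zpow_0)
next
  case (step1 i)
  then show ?case unfolding zpow_plus1(1)[OF f] using fun_cong[OF assms(2)] by simp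
next
  case (step2 i)
  have "f (zpow f (i - 1) (g a)) = zpow f (i - 1 + 1) (g a)" unfolding zpow_plus1(1)[OF f] by simp
  also have "\<dots> = g (zpow f (i - 1 + 1) a)" using step2 by simp
  also have "\<dots> = f (g (zpow f (i - 1) a))" unfolding zpow_plus1(1)[OF f] using fun_cong[OF assms(2)] by simp
  finally show ?case using bij_is_inj[OF f] by (simp add: inj_eq)
qed

definition translate :: "int \<Rightarrow> int \<Rightarrow> L \<Rightarrow> L" where "translate m n = zpow T1 m \<circ> zpow T2 n"

lemma tau_mn_translate: "tau_mn m n = translate m n (tau 0)" by (simp add: tau_mn_def translate_def)

lemma diff_auto_translate: "diff_auto (translate m n)"
  unfolding translate_def by (intro diff_auto_comp diff_auto_zpow T_diff_auto)

lemmas T_bij = T_diff_auto[THEN diff_auto_bij]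

lemma translate_T1: "translate m n (T1 f) = translate (m + 1) n f"
  by (simp add: translate_def zpow_commute[OF T_bij(2) T1_T2[symmetric]] zpow_plus1(2)[OF T_bij(1)])

lemma translate_T2: "translate m n (T2 f) = translate m (n + 1) f"
  by (simp add: translate_def zpow_plus1(2)[OF T_bij(2)])

lemma translate_vals: "translate m n gx = gx" "translate m n (alpha 0) = alpha 0 + cL (3 * of_int m)"
  "translate m n (alpha 1) = alpha 1 + cL (3 * of_int n) - cL (3 * of_int m)"
proof -
  note h = field_morphD[OF diff_auto_morph[OF diff_auto_zpow[OF T_diff_auto(1)]]]
  have t: "T1 (alpha 0) = alpha 0 + cL 3" "T1 (alpha 1) = alpha 1 + cL (- 3)" "T2 (alpha 1) = alpha 1 + cL 3"
    by (simp_all only: T1_vals T2_vals cL_numeral cL_hom) simp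
  show "translate m n gx = gx" by (simp add: translate_def zpow_fixed T_bij T1_vals T2_vals)
  show "translate m n (alpha 0) = alpha 0 + cL (3 * of_int m)"
    by (simp add: translate_def zpow_fixed T_bij T2_vals zpow_translation[OF T_diff_auto(1) t(1)] mult.commute)
  show "translate m n (alpha 1) = alpha 1 + cL (3 * of_int n) - cL (3 * of_int m)"
    unfolding translate_def o_apply zpow_translation[OF T_diff_auto(2) t(3)] h zpow_translation[OF T_diff_auto(1) t(2)]
    by (simp add: cL_hom mult.commute)
qed

text \<open>The base identities are transported by \<open>translate (m - 1) n\<close> and
  \<open>translate m (n - 1)\<close>. These are differential automorphisms fixing \<open>gx\<close>,
  so they pass through \<open>toda\<close> and only shift the \<open>alpha\<close> in the
  constant.\<close>

lemma toda_tau_mn: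
  "tau_mn (m + 1) n * tau_mn (m - 1) n = toda ((alpha 0 - alpha 1 + cL (of_int (6 * m - 3 * n - 3))) / 3) (tau_mn m n)"
  "tau_mn m (n + 1) * tau_mn m (n - 1) = toda ((alpha 0 + 2 * alpha 1 + cL (of_int (6 * n - 3 * m - 3))) / 3) (tau_mn m n)"
proof -
  note h = field_morphD[OF diff_auto_morph[OF diff_auto_translate]] field_morph_numeral[OF diff_auto_morph[OF diff_auto_translate]]
  have "tau_mn (m + 1) n * tau_mn (m - 1) n = translate (m - 1) n (T1 (T1 (tau 0)) * tau 0)"
    by (simp add: tau_mn_translate h translate_T1 add.commute)
  also have "\<dots> = toda (translate (m - 1) n ((3 + alpha 0 - alpha 1) / 3)) (tau_mn m n)"
    unfolding toda_T1 toda_diff_auto[OF diff_auto_translate translate_vals(1)] by (simp add: translate_T1 tau_mn_translate)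
  also have "translate (m - 1) n ((3 + alpha 0 - alpha 1) / 3) = (alpha 0 - alpha 1 + cL (of_int (6 * m - 3 * n - 3))) / 3"
    unfolding h translate_vals by (simp add: cL_hom cL_of_int cL_numeral algebra_simps)
  finally show "tau_mn (m + 1) n * tau_mn (m - 1) n = toda ((alpha 0 - alpha 1 + cL (of_int (6 * m - 3 * n - 3))) / 3) (tau_mn m n)" .
  have "tau_mn m (n + 1) * tau_mn m (n - 1) = translate m (n - 1) (T2 (T2 (tau 0)) * tau 0)"
    by (simp add: tau_mn_translate h translate_T2 add.commute)
  also have "\<dots> = toda (translate m (n - 1) ((3 + alpha 0 + 2 * alpha 1) / 3)) (tau_mn m n)"
    unfolding toda_T2 toda_diff_auto[OF diff_auto_translate translate_vals(1)] by (simp add: translate_T2 tau_mn_translate)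
  also have "translate m (n - 1) ((3 + alpha 0 + 2 * alpha 1) / 3) = (alpha 0 + 2 * alpha 1 + cL (of_int (6 * n - 3 * m - 3))) / 3"
    unfolding h translate_vals by (simp add: cL_hom cL_of_int cL_numeral algebra_simps)
  finally show "tau_mn m (n + 1) * tau_mn m (n - 1) = toda ((alpha 0 + 2 * alpha 1 + cL (of_int (6 * n - 3 * m - 3))) / 3) (tau_mn m n)" .
qed

lemma tau_mn_nz: "tau_mn m n \<noteq> 0"
  unfolding tau_mn_translate using field_morphD(9)[OF diff_auto_morph[OF diff_auto_translate]] tau_fF_nz(1) by simp

section \<open>The evaluated Toda equations and their propagation over the lattice\<close>

definition toda_poly :: "complex \<Rightarrow> complex poly \<Rightarrow> complex poly" where
  "toda_poly c Q = Q * pderiv (pderiv Q) - pderiv Q * pderiv Q + [:c, 0, 1:] * (Q * Q)"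

lemma evaluates_to_toda:
  assumes "evaluates_to t Q" "evaluates_to k [:c:]"
  shows "evaluates_to (toda k t) (toda_poly c Q)"
proof -
  have x: "[:c, 0, 1:] = [:0,1:] * [:0,1:] + [:c:]" by simp
  show ?thesis unfolding toda_def toda_poly_def x
    by (intro evaluates_to_ring evaluates_to_DL evaluates_to_gens assms)
qed

lemma evaluates_to_coeff:
  "evaluates_to ((alpha 0 - alpha 1 + cL (of_int (6 * m - 3 * n - 3))) / 3) [:of_int (2 * m - n - 1):]"
  "evaluates_to ((alpha 0 + 2 * alpha 1 + cL (of_int (6 * n - 3 * m - 3))) / 3) [:of_int (2 * n - m):]"
proof -
  have 3: "evaluates_to 3 [:3:]" and 2: "evaluates_to 2 [:2:]"
    using evaluates_to_gens(1)[of 3] evaluates_to_gens(1)[of 2] by (simp_all add: cL_numeral)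
  have "evaluates_to (alpha 0 - alpha 1 + cL (of_int (6 * m - 3 * n - 3))) (1 - 1 + [:of_int (6 * m - 3 * n - 3):])"
    by (intro evaluates_to_ring evaluates_to_gens)
  also have "1 - 1 + [:of_int (6 * m - 3 * n - 3):] = [:of_int (2 * m - n - 1):] * [:3::complex:]" by simp
  finally show "evaluates_to ((alpha 0 - alpha 1 + cL (of_int (6 * m - 3 * n - 3))) / 3) [:of_int (2 * m - n - 1):]"
    by (rule evaluates_to_divide[OF _ 3]) simp
  have "evaluates_to (alpha 0 + 2 * alpha 1 + cL (of_int (6 * n - 3 * m - 3))) (1 + [:2:] * 1 + [:of_int (6 * n - 3 * m - 3):])"
    by (intro evaluates_to_ring evaluates_to_gens 2)
  also have "1 + [:2:] * 1 + [:of_int (6 * n - 3 * m - 3):] = [:of_int (2 * n - m):] * [:3::complex:]"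
    by (simp add: one_pCons)
  finally show "evaluates_to ((alpha 0 + 2 * alpha 1 + cL (of_int (6 * n - 3 * m - 3))) / 3) [:of_int (2 * n - m):]"
    by (rule evaluates_to_divide[OF _ 3]) simp
qed

text \<open>This is where new values come into existence: the known \<open>Q0\<close> is nonzero, so
  \<open>t1\<close> as a quotient has a value, and the given factorisation of
  \<open>toda_poly c Q\<close> shows that this value is the polynomial \<open>Q1\<close>.\<close>

lemma evaluates_to_neighbour:
  assumes "t1 * t0 = toda k t" "evaluates_to k [:c:]" "evaluates_to t Q" "evaluates_to t0 Q0"
    "Q1 * Q0 = toda_poly c Q" "Q0 \<noteq> 0" "t0 \<noteq> 0"
  shows "evaluates_to t1 Q1"
proof -
  have "evaluates_to (toda k t) (Q1 * Q0)" using evaluates_to_toda assms by metis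
  then have "evaluates_to (toda k t / t0) Q1" using assms by (intro evaluates_to_divide)
  moreover have "toda k t / t0 = t1" using assms by (simp add: field_simps)
  ultimately show ?thesis by simp
qed

lemma two_sided_induct:
  fixes P :: "int \<Rightarrow> bool"
  assumes "P 0" "P 1" "\<And>k. P k \<Longrightarrow> P (k - 1) \<Longrightarrow> P (k + 1)" "\<And>k. P k \<Longrightarrow> P (k + 1) \<Longrightarrow> P (k - 1)"
  shows "P k"
proof -
  have "P k \<and> P (k + 1)"
  proof (induction k rule: int_induct[where k = 0])
    case (step1 i) then show ?case using assms(3)[of "i + 1"] by (simp add: add.commute)
  next
    case (step2 i) then show ?case using assms(4)[of i] by simp
  qed (use assms in simp)
  then show ?thesis ..
qed

lemma tau_mn_start: "tau_mn 0 0 = tau 0" "tau_mn 1 0 = tau 1" "tau_mn 1 1 = tau 2" "tau_mn 0 1 = fF 1 * tau 2 * tau 0 / tau 1"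
proof -
  have z: "zpow f 1 = f" for f :: "L \<Rightarrow> L" by (simp add: zpow_def)
  show "tau_mn 0 0 = tau 0" "tau_mn 1 0 = tau 1" by (simp_all add: tau_mn_def zpow_0 z T1_vals)
  show "tau_mn 0 1 = fF 1 * tau 2 * tau 0 / tau 1" by (simp only: tau_mn_def zpow_0 z T2_vals s1_vals id_apply)
  have "tau_mn 1 1 = T2 (T1 (tau 0))" using fun_cong[OF T1_T2, of "tau 0"] by (simp add: tau_mn_def z)
  then show "tau_mn 1 1 = tau 2" by (simp only: T1_vals T2_vals)
qed

text \<open>The Toda equations in the two directions, started from the four points of a unit square, determine all
  evaluations; they also show inductively that the evaluations exist.\<close>

lemma evaluates_to_tau_mn:
  assumes nz: "\<And>m n. R m n \<noteq> 0"
    and start: "R 0 0 = 1" "R 1 0 = 1" "R 1 1 = 1" "R 0 1 = [:0, 1:]"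
    and toda1: "\<And>m n. R (m + 1) n * R (m - 1) n = toda_poly (of_int (2 * m - n - 1)) (R m n)"
    and toda2: "\<And>m n. R m (n + 1) * R m (n - 1) = toda_poly (of_int (2 * n - m)) (R m n)"
  shows "evaluates_to (tau_mn m n) (R m n)"
proof -
  let ?E = "\<lambda>m n. evaluates_to (tau_mn m n) (R m n)"
  \<comment> \<open>The lines \<open>m = 0\<close> and \<open>m = 1\<close> are filled first, in the
    direction of \<open>n\<close>; afterwards every \<open>n\<close> has two consecutive starting
    values in the direction of \<open>m\<close>.\<close>
  have vert: "?E m n" if "?E m 0" "?E m 1" for m n
  proof (rule two_sided_induct[where P = "?E m"])
    fix k
    note st = evaluates_to_coeff(2)[of k m]
    have c: "tau_mn m (k - 1) * tau_mn m (k + 1) = tau_mn m (k + 1) * tau_mn m (k - 1)"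
      "R m (k - 1) * R m (k + 1) = R m (k + 1) * R m (k - 1)" by simp_all
    show "?E m k \<Longrightarrow> ?E m (k - 1) \<Longrightarrow> ?E m (k + 1)"
      by (rule evaluates_to_neighbour[OF toda_tau_mn(2) st _ _ toda2 nz tau_mn_nz])
    show "?E m k \<Longrightarrow> ?E m (k + 1) \<Longrightarrow> ?E m (k - 1)"
      by (rule evaluates_to_neighbour[OF c(1)[THEN trans, OF toda_tau_mn(2)] st _ _ c(2)[THEN trans, OF toda2] nz tau_mn_nz])
  qed (use that in auto)
  have "evaluates_to (fF 1 * tau 2 * tau 0) ((0 - 0 + [:0,1:]) * 1 * 1)"
    unfolding fF_def by (intro evaluates_to_ring evaluates_to_Fp evaluates_to_gens)
  then have "evaluates_to (fF 1 * tau 2 * tau 0 / tau 1) [:0,1:]"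
    by (intro evaluates_to_divide[OF _ evaluates_to_gens(4)]) simp_all
  then have "?E 0 1" by (simp only: tau_mn_start start)
  moreover have "?E 0 0" "?E 1 0" "?E 1 1" by (simp_all only: tau_mn_start start evaluates_to_gens)
  ultimately have E: "?E 0 n" "?E 1 n" for n by (simp_all only: vert)
  show ?thesis
  proof (rule two_sided_induct[where P = "\<lambda>m. ?E m n", OF E])
    fix k
    note st = evaluates_to_coeff(1)[of k n]
    have c: "tau_mn (k - 1) n * tau_mn (k + 1) n = tau_mn (k + 1) n * tau_mn (k - 1) n"
      "R (k - 1) n * R (k + 1) n = R (k + 1) n * R (k - 1) n" by simp_all
    show "?E k n \<Longrightarrow> ?E (k - 1) n \<Longrightarrow> ?E (k + 1) n"
      by (rule evaluates_to_neighbour[OF toda_tau_mn(1) st _ _ toda1 nz tau_mn_nz])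
    show "?E k n \<Longrightarrow> ?E (k + 1) n \<Longrightarrow> ?E (k - 1) n"
      by (rule evaluates_to_neighbour[OF c(1)[THEN trans, OF toda_tau_mn(1)] st _ _ c(2)[THEN trans, OF toda1] nz tau_mn_nz])
  qed
qed

section \<open>Wronskian determinants\<close>

lemma coeff_okp:
  "coeff (okp (int n)) c = (if c \<le> n \<and> even (n - c)
     then (1/2) ^ ((n - c) div 2) / (fact c * fact ((n - c) div 2)) else 0)"
proof -
  let ?S = "{(a,b). a + 2 * b = n}"
  let ?w = "\<lambda>(a,b). (1/2)^b / (fact a * fact b) :: complex"
  have fin: "finite ?S" by (rule finite_subset[of _ "{..n} \<times> {..n}"]) auto
  have "coeff (okp (int n)) c = (\<Sum>x\<in>?S. if fst x = c then ?w x else 0)"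
    unfolding okp_def by (auto simp: coeff_sum case_prod_unfold monom_altdef[of 1, simplified, symmetric] intro!: sum.cong)
  also have "\<dots> = (\<Sum>x\<in>?S \<inter> {x. fst x = c}. ?w x)" using fin by (simp add: sum.inter_restrict)
  also have "?S \<inter> {x. fst x = c} = (if c \<le> n \<and> even (n - c) then {(c, (n - c) div 2)} else {})"
    by (auto; presburger)
  finally show ?thesis by auto
qed

lemma okp_neg: "k < 0 \<Longrightarrow> okp k = 0" by (simp add: okp_def)

lemma okp_0: "okp 0 = 1"
  using coeff_okp[of 0] by (intro poly_eqI) auto

lemma okp_nonneg_cases: "(\<And>n. k = int n \<Longrightarrow> P) \<Longrightarrow> (k < 0 \<Longrightarrow> P) \<Longrightarrow> P"
  by (metis nonneg_int_cases not_le)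

lemma pderiv_okp: "pderiv (okp k) = okp (k - 1)"
proof (rule okp_nonneg_cases[of k])
  fix n assume k: "k = int n"
  show ?thesis
  proof (cases n)
    case 0 then show ?thesis using k by (simp add: okp_0 okp_neg)
  next
    case (Suc m)
    have "coeff (pderiv (okp (int (Suc m)))) c = coeff (okp (int m)) c" for c
      unfolding coeff_pderiv coeff_okp by (auto simp: fact_Suc simp del: of_nat_Suc)
    then show ?thesis using k Suc by (auto intro: poly_eqI)
  qed
qed (simp add: okp_neg)

text \<open>Differentiation of \<open>exp(x z + z^2/2)\<close> in \<open>z\<close>. On coefficients,
  with \<open>n = c + 2 * b\<close>, the two terms on the right carry the weights \<open>c\<close>
  and \<open>2 * b\<close>.\<close>

lemma okp_rec: "of_int k * okp k = [:0,1:] * okp (k - 1) + okp (k - 2)"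
proof (rule okp_nonneg_cases[of k])
  fix n assume k: "k = int n"
  have oi: "(of_int i :: complex poly) = [:of_int i:]" for i by (simp add: of_int_poly)
  consider "n = 0" | "n = 1" | m where "n = Suc (Suc m)" by (metis One_nat_def not0_implies_Suc)
  then show ?thesis
  proof cases
    case 3
    have "of_nat n * coeff (okp (int n)) c = (case c of 0 \<Rightarrow> 0 | Suc d \<Rightarrow> coeff (okp (int (Suc m))) d) + coeff (okp (int m)) c" for c
    proof (cases "c \<le> n \<and> even (n - c)")
      case True
      define b where "b = (n - c) div 2"
      have "even (n - c)" using True by (rule conjunct2)
      then have "2 * b = n - c" unfolding b_def by (rule dvd_mult_div_cancel)
      then have n: "n = c + 2 * b" using True by simp
      have 1: "coeff (okp (int n)) c = (1/2) ^ b / (fact c * fact b)" unfolding coeff_okp b_def by (rule if_P[OF True])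
      have 2: "(case c of 0 \<Rightarrow> 0 | Suc d \<Rightarrow> coeff (okp (int (Suc m))) d) = of_nat c * ((1/2) ^ b / (fact c * fact b))"
      proof (cases c)
        case (Suc d)
        have "d \<le> Suc m" "even (Suc m - d)" "(Suc m - d) div 2 = b" using n 3 Suc by auto
        then have "coeff (okp (int (Suc m))) d = (1/2) ^ b / (fact d * fact b)" unfolding coeff_okp by simp
        then show ?thesis using Suc by (simp add: fact_Suc del: of_nat_Suc)
      qed simp
      have 4: "coeff (okp (int m)) c = 2 * of_nat b * ((1/2) ^ b / (fact c * fact b))"
      proof (cases b)
        case 0 then show ?thesis using n 3 unfolding coeff_okp by simp
      next
        case (Suc e)
        have "c \<le> m" "even (m - c)" "(m - c) div 2 = e" using n 3 Suc by auto
        then have "coeff (okp (int m)) c = (1/2) ^ e / (fact c * fact e)" unfolding coeff_okp by simp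
        then show ?thesis using Suc by (simp add: fact_Suc del: of_nat_Suc)
      qed
      have "(of_nat n :: complex) = of_nat c + 2 * of_nat b" by (simp add: n)
      then show ?thesis unfolding 1 2 4 by (simp only: distrib_right)
    next
      case False
      have "(case c of 0 \<Rightarrow> 0 | Suc d \<Rightarrow> coeff (okp (int (Suc m))) d) = 0"
        using False 3 unfolding coeff_okp by (auto split: nat.split)
      moreover have "coeff (okp (int m)) c = 0" using False 3 unfolding coeff_okp by auto
      moreover have "coeff (okp (int n)) c = 0" using False unfolding coeff_okp by auto
      ultimately show ?thesis by simp
    qed
    then have "smult (of_nat n) (okp (int n)) = pCons 0 (okp (int (Suc m))) + okp (int m)"
      by (intro poly_eqI) (simp add: coeff_pCons split: nat.split del: of_nat_Suc)
    moreover have "of_int k * okp k = smult (of_nat n) (okp (int n))" by (simp add: k of_nat_poly)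
    moreover have "okp (k - 1) = okp (int (Suc m))" "okp (k - 2) = okp (int m)" using k 3 by simp_all
    ultimately show ?thesis by simp
  next
    case 2
    have "coeff (okp 1) c = coeff [:0,1:] c" for c
      using coeff_okp[of 1 c] by (cases c) (auto simp: coeff_pCons split: nat.split)
    then have "okp 1 = [:0,1:]" by (rule poly_eqI)
    then show ?thesis using k 2 by (simp add: okp_0 okp_neg)
  qed (use k in \<open>simp add: okp_neg\<close>)
qed (simp add: okp_neg)

lemma okp_1: "okp 1 = [:0, 1:]"
  using okp_rec[of 1] by (simp add: okp_0 okp_neg)

lemma okp_2: "okp 2 = [:1/2, 0, 1/2:]"
proof -
  have "smult 2 (okp 2) = [:1, 0, 1:]" using okp_rec[of 2] by (simp add: okp_0 okp_1 one_pCons numeral_poly)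
  then have "smult (1/2) (smult 2 (okp 2)) = smult (1/2) [:1, 0, 1:]" by (rule arg_cong)
  then show ?thesis by simp
qed

lemma okp_3: "okp 3 = [:0, 1/2, 0, 1/6:]"
proof -
  have "smult 3 (okp 3) = [:0, 3/2, 0, 1/2:]" using okp_rec[of 3] by (simp add: okp_2 okp_1 numeral_poly)
  then have "smult (1/3) (smult 3 (okp 3)) = smult (1/3) [:0, 3/2, 0, 1/2:]" by (rule arg_cong)
  then show ?thesis by simp
qed

section \<open>Derivatives of determinants and Cramer coefficients\<close>

lemma pderiv_sum: "pderiv (sum f I) = (\<Sum>i\<in>I. pderiv (f i))"
  by (induction I rule: infinite_finite_induct) (simp_all add: pderiv_add)

lemma det_repl_row:
  fixes A :: "'a::comm_ring_1 mat"
  assumes A: "A \<in> carrier_mat n n" and i: "i < n"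
  shows "det (mat n n (\<lambda>(r,c). if r = i then v c else A $$ (r,c))) = (\<Sum>j<n. v j * cofactor A i j)"
proof -
  let ?B = "mat n n (\<lambda>(r,c). if r = i then v c else A $$ (r,c))"
  have "mat_delete ?B i j = mat_delete A i j" if "j < n" for j
    by (rule eq_matI) (use A i that in \<open>auto simp: mat_delete_def\<close>)
  then have "cofactor ?B i j = cofactor A i j" if "j < n" for j using that by (simp add: cofactor_def)
  moreover have "det ?B = (\<Sum>j<n. ?B $$ (i,j) * cofactor ?B i j)" by (rule laplace_expansion_row) (use i in auto)
  ultimately show ?thesis using i by simp
qed

lemma pderiv_det:
  fixes A :: "'a::idom poly mat"
  assumes A: "A \<in> carrier_mat n n"
  shows "pderiv (det A) = (\<Sum>i<n. \<Sum>j<n. pderiv (A $$ (i,j)) * cofactor A i j)"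
proof -
  have s: "pderiv (signof p * q) = signof p * pderiv q" for p :: "nat \<Rightarrow> nat" and q :: "'a poly"
    by (simp add: sign_def pderiv_minus)
  have P: "(\<Prod>r\<in>{0..<n} - {i}. A $$ (r, p r)) * pderiv (A $$ (i, p i))
     = (\<Prod>r = 0..<n. mat n n (\<lambda>(r,c). if r = i then pderiv (A $$ (i,c)) else A $$ (r,c)) $$ (r, p r))"
    if i: "i < n" and p: "p permutes {0..<n}" for i p
  proof -
    have pr: "p r < n" if "r < n" for r using permutes_in_image[OF p, of r] that by simp
    have "{0..<n} = insert i ({0..<n} - {i})" using i by auto
    then have "(\<Prod>r = 0..<n. mat n n (\<lambda>(r,c). if r = i then pderiv (A $$ (i,c)) else A $$ (r,c)) $$ (r, p r))
       = mat n n (\<lambda>(r,c). if r = i then pderiv (A $$ (i,c)) else A $$ (r,c)) $$ (i, p i)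
         * (\<Prod>r\<in>{0..<n} - {i}. mat n n (\<lambda>(r,c). if r = i then pderiv (A $$ (i,c)) else A $$ (r,c)) $$ (r, p r))"
      by (metis (no_types, lifting) Diff_iff finite_Diff finite_atLeastLessThan insertI1 prod.insert_remove insert_Diff_single)
    then show ?thesis using i pr by (simp add: mult.commute)
  qed
  have "pderiv (det A) = (\<Sum>p | p permutes {0..<n}. signof p * (\<Sum>i<n. (\<Prod>r\<in>{0..<n} - {i}. A $$ (r, p r)) * pderiv (A $$ (i, p i))))"
    unfolding det_def'[OF A] by (simp add: pderiv_sum s pderiv_prod lessThan_atLeast0)
  also have "\<dots> = (\<Sum>i<n. \<Sum>p | p permutes {0..<n}. signof p * ((\<Prod>r\<in>{0..<n} - {i}. A $$ (r, p r)) * pderiv (A $$ (i, p i))))"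
    unfolding sum_distrib_left by (rule sum.swap)
  also have "\<dots> = (\<Sum>i<n. det (mat n n (\<lambda>(r,c). if r = i then pderiv (A $$ (i,c)) else A $$ (r,c))))"
    by (intro sum.cong refl) (auto simp: P det_def'[OF mat_carrier] intro!: sum.cong)
  also have "\<dots> = (\<Sum>i<n. \<Sum>j<n. pderiv (A $$ (i,j)) * cofactor A i j)"
    by (intro sum.cong refl det_repl_row[OF A]) auto
  finally show ?thesis .
qed

text \<open>By \<open>pderiv_okp\<close>, column \<open>j\<close> is the \<open>j\<close>-th
  derivative of column \<open>0\<close>, so \<open>wdet\<close> is a Wronskian.\<close>

definition wmat :: "nat list \<Rightarrow> complex poly mat" where
  "wmat hs = mat (length hs) (length hs) (\<lambda>(i,j). okp (int (hs ! i) - int j))"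

definition wdet :: "nat list \<Rightarrow> complex poly" where "wdet hs = det (wmat hs)"

lemma wmat_carrier: "wmat hs \<in> carrier_mat (length hs) (length hs)"
  by (simp add: wmat_def)

text \<open>By expansion along column \<open>j\<close>: the determinant of \<open>wmat hs\<close>
  with that column replaced by \<open>v\<close>.\<close>

definition cramer :: "nat list \<Rightarrow> (nat \<Rightarrow> complex poly) \<Rightarrow> nat \<Rightarrow> complex poly" where
  "cramer hs v j = (\<Sum>i<length hs. v i * cofactor (wmat hs) i j)"

lemma cramer_linear:
  "cramer hs (\<lambda>i. v i + w i) j = cramer hs v j + cramer hs w j"
  "cramer hs (\<lambda>i. c * v i) j = c * cramer hs v j"
  by (simp_all add: cramer_def algebra_simps sum.distrib sum_distrib_left)

lemma cramer_column:
  assumes "k < length hs" "j < length hs"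
  shows "cramer hs (\<lambda>i. okp (int (hs ! i) - int k)) j = (if k = j then wdet hs else 0)"
proof -
  let ?n = "length hs" and ?A = "wmat hs"
  note A = wmat_carrier[of hs]
  have "(adj_mat ?A * ?A) $$ (j, k) = (\<Sum>i<?n. cofactor ?A i j * ?A $$ (i, k))"
    using A assms adj_mat(1)[OF A]
    by (simp add: times_mat_def scalar_prod_def adj_mat_def lessThan_atLeast0)
  also have "\<dots> = cramer hs (\<lambda>i. okp (int (hs ! i) - int k)) j"
    unfolding cramer_def using assms by (intro sum.cong) (auto simp: wmat_def)
  finally show ?thesis using adj_mat(3)[OF A] assms by (cases "k = j") (auto simp: wdet_def)
qed

text \<open>Cramer's rule without division: the vector \<open>cramer hs v\<close> is mapped by
  \<open>wmat hs\<close> to \<open>wdet hs\<close> times \<open>v\<close>. Rows with small entries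
  make this system triangular, which is exploited in \<open>weighted_raise\<close>.\<close>

lemma cramer_row:
  assumes "r < length hs"
  shows "(\<Sum>j<length hs. okp (int (hs ! r) - int j) * cramer hs v j) = wdet hs * v r"
proof -
  let ?n = "length hs" and ?A = "wmat hs"
  note A = wmat_carrier[of hs]
  have *: "(\<Sum>j<?n. okp (int (hs ! r) - int j) * cofactor ?A i j) = (if r = i then wdet hs else 0)" if "i < ?n" for i
  proof -
    have "(?A * adj_mat ?A) $$ (r, i) = (\<Sum>j<?n. ?A $$ (r, j) * cofactor ?A i j)"
      using A assms that adj_mat(1)[OF A]
      by (simp add: times_mat_def scalar_prod_def adj_mat_def lessThan_atLeast0)
    also have "\<dots> = (\<Sum>j<?n. okp (int (hs ! r) - int j) * cofactor ?A i j)"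
      using assms by (intro sum.cong) (auto simp: wmat_def)
    finally show ?thesis using adj_mat(2)[OF A] assms that by (cases "r = i") (auto simp: wdet_def)
  qed
  have "(\<Sum>j<?n. okp (int (hs ! r) - int j) * cramer hs v j)
      = (\<Sum>i<?n. v i * (\<Sum>j<?n. okp (int (hs ! r) - int j) * cofactor ?A i j))"
    unfolding cramer_def sum_distrib_left by (subst sum.swap) (simp add: algebra_simps)
  also have "\<dots> = (\<Sum>i<?n. if r = i then v i * wdet hs else 0)" using * by (intro sum.cong) auto
  finally show ?thesis using assms by (simp add: mult.commute)
qed

text \<open>Differentiating column \<open>j\<close> turns it into column \<open>j + 1\<close>. A
  repeated column kills the term for every \<open>j\<close> except the last.\<close>

lemma pderiv_wdet:
  assumes "hs \<noteq> []"
  shows "pderiv (wdet hs) = cramer hs (\<lambda>i. okp (int (hs ! i) - int (length hs))) (length hs - 1)"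
proof -
  let ?n = "length hs"
  have "pderiv (wdet hs) = (\<Sum>i<?n. \<Sum>j<?n. okp (int (hs ! i) - int (j + 1)) * cofactor (wmat hs) i j)"
    unfolding wdet_def pderiv_det[OF wmat_carrier]
    by (intro sum.cong refl) (auto simp: wmat_def pderiv_okp algebra_simps)
  also have "\<dots> = (\<Sum>j<?n. cramer hs (\<lambda>i. okp (int (hs ! i) - int (j + 1))) j)"
    unfolding cramer_def by (rule sum.swap)
  also have "\<dots> = (\<Sum>j<?n. if j = ?n - 1 then cramer hs (\<lambda>i. okp (int (hs ! i) - int (j + 1))) j else 0)"
    by (rule sum.cong) (auto simp: cramer_column simp del: of_nat_add of_nat_Suc)
  also have "\<dots> = cramer hs (\<lambda>i. okp (int (hs ! i) - int (?n - 1 + 1))) (?n - 1)"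
    using assms by (subst sum.delta) auto
  finally show ?thesis using assms by simp
qed

lemma wdet_update:
  assumes "i < length hs"
  shows "wdet (hs[i := h]) = (\<Sum>j<length hs. okp (int h - int j) * cofactor (wmat hs) i j)"
proof -
  have "wmat (hs[i := h]) = mat (length hs) (length hs) (\<lambda>(r,c). if r = i then okp (int h - int c) else wmat hs $$ (r,c))"
    by (rule eq_matI) (auto simp: wmat_def)
  then show ?thesis unfolding wdet_def using det_repl_row[OF wmat_carrier assms] by simp
qed

text \<open>Both sides are the same double sum of entries times cofactors. Trading rows for columns
  is the decisive move: a weight polynomial in the row label becomes, by \<open>okp_rec\<close>, a
  combination of shifted columns.\<close>

lemma weighted_row_sum:
  "(\<Sum>i<length hs. w i * wdet (hs[i := g i])) = (\<Sum>j<length hs. cramer hs (\<lambda>i. w i * okp (int (g i) - int j)) j)"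
proof -
  have "(\<Sum>i<length hs. w i * wdet (hs[i := g i]))
     = (\<Sum>i<length hs. \<Sum>j<length hs. w i * okp (int (g i) - int j) * cofactor (wmat hs) i j)"
    by (intro sum.cong refl) (simp add: wdet_update sum_distrib_left mult.assoc)
  then show ?thesis unfolding cramer_def by (subst (asm) sum.swap)
qed

text \<open>By \<open>okp_rec\<close>, multiplication by \<open>a\<close> acts on
  \<open>okp (a - k)\<close> as \<open>k\<close> plus \<open>X\<close> times a shift by one plus a
  shift by two; this is applied twice.\<close>

lemma okp_quadratic_weight:
  fixes \<alpha> \<beta> \<gamma> :: "complex poly" and a k :: int
  defines "X \<equiv> [:0, 1:]"
  shows "(\<alpha> * of_int a ^ 2 + \<beta> * of_int a + \<gamma>) * okp (a - k) =
    (\<alpha> * of_int k ^ 2 + \<beta> * of_int k + \<gamma>) * okp (a - k) + (\<alpha> * (2 * of_int k + 1) + \<beta>) * X * okp (a - (k + 1))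
    + (\<alpha> * (2 * of_int k + 2) + \<alpha> * X * X + \<beta>) * okp (a - (k + 2)) + 2 * \<alpha> * X * okp (a - (k + 3)) + \<alpha> * okp (a - (k + 4))"
proof -
  have r: "of_int a * okp (a - j) = of_int j * okp (a - j) + X * okp (a - (j + 1)) + okp (a - (j + 2))" for j
    using okp_rec[of "a - j"] unfolding X_def by (simp add: algebra_simps)
  define A where "A = (of_int a :: complex poly)"
  define K where "K = (of_int k :: complex poly)"
  define y where "y i = okp (a - (k + i))" for i
  have R: "A * y i = (K + of_int i) * y i + X * y (i + 1) + y (i + 2)" for i
    using r[of "k + i"] unfolding A_def K_def y_def by (simp add: algebra_simps)
  have R0: "A * y 0 = K * y 0 + X * y 1 + y 2" using R[of 0] by simp
  have R1: "A * y 1 = (K + 1) * y 1 + X * y 2 + y 3" using R[of 1] by simp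
  have R2: "A * y 2 = (K + 2) * y 2 + X * y 3 + y 4" using R[of 2] by simp
  have "A * (A * y 0) = A * (K * y 0 + X * y 1 + y 2)" by (rule arg_cong[OF R0])
  also have "\<dots> = K * (A * y 0) + X * (A * y 1) + A * y 2" by (simp add: algebra_simps)
  also have "\<dots> = K * K * y 0 + (2 * K + 1) * X * y 1 + (2 * K + 2 + X * X) * y 2 + 2 * X * y 3 + y 4"
    unfolding R0 R1 R2 by (simp add: algebra_simps)
  finally have RR: "A * (A * y 0) = \<dots>" .
  have "(\<alpha> * A ^ 2 + \<beta> * A + \<gamma>) * y 0 = \<alpha> * (A * (A * y 0)) + \<beta> * (A * y 0) + \<gamma> * y 0"
    by (simp add: power2_eq_square algebra_simps)
  also have "\<dots> = (\<alpha> * K ^ 2 + \<beta> * K + \<gamma>) * y 0 + (\<alpha> * (2 * K + 1) + \<beta>) * X * y 1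
    + (\<alpha> * (2 * K + 2) + \<alpha> * X * X + \<beta>) * y 2 + 2 * \<alpha> * X * y 3 + \<alpha> * y 4"
    unfolding RR unfolding R0 by (simp add: power2_eq_square algebra_simps)
  finally show ?thesis unfolding A_def K_def y_def by simp
qed

lemma length_ge_3:
  assumes "{0, 1, 2} \<subseteq> set (hs :: nat list)" shows "length hs \<ge> 3"
proof -
  have "card {0, 1, 2 :: nat} \<le> card (set hs)" by (rule card_mono) (use assms in auto)
  also have "\<dots> \<le> length hs" by (rule card_length)
  finally show ?thesis by simp
qed

text \<open>Fermionically: the operators that move a particle three steps up with weights \<open>1\<close>, \<open>h\<close>, \<open>h\<^sup>2\<close>
  act on the tau function as multiplication by \<open>3 t\<^sub>3 = 0\<close>, as a Virasoro operator and as a \<open>W\<^sub>3\<close>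
  operator, which at \<open>t = (x, 1/2, 0, \<dots>)\<close> reduce to first order operators in \<open>x\<close>.\<close>

lemma weighted_raise:
  fixes \<alpha> \<beta> \<gamma> :: "complex poly"
  assumes hs: "{0, 1, 2} \<subseteq> set hs"
  shows "(\<Sum>i<length hs. (\<alpha> * of_nat (hs ! i) ^ 2 + \<beta> * of_nat (hs ! i) + \<gamma>) * wdet (hs[i := hs ! i + 3]))
    = \<alpha> * pderiv (wdet hs) + (\<alpha> * [:0, 2 * of_nat (length hs) - 4, 0, 1/3:] + \<beta> * [:0, 1:]) * wdet hs"
proof -
  define N where "N = length hs"
  define W where "W = wdet hs"
  define X where "X = [:0, 1 :: complex:]"
  define C where "C k j = cramer hs (\<lambda>i. okp (int (hs ! i) - k)) j" for k :: int and j
  have N3: "N \<ge> 3" unfolding N_def using length_ge_3[OF hs] .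
  have C: "C (int k) j = (if k = j then W else 0)" if "k < N" "j < N" for k j
    unfolding C_def W_def using cramer_column[of k hs j] that by (simp add: N_def)
  have "hs \<noteq> []" using N3 by (auto simp: N_def)
  then have dW: "pderiv W = C (int N) (N - 1)"
    unfolding W_def C_def N_def by (rule pderiv_wdet)
  have row: "(\<Sum>j<N. okp (int h - int j) * C k j) = W * okp (int h - k)" if h: "h \<in> set hs" for h k
  proof -
    from h obtain r where "r < N" "hs ! r = h" by (auto simp: N_def in_set_conv_nth)
    then show ?thesis using cramer_row[of r hs "\<lambda>i. okp (int (hs ! i) - k)"] by (simp add: N_def C_def W_def)
  qed
  \<comment> \<open>The rows labelled \<open>0\<close>, \<open>1\<close>, \<open>2\<close> vanish
    beyond the diagonal, so they determine \<open>C k 0\<close>, \<open>C k 1\<close>,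
    \<open>C k 2\<close> successively, for negative \<open>k\<close> as well.\<close>
  have row': "(\<Sum>j\<le>h. okp (int h - int j) * C k j) = W * okp (int h - k)" if h: "h \<in> {0,1,2}" for h k
  proof -
    have "(\<Sum>j\<le>h. okp (int h - int j) * C k j) = (\<Sum>j<N. okp (int h - int j) * C k j)"
      by (rule sum.mono_neutral_left) (use h N3 in \<open>auto simp: okp_neg\<close>)
    then show ?thesis using row[of h k] h hs by auto
  qed
  have e0: "C k 0 = W * okp (- k)" for k using row'[of 0 k] by (simp add: okp_0)
  have e1: "C k 1 = W * (okp (1 - k) - okp 1 * okp (- k))" for k
    using row'[of 1 k] by (simp add: okp_0 e0 atMost_Suc algebra_simps)
  have e2: "C k 2 = W * (okp (2 - k) - okp 1 * (okp (1 - k) - okp 1 * okp (- k)) - okp 2 * okp (- k))" for k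
    using row'[of 2 k] by (simp add: okp_0 e0 e1[simplified] atMost_Suc numeral_2_eq_2[symmetric] algebra_simps)
       (simp add: numeral_2_eq_2 atMost_Suc okp_0 e0 e1[simplified] algebra_simps)
  define c where "c k = \<alpha> * of_int k ^ 2 + \<beta> * of_int k + \<gamma>" for k :: int
  define c1 where "c1 k = (\<alpha> * (2 * of_int k + 1) + \<beta>) * X" for k :: int
  define c2 where "c2 k = \<alpha> * (2 * of_int k + 2) + \<alpha> * X * X + \<beta>" for k :: int
  define w where "w i = \<alpha> * of_nat (hs ! i) ^ 2 + \<beta> * of_nat (hs ! i) + \<gamma>" for i
  \<comment> \<open>The boundary terms: raising by three refers to columns of negative index, and
    this happens only for \<open>j < 3\<close>.\<close>
  define e where "e j = (if j = 0 then c (-3) * C (-3) 0 + c1 (-3) * C (-2) 0 + c2 (-3) * C (-1) 0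
     else if j = 1 then c (-2) * C (-2) 1 + c1 (-2) * C (-1) 1 else if j = 2 then c (-1) * C (-1) 2 else 0)" for j :: nat
  have main: "cramer hs (\<lambda>i. w i * okp (int (hs ! i + 3) - int j)) j
      = e j + (2 * \<alpha> * X * W + (if j = N - 1 then \<alpha> * pderiv W else 0))" if j: "j < N" for j
  proof -
    \<comment> \<open>The raised entry is \<open>okp (h - k)\<close>. Of the five shifted columns,
      \<open>k + 3\<close> is column \<open>j\<close> itself and gives \<open>W\<close>;
      \<open>k + 4\<close> is the next one and survives only at the right edge, as
      \<open>pderiv W\<close>; the three others vanish unless their index is negative.\<close>
    define k where "k = int j - 3"
    have "w i * okp (int (hs ! i + 3) - int j) = c k * okp (int (hs ! i) - k) + c1 k * okp (int (hs ! i) - (k + 1))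
       + c2 k * okp (int (hs ! i) - (k + 2)) + 2 * \<alpha> * X * okp (int (hs ! i) - (k + 3)) + \<alpha> * okp (int (hs ! i) - (k + 4))" for i
      using okp_quadratic_weight[of \<alpha> "int (hs ! i)" \<beta> \<gamma> k]
      unfolding c_def c1_def c2_def w_def X_def k_def by (simp add: algebra_simps)
    then have "cramer hs (\<lambda>i. w i * okp (int (hs ! i + 3) - int j)) j = c k * C k j + c1 k * C (k + 1) j
       + c2 k * C (k + 2) j + 2 * \<alpha> * X * C (k + 3) j + \<alpha> * C (k + 4) j"
      unfolding C_def by (simp only: cramer_linear)
    also have "C (k + 3) j = W" using C[of j j] j by (simp add: k_def)
    also have "\<alpha> * C (k + 4) j = (if j = N - 1 then \<alpha> * pderiv W else 0)"
      using C[of "j + 1" j] j dW by (auto simp: k_def add.commute)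
    also have "c k * C k j + c1 k * C (k + 1) j + c2 k * C (k + 2) j = e j"
    proof -
      have z: "C (k + i) j = 0" if "0 \<le> k + i" "i < 3" for i
        using C[of "nat (k + i)" j] j that by (simp add: k_def)
      consider "j = 0" | "j = 1" | "j = 2" | "j \<ge> 3" by linarith
      then show ?thesis
      proof cases
        case 1 then show ?thesis by (simp add: e_def k_def)
      next
        case 2 then show ?thesis using z[of 2] by (simp add: e_def k_def)
      next
        case 3 then show ?thesis using z[of 1] z[of 2] by (simp add: e_def k_def)
      next
        case 4 then show ?thesis using z[of 0] z[of 1] z[of 2] by (simp add: e_def k_def)
      qed
    qed
    finally show ?thesis by (simp add: algebra_simps)
  qed
  have "(\<Sum>i<N. w i * wdet (hs[i := hs ! i + 3])) = (\<Sum>j<N. cramer hs (\<lambda>i. w i * okp (int (hs ! i + 3) - int j)) j)"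
    unfolding N_def by (rule weighted_row_sum)
  also have "\<dots> = (\<Sum>j<N. e j + (2 * \<alpha> * X * W + (if j = N - 1 then \<alpha> * pderiv W else 0)))"
    by (rule sum.cong) (use main in auto)
  also have "\<dots> = (\<Sum>j<N. e j) + (of_nat N * (2 * \<alpha> * X * W) + \<alpha> * pderiv W)"
    using N3 by (simp add: sum.distrib)
  also have "(\<Sum>j<N. e j) = (\<Sum>j<3. e j)"
    by (rule sum.mono_neutral_right) (use N3 in \<open>auto simp: e_def\<close>)
  also have "(\<Sum>j<3. e j) = e 0 + e 1 + e 2" by (simp add: numeral_3_eq_3 numeral_2_eq_2)
  also have "\<dots> = (\<alpha> * [:0, -4, 0, 1/3:] + \<beta> * [:0, 1:]) * W"
  proof -
    define P where "P = okp 2"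
    define Q where "Q = okp 3"
    have "e 0 + e 1 + e 2 = W * (\<alpha> * (9 * Q - 5 * X * P - 4 * X + X ^ 3 + 4 * (Q - X * P) - 3 * X * (P - X * X) + Q - X * P - X * (P - X * X))
       + \<beta> * (- 3 * Q + X * P + X - 2 * (Q - X * P) + X * (P - X * X) - Q + X * P + X * (P - X * X))
       + \<gamma> * (3 * Q - 3 * X * P + X ^ 3))"
      unfolding e_def e0 e1 e2 c_def c1_def c2_def
      by (simp add: P_def[symmetric] Q_def[symmetric] okp_1 X_def[symmetric] power2_eq_square power3_eq_cube algebra_simps)
    also have "9 * Q - 5 * X * P - 4 * X + X ^ 3 + 4 * (Q - X * P) - 3 * X * (P - X * X) + Q - X * P - X * (P - X * X) = [:0, -4, 0, 1/3:]"
      by (simp add: P_def Q_def X_def okp_2 okp_3 numeral_poly power3_eq_cube)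
    also have "- 3 * Q + X * P + X - 2 * (Q - X * P) + X * (P - X * X) - Q + X * P + X * (P - X * X) = [:0, 1:]"
      by (simp add: P_def Q_def X_def okp_2 okp_3 numeral_poly)
    \<comment> \<open>Newton's expression for the third power sum in the complete functions, that is
      \<open>3 t_3\<close>, which is zero at this point.\<close>
    also have "3 * Q - 3 * X * P + X ^ 3 = 0"
      by (simp add: P_def Q_def X_def okp_2 okp_3 numeral_poly power3_eq_cube)
    finally show ?thesis by simp
  qed
  finally have "(\<Sum>i<N. w i * wdet (hs[i := hs ! i + 3])) = \<dots> + (of_nat N * (2 * \<alpha> * X * W) + \<alpha> * pderiv W)" .
  also have "\<dots> = \<alpha> * pderiv W + (\<alpha> * ([:0, -4, 0, 1/3:] + of_nat N * (2 * X)) + \<beta> * [:0, 1:]) * W"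
    by (simp add: algebra_simps)
  also have "[:0, -4, 0, 1/3:] + of_nat N * (2 * X) = [:0, 2 * of_nat N - 4, 0, 1/3:]"
    by (simp add: X_def of_nat_poly numeral_poly)
  finally show ?thesis unfolding w_def W_def N_def .
qed

lemma wdet_not_distinct:
  assumes "\<not> distinct hs" shows "wdet hs = 0"
proof -
  from assms obtain i j where ij: "i < length hs" "j < length hs" "i \<noteq> j" "hs ! i = hs ! j"
    by (auto simp: distinct_conv_nth)
  have "row (wmat hs) i = row (wmat hs) j" by (rule eq_vecI) (use ij in \<open>auto simp: wmat_def\<close>)
  then show ?thesis unfolding wdet_def using det_identical_rows[OF wmat_carrier ij(3,1,2)] by simp
qed

text \<open>The weight \<open>(h - h1) * (h - h2)\<close> removes the rows \<open>h1\<close> and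
  \<open>h2\<close>; every other row of \<open>B\<close> collides when raised and gives a
  determinant with equal rows. Only \<open>f\<close> is left in
  \<open>weighted_raise\<close>.\<close>

lemma wdet_raise:
  assumes hs: "{0, 1, 2} \<subseteq> set (B @ [f])"
    and B: "\<And>h. h \<in> set B \<Longrightarrow> h = h1 \<or> h = h2 \<or> h + 3 \<in> set (B @ [f])"
  shows "[:(of_nat f - of_nat h1) * (of_nat f - of_nat h2):] * wdet (B @ [f + 3])
    = pderiv (wdet (B @ [f])) + [:0, 2 * of_nat (length B) - 2 - of_nat h1 - of_nat h2, 0, 1/3:] * wdet (B @ [f])"
proof -
  let ?hs = "B @ [f]"
  define w where "w h = (1::complex poly) * of_nat h ^ 2 + (- of_nat h1 - of_nat h2) * of_nat h + of_nat h1 * of_nat h2" for h :: nat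
  have w: "w h = (of_nat h - of_nat h1) * (of_nat h - of_nat h2)" for h
    by (simp add: w_def power2_eq_square algebra_simps)
  have z: "w (B ! i) * wdet (?hs[i := B ! i + 3]) = 0" if i: "i < length B" for i
  proof (cases "B ! i = h1 \<or> B ! i = h2")
    case False
    then have "B ! i + 3 \<in> set ?hs" using B[of "B ! i"] i by auto
    then obtain k where k: "k < length ?hs" "?hs ! k = B ! i + 3" by (metis in_set_conv_nth)
    have "k \<noteq> i" using k i by (auto simp: nth_append)
    then have "?hs[i := B ! i + 3] ! k = ?hs[i := B ! i + 3] ! i" using k i by (simp add: nth_append)
    then have "\<not> distinct (?hs[i := B ! i + 3])" using k i \<open>k \<noteq> i\<close>
      by (metis distinct_conv_nth length_append_singleton length_list_update less_SucI)
    then show ?thesis using wdet_not_distinct by simp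
  qed (auto simp: w)
  have "(\<Sum>i<length ?hs. w (?hs ! i) * wdet (?hs[i := ?hs ! i + 3])) = w f * wdet (B @ [f + 3])"
  proof -
    have "(\<Sum>i<length B. w (?hs ! i) * wdet (?hs[i := ?hs ! i + 3])) = 0"
      by (rule sum.neutral) (use z in \<open>auto simp: nth_append\<close>)
    then show ?thesis by (simp add: nth_append list_update_append)
  qed
  moreover have "w f = [:(of_nat f - of_nat h1) * (of_nat f - of_nat h2):]"
    unfolding w by (simp add: of_nat_poly)
  moreover have "(1 * [:0, 2 * of_nat (length ?hs) - 4, 0, 1/3:] + (- of_nat h1 - of_nat h2) * [:0, 1:])
    = [:0, 2 * of_nat (length B) - 2 - of_nat h1 - of_nat h2, 0, 1/3 :: complex:]"
    by (simp add: of_nat_poly)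
  ultimately show ?thesis using weighted_raise[OF hs, of 1 "- of_nat h1 - of_nat h2" "of_nat h1 * of_nat h2", folded w_def]
    by simp
qed

section \<open>Jacobi's determinant identity\<close>

lemma det_two: assumes A: "A \<in> carrier_mat 2 2" shows "det A = A $$ (0,0) * A $$ (1,1) - A $$ (0,1) * A $$ (1,0)"
proof -
  have c: "mat_delete A 0 j \<in> carrier_mat 1 1" if "j < 2" for j using A that by (auto simp: mat_delete_def)
  have "det A = (\<Sum>j<2. A $$ (0,j) * cofactor A 0 j)" by (rule laplace_expansion_row[OF A]) simp
  also have "\<dots> = A $$ (0,0) * cofactor A 0 0 + A $$ (0,1) * cofactor A 0 1" by (simp add: numeral_2_eq_2)
  finally have "det A = A $$ (0,0) * cofactor A 0 0 + A $$ (0,1) * cofactor A 0 1" .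
  moreover have "cofactor A 0 0 = A $$ (1,1)" "cofactor A 0 1 = - A $$ (1,0)"
    using det_single[OF c[of 0]] det_single[OF c[of 1]] A by (auto simp: cofactor_def mat_delete_def)
  ultimately show ?thesis by simp
qed

text \<open>Desnanot--Jacobi, from multiplying \<open>M\<close> by the identity matrix with its last two columns replaced by
  those of the adjugate.\<close>

lemma desnanot_jacobi:
  fixes M :: "'a::idom mat"
  assumes M: "M \<in> carrier_mat (n + 2) (n + 2)" and nz: "det M \<noteq> 0"
  shows "det M * det (mat n n (\<lambda>(i,j). M $$ (i,j)))
    = cofactor M n n * cofactor M (n+1) (n+1) - cofactor M (n+1) n * cofactor M n (n+1)"
proof -
  let ?A = "mat n n (\<lambda>(i,j). M $$ (i,j))"
  define P where "P = mat n 2 (\<lambda>(i,j). cofactor M (n + j) i)"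
  define Y where "Y = mat 2 2 (\<lambda>(i,j). cofactor M (n + j) (n + i))"
  define Z where "Z = four_block_mat (1\<^sub>m n) P (0\<^sub>m 2 n) Y"
  define R where "R = mat 2 n (\<lambda>(i,j). M $$ (n + i, j))"
  have Z: "Z \<in> carrier_mat (n + 2) (n + 2)"
    unfolding Z_def by (rule four_block_carrier_mat) (auto simp: Y_def)
  have dZ: "det Z = det Y" unfolding Z_def
    by (subst det_four_block_mat_lower_left_zero[of _ n _ 2]) (auto simp: P_def Y_def)
  have adj: "(\<Sum>k<n + 2. M $$ (i, k) * cofactor M j k) = (if i = j then det M else 0)" if "i < n + 2" "j < n + 2" for i j
  proof -
    have "(M * adj_mat M) $$ (i, j) = (\<Sum>k<n + 2. M $$ (i, k) * cofactor M j k)"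
      using M that adj_mat(1)[OF M]
      by (simp add: times_mat_def scalar_prod_def adj_mat_def lessThan_atLeast0)
    then show ?thesis using adj_mat(2)[OF M] that by (cases "i = j") auto
  qed
  have "M * Z = four_block_mat ?A (0\<^sub>m n 2) R (det M \<cdot>\<^sub>m 1\<^sub>m 2)"
  proof (rule eq_matI)
    fix i j assume "i < dim_row (four_block_mat ?A (0\<^sub>m n 2) R (det M \<cdot>\<^sub>m 1\<^sub>m 2))"
      "j < dim_col (four_block_mat ?A (0\<^sub>m n 2) R (det M \<cdot>\<^sub>m 1\<^sub>m 2))"
    then have ij: "i < n + 2" "j < n + 2" by auto
    have e: "(M * Z) $$ (i, j) = (\<Sum>k<n + 2. M $$ (i, k) * Z $$ (k, j))"
      using M Z ij by (simp add: times_mat_def scalar_prod_def lessThan_atLeast0)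
    show "(M * Z) $$ (i, j) = four_block_mat ?A (0\<^sub>m n 2) R (det M \<cdot>\<^sub>m 1\<^sub>m 2) $$ (i, j)"
    proof (cases "j < n")
      case True
      then have "(M * Z) $$ (i, j) = (\<Sum>k<n + 2. if k = j then M $$ (i, k) else 0)"
        unfolding e by (intro sum.cong) (auto simp: Z_def P_def Y_def)
      then have "(M * Z) $$ (i, j) = M $$ (i, j)" using ij by simp
      then show ?thesis using True ij by (auto simp: R_def)
    next
      case False
      have "(M * Z) $$ (i, j) = (\<Sum>k<n + 2. M $$ (i, k) * cofactor M j k)"
        unfolding e using False ij by (intro sum.cong) (auto simp: Z_def P_def Y_def)
      then show ?thesis using adj[OF ij] False ij by (auto simp: R_def)
    qed
  qed (use M Z in auto)
  then have "det (M * Z) = det ?A * det (det M \<cdot>\<^sub>m 1\<^sub>m 2 :: 'a mat)"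
    using det_four_block_mat_upper_right_zero[of ?A n "0\<^sub>m n 2" 2 R "det M \<cdot>\<^sub>m 1\<^sub>m 2"] by (simp add: R_def)
  then have "det M * det Y = det ?A * (det M * det M)"
    using det_mult[OF M Z] dZ by (simp add: power2_eq_square)
  \<comment> \<open>The product formula yields the identity multiplied by \<open>det M\<close>; this
    factor is cancelled in the integral domain.\<close>
  then have "det Y = det ?A * det M" using nz by (simp add: mult.left_commute mult.commute)
  moreover have "det Y = cofactor M n n * cofactor M (n+1) (n+1) - cofactor M (n+1) n * cofactor M n (n+1)"
    by (subst det_two) (auto simp: Y_def)
  ultimately show ?thesis by (simp add: mult.commute)
qed

text \<open>Deleting the next-to-last column of \<open>wmat (B @ [f, g])\<close>, together with the
  row of \<open>g\<close>, leaves this matrix. So two of the four minors in Jacobi's identity are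
  derivatives.\<close>

lemma pderiv_wdet_snoc:
  "pderiv (wdet (B @ [f])) = det (mat (length B + 1) (length B + 1)
     (\<lambda>(i,j). okp (int ((B @ [f]) ! i) - int (if j = length B then length B + 1 else j))))"
proof -
  let ?n = "length B" and ?hs = "B @ [f]"
  let ?K = "mat (?n + 1) (?n + 1) (\<lambda>(i,j). okp (int (?hs ! i) - int (if j = ?n then ?n + 1 else j)))"
  have m: "mat_delete ?K i ?n = mat_delete (wmat ?hs) i ?n" if "i < ?n + 1" for i
    by (rule eq_matI) (auto simp: mat_delete_def wmat_def)
  have "det ?K = (\<Sum>i<?n + 1. ?K $$ (i, ?n) * cofactor ?K i ?n)"
    by (rule laplace_expansion_column) auto
  also have "\<dots> = (\<Sum>i<?n + 1. okp (int (?hs ! i) - int (length ?hs)) * cofactor (wmat ?hs) i ?n)"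
  proof (rule sum.cong)
    fix i assume "i \<in> {..<?n + 1}"
    then have i: "i < ?n + 1" by simp
    then show "?K $$ (i, ?n) * cofactor ?K i ?n = okp (int (?hs ! i) - int (length ?hs)) * cofactor (wmat ?hs) i ?n"
      unfolding cofactor_def m[OF i] by simp
  qed simp
  also have "\<dots> = pderiv (wdet ?hs)" using pderiv_wdet[of ?hs] by (simp add: cramer_def)
  finally show ?thesis ..
qed

lemma wdet_jacobi:
  assumes nz: "wdet (B @ [f, g]) \<noteq> 0"
  shows "wdet (B @ [f, g]) * wdet B = wdet (B @ [f]) * pderiv (wdet (B @ [g])) - pderiv (wdet (B @ [f])) * wdet (B @ [g])"
proof -
  let ?n = "length B" and ?M = "wmat (B @ [f, g])"
  have M: "?M \<in> carrier_mat (?n + 2) (?n + 2)" by (simp add: wmat_def)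
  have 0: "mat ?n ?n (\<lambda>(i,j). ?M $$ (i,j)) = wmat B"
    by (rule eq_matI) (auto simp: wmat_def nth_append)
  have a: "mat_delete ?M (?n+1) (?n+1) = wmat (B @ [f])"
    by (rule eq_matI) (auto simp: mat_delete_def wmat_def nth_append)
  have b: "mat_delete ?M ?n (?n+1) = wmat (B @ [g])"
    by (rule eq_matI) (auto simp: mat_delete_def wmat_def nth_append)
  have c: "mat_delete ?M (?n+1) ?n = mat (?n + 1) (?n + 1)
     (\<lambda>(i,j). okp (int ((B @ [f]) ! i) - int (if j = ?n then ?n + 1 else j)))"
    by (rule eq_matI) (auto simp: mat_delete_def wmat_def nth_append)
  have d: "mat_delete ?M ?n ?n = mat (?n + 1) (?n + 1)
     (\<lambda>(i,j). okp (int ((B @ [g]) ! i) - int (if j = ?n then ?n + 1 else j)))"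
    by (rule eq_matI) (auto simp: mat_delete_def wmat_def nth_append)
  have "cofactor ?M ?n ?n = pderiv (wdet (B @ [g]))" "cofactor ?M (?n+1) (?n+1) = wdet (B @ [f])"
    "cofactor ?M (?n+1) ?n = - pderiv (wdet (B @ [f]))" "cofactor ?M ?n (?n+1) = - wdet (B @ [g])"
    unfolding cofactor_def a b c d pderiv_wdet_snoc[symmetric] wdet_def[symmetric] by simp_all
  then show ?thesis using desnanot_jacobi[OF M] nz unfolding wdet_def[symmetric] 0 by (simp add: mult.commute)
qed

section \<open>Hook lengths\<close>

lemma coeff_mult_bounds:
  assumes "degree p \<le> m" "degree q \<le> n"
  shows "degree (p * q) \<le> m + n" "coeff (p * q) (m + n) = coeff p m * coeff q n"
proof -
  show "degree (p * q) \<le> m + n" using degree_mult_le[of p q] assms by linarith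
  have z: "coeff p i * coeff q (m + n - i) = 0" if "i \<noteq> m" "i \<le> m + n" for i
  proof (cases "i < m")
    case True
    then have "coeff q (m + n - i) = 0" using assms by (intro coeff_eq_0) auto
    then show ?thesis by simp
  next
    case False
    then have "coeff p i = 0" using assms that by (intro coeff_eq_0) auto
    then show ?thesis by simp
  qed
  have "coeff (p * q) (m + n) = (\<Sum>i\<le>m + n. if i = m then coeff p m * coeff q n else 0)"
    unfolding coeff_mult by (rule sum.cong) (use z in auto)
  then show "coeff (p * q) (m + n) = coeff p m * coeff q n" by simp
qed

lemma coeff_prod_bounds:
  fixes f :: "'b \<Rightarrow> 'a::comm_semiring_1 poly"
  assumes "finite S" "\<And>i. i \<in> S \<Longrightarrow> degree (f i) \<le> d i"
  shows "degree (prod f S) \<le> sum d S \<and> coeff (prod f S) (sum d S) = (\<Prod>i\<in>S. coeff (f i) (d i))"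
  using assms
proof (induction S rule: finite_induct)
  case (insert a S)
  then show ?case using coeff_mult_bounds[of "f a" "d a" "prod f S" "sum d S"] by simp
qed simp

lemma degree_okp: "degree (okp (int n)) \<le> n"
  by (rule degree_le) (auto simp: coeff_okp)

text \<open>The leading coefficient of \<open>okp k\<close>, with value \<open>0\<close> for
  negative \<open>k\<close>.\<close>

definition rfact :: "int \<Rightarrow> complex" where "rfact k = (if k < 0 then 0 else 1 / fact (nat k))"

text \<open>For \<open>k > h\<close> the falling factorial contains the factor zero, which matches
  the convention for negative arguments. This turns the determinant of reciprocal factorials into a
  Vandermonde determinant.\<close>

lemma rfact_falling:
  "rfact (int h - int k) = (\<Prod>t<k. of_nat h - of_nat t) / fact h"
proof (cases "k \<le> h")
  case True
  have "(\<Prod>t<k. of_nat h - of_nat t :: complex) * fact (h - k) = fact h" using True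
  proof (induction k)
    case (Suc k)
    have "h - k = Suc (h - Suc k)" using Suc by simp
    then have "fact (h - k) = (of_nat (h - k) :: complex) * fact (h - Suc k)" by (metis fact_Suc)
    then show ?case using Suc by (simp add: of_nat_diff mult.assoc)
  qed simp
  then have "(\<Prod>t<k. of_nat h - of_nat t :: complex) / fact h = 1 / fact (h - k)"
    by (simp add: field_simps)
  moreover have "nat (int h - int k) = h - k" using True by simp
  ultimately show ?thesis using True by (simp add: rfact_def)
next
  case False
  then have "(\<Prod>t<k. of_nat h - of_nat t :: complex) = 0" by (intro prod_zero) auto
  then show ?thesis using False by (simp add: rfact_def)
qed

lemma det_scale_rows:
  "det (mat n n (\<lambda>(i,j). c i * a i j)) = (\<Prod>i<n. c i) * det (mat n n (\<lambda>(i,j). a i j))"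
proof -
  have "(\<Prod>i = 0..<n. mat n n (\<lambda>(i,j). c i * a i j) $$ (i, p i))
     = (\<Prod>i<n. c i) * (\<Prod>i = 0..<n. mat n n (\<lambda>(i,j). a i j) $$ (i, p i))" if p: "p permutes {0..<n}" for p
  proof -
    have "p i < n" if "i < n" for i using permutes_in_image[OF p, of i] that by simp
    then show ?thesis by (simp add: prod.distrib lessThan_atLeast0)
  qed
  then show ?thesis
    by (auto simp: det_def'[OF mat_carrier] sum_distrib_left mult.left_commute intro!: sum.cong)
qed

text \<open>Subtracting multiples of neighbouring columns makes the last row \<open>(0, \<dots>, 0, 1)\<close> and pulls a factor
  \<open>x i - x n\<close> out of each other row.\<close>

lemma vandermonde_falling:
  fixes x :: "nat \<Rightarrow> 'a::idom"
  shows "det (mat n n (\<lambda>(i,j). \<Prod>t<n - 1 - j. x i - of_nat t)) = (\<Prod>i<n. \<Prod>j\<in>{i<..<n}. x i - x j)"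
proof (induction n)
  case (Suc n)
  define M where "M = mat (Suc n) (Suc n) (\<lambda>(i,j). \<Prod>t<n - j. x i - of_nat t)"
  define U where "U = mat (Suc n) (Suc n) (\<lambda>(k,j). if k = j then 1 else if k = Suc j then of_nat (n - Suc j) - x n else 0)"
  have M: "M \<in> carrier_mat (Suc n) (Suc n)" and U: "U \<in> carrier_mat (Suc n) (Suc n)"
    by (simp_all add: M_def U_def)
  have "det U = prod_list (diag_mat U)"
    by (rule det_lower_triangular[OF _ U]) (auto simp: U_def)
  also have "\<dots> = 1" by (simp add: prod_list_diag_prod U_def)
  finally have dU: "det U = 1" .
  have MU: "(M * U) $$ (i, j) = (if j = n then 1 else (x i - x n) * (\<Prod>t<n - 1 - j. x i - of_nat t))"
    if ij: "i < Suc n" "j < Suc n" for i j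
  proof -
    have "(M * U) $$ (i, j) = (\<Sum>k<Suc n. M $$ (i, k) * U $$ (k, j))"
      using M U ij by (simp add: times_mat_def scalar_prod_def lessThan_atLeast0)
    also have "\<dots> = (\<Sum>k<Suc n. (if k = j then M $$ (i, k) else 0) + (if k = Suc j then M $$ (i, k) * (of_nat (n - Suc j) - x n) else 0))"
      by (rule sum.cong) (use ij in \<open>auto simp: U_def\<close>)
    also have "\<dots> = M $$ (i, j) + (if j < n then M $$ (i, Suc j) * (of_nat (n - Suc j) - x n) else 0)"
      using ij by (simp add: sum.distrib del: sum.lessThan_Suc)
    also have "\<dots> = (if j = n then 1 else (x i - x n) * (\<Prod>t<n - 1 - j. x i - of_nat t))"
    proof (cases "j = n")
      case False
      then have "n - j = Suc (n - Suc j)" using ij by simp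
      then show ?thesis using False ij by (simp add: M_def algebra_simps)
    qed (use ij in \<open>simp add: M_def\<close>)
    finally show ?thesis .
  qed
  have MUc: "M * U \<in> carrier_mat (Suc n) (Suc n)" using M U by simp
  have "det M = det (M * U)" using det_mult[OF M U] dU by simp
  also have "\<dots> = (\<Sum>j<Suc n. (M * U) $$ (n, j) * cofactor (M * U) n j)"
    by (rule laplace_expansion_row[OF MUc]) simp
  also have "\<dots> = (\<Sum>j<Suc n. if j = n then cofactor (M * U) n j else 0)"
    by (rule sum.cong) (auto simp: MU)
  also have "\<dots> = cofactor (M * U) n n" by simp
  also have "\<dots> = det (mat n n (\<lambda>(i,j). (x i - x n) * (\<Prod>t<n - 1 - j. x i - of_nat t)))"
  proof -
    have "mat_delete (M * U) n n = mat n n (\<lambda>(i,j). (x i - x n) * (\<Prod>t<n - 1 - j. x i - of_nat t))"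
      by (rule eq_matI) (use M U in \<open>auto simp: mat_delete_def MU simp del: index_mult_mat(1)\<close>)
    then show ?thesis by (simp add: cofactor_def)
  qed
  also have "\<dots> = (\<Prod>i<n. x i - x n) * (\<Prod>i<n. \<Prod>j\<in>{i<..<n}. x i - x j)"
    unfolding det_scale_rows Suc ..
  also have "\<dots> = (\<Prod>i<Suc n. \<Prod>j\<in>{i<..<Suc n}. x i - x j)"
  proof -
    have "{i<..<Suc n} = insert n {i<..<n}" if "i < n" for i using that by auto
    then have "(\<Prod>i<n. \<Prod>j\<in>{i<..<Suc n}. x i - x j) = (\<Prod>i<n. (x i - x n) * (\<Prod>j\<in>{i<..<n}. x i - x j))"
      by (intro prod.cong) auto
    moreover have "{n<..<Suc n} = {}" by auto
    ultimately show ?thesis by (simp add: prod.distrib)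
  qed
  finally show ?case by (simp add: M_def)
qed simp

section \<open>The leading coefficient of a Schur function\<close>

lemma part_nth: "i < length lam \<Longrightarrow> part lam (Suc i) = lam ! i"
  by (simp add: part_def)

lemma schur_alt: "schur lam = det (mat (length lam) (length lam) (\<lambda>(i,j). okp (int (lam ! i) - int i + int j)))"
  unfolding schur_def by (rule arg_cong[where f = det], rule eq_matI) (auto simp: part_nth algebra_simps)

text \<open>For a partition these are the hook lengths of the first column.\<close>

definition beta_number :: "nat list \<Rightarrow> nat \<Rightarrow> nat" where
  "beta_number lam i = lam ! i + (length lam - 1 - i)"

text \<open>In each term of the Leibniz formula the indices add up to \<open>sum_list lam\<close>,
  since the permutation cancels the row numbers; a term with a negative index vanishes. The
  coefficient is thus the determinant of the leading coefficients.\<close>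

lemma coeff_schur:
  "degree (schur lam) \<le> sum_list lam"
  "coeff (schur lam) (sum_list lam) =
     (\<Prod>i<length lam. \<Prod>j\<in>{i<..<length lam}. of_nat (beta_number lam i) - of_nat (beta_number lam j)) / (\<Prod>i<length lam. fact (beta_number lam i))"
proof -
  let ?l = "length lam"
  let ?A = "mat ?l ?l (\<lambda>(i,j). okp (int (lam ! i) - int i + int j))"
  let ?B = "mat ?l ?l (\<lambda>(i,j). rfact (int (lam ! i) - int i + int j))"
  have tm: "degree (\<Prod>i = 0..<?l. ?A $$ (i, p i)) \<le> sum_list lam \<and>
     coeff (\<Prod>i = 0..<?l. ?A $$ (i, p i)) (sum_list lam) = (\<Prod>i = 0..<?l. ?B $$ (i, p i))"
    if p: "p permutes {0..<?l}" for p
  proof -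
    have pl: "p i < ?l" if "i < ?l" for i using permutes_in_image[OF p, of i] that by simp
    have A: "(\<Prod>i = 0..<?l. ?A $$ (i, p i)) = (\<Prod>i = 0..<?l. okp (int (lam ! i) - int i + int (p i)))"
      by (rule prod.cong) (auto simp: pl)
    have B: "(\<Prod>i = 0..<?l. ?B $$ (i, p i)) = (\<Prod>i = 0..<?l. rfact (int (lam ! i) - int i + int (p i)))"
      by (rule prod.cong) (auto simp: pl)
    show ?thesis
    proof (cases "\<forall>i<?l. 0 \<le> int (lam ! i) - int i + int (p i)")
      case True
      define d where "d i = nat (int (lam ! i) - int i + int (p i))" for i
      have d: "int (lam ! i) - int i + int (p i) = int (d i)" if "i < ?l" for i using True that by (simp add: d_def)
      have "int (\<Sum>i = 0..<?l. d i) = (\<Sum>i = 0..<?l. int (lam ! i) - int i + int (p i))"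
        using d by simp
      also have "\<dots> = (\<Sum>i = 0..<?l. int (lam ! i)) - (\<Sum>i = 0..<?l. int i) + (\<Sum>i = 0..<?l. int (p i))"
        by (simp add: sum.distrib sum_subtractf)
      also have "(\<Sum>i = 0..<?l. int (p i)) = (\<Sum>i = 0..<?l. int i)"
        using sum.permute[OF p, of int] by (simp add: o_def)
      finally have s: "(\<Sum>i = 0..<?l. d i) = sum_list lam"
        unfolding sum_list_sum_nth by (simp flip: of_nat_sum)
      have "(\<Prod>i = 0..<?l. okp (int (lam ! i) - int i + int (p i))) = (\<Prod>i = 0..<?l. okp (int (d i)))"
        by (rule prod.cong) (auto simp: d)
      moreover have "(\<Prod>i = 0..<?l. rfact (int (lam ! i) - int i + int (p i))) = (\<Prod>i = 0..<?l. coeff (okp (int (d i))) (d i))"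
        by (rule prod.cong) (auto simp: d coeff_okp rfact_def)
      ultimately show ?thesis unfolding A B
        using coeff_prod_bounds[of "{0..<?l}" "\<lambda>i. okp (int (d i))" d] degree_okp s by simp
    next
      case False
      then obtain i where "i < ?l" "int (lam ! i) - int i + int (p i) < 0" by (auto simp: not_le)
      then have z: "(\<Prod>i = 0..<?l. okp (int (lam ! i) - int i + int (p i))) = 0"
        "(\<Prod>i = 0..<?l. rfact (int (lam ! i) - int i + int (p i))) = 0"
        by (auto intro!: prod_zero bexI[of _ i] simp: okp_neg rfact_def)
      then show ?thesis unfolding A B z by simp
    qed
  qed
  have sg: "signof p * q = smult (signof p) q" for p :: "nat \<Rightarrow> nat" and q :: "complex poly"
    by (simp add: sign_def)
  have det: "schur lam = (\<Sum>p | p permutes {0..<?l}. smult (signof p) (\<Prod>i = 0..<?l. ?A $$ (i, p i)))"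
    unfolding schur_alt det_def'[OF mat_carrier] sg ..
  show "degree (schur lam) \<le> sum_list lam" unfolding det
    by (rule degree_sum_le) (use tm degree_smult_le order.trans in \<open>blast intro: finite_permutations\<close>)+
  have "coeff (schur lam) (sum_list lam) = det ?B"
    unfolding det det_def'[OF mat_carrier] coeff_sum coeff_smult
    by (rule sum.cong) (use tm in auto)
  also have "?B = mat ?l ?l (\<lambda>(i,j). (1 / fact (beta_number lam i)) * (\<Prod>t<?l - 1 - j. of_nat (beta_number lam i) - of_nat t))"
  proof (rule eq_matI; clarsimp)
    fix i j assume ij: "i < ?l" "j < ?l"
    have "int (lam ! i) - int i + int j = int (beta_number lam i) - int (?l - 1 - j)" using ij by (simp add: beta_number_def)
    then show "rfact (int (lam ! i) - int i + int j) = (\<Prod>t<?l - Suc j. of_nat (beta_number lam i) - of_nat t) / fact (beta_number lam i)"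
      using rfact_falling[of "beta_number lam i" "?l - 1 - j"] by simp
  qed
  also have "det \<dots> = (\<Prod>i<?l. 1 / fact (beta_number lam i)) * (\<Prod>i<?l. \<Prod>j\<in>{i<..<?l}. of_nat (beta_number lam i) - of_nat (beta_number lam j))"
    unfolding det_scale_rows vandermonde_falling ..
  finally show "coeff (schur lam) (sum_list lam) =
     (\<Prod>i<length lam. \<Prod>j\<in>{i<..<length lam}. of_nat (beta_number lam i) - of_nat (beta_number lam j)) / (\<Prod>i<length lam. fact (beta_number lam i))"
    by (simp add: prod_dividef)
qed

section \<open>Hook lengths against differences of beta numbers\<close>

lemma part_antimono:
  assumes "is_partition lam" "1 \<le> i" "i \<le> k" "k \<le> length lam" shows "part lam k \<le> part lam i"
proof -
  have "lam ! (k - 1) \<le> lam ! (i - 1)"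
    using assms unfolding is_partition_def
    by (cases "i = k") (auto simp: sorted_wrt_iff_nth_less)
  then show ?thesis using assms by (simp add: part_def)
qed

lemma le_conj_part_iff:
  assumes lam: "is_partition lam" and k: "1 \<le> k" "k \<le> length lam"
  shows "k \<le> conj_part lam j \<longleftrightarrow> j \<le> part lam k"
proof -
  let ?S = "{i. 1 \<le> i \<and> i \<le> length lam \<and> j \<le> part lam i}"
  have fin: "finite ?S" by (rule finite_subset[of _ "{..length lam}"]) auto
  show ?thesis
  proof
    assume "j \<le> part lam k"
    then have "{1..k} \<subseteq> ?S" using part_antimono[OF lam] k by (auto intro: order.trans)
    from card_mono[OF fin this] show "k \<le> conj_part lam j" by (simp add: conj_part_def)
  next
    assume c: "k \<le> conj_part lam j"
    show "j \<le> part lam k"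
    proof (rule ccontr)
      assume n: "\<not> j \<le> part lam k"
      have "i < k" if "i \<in> ?S" for i
      proof (rule ccontr)
        assume "\<not> i < k"
        then have "part lam i \<le> part lam k" using part_antimono[OF lam k(1)] that by simp
        then show False using n that by simp
      qed
      then have "?S \<subseteq> {1..<k}" by auto
      from card_mono[OF _ this] show False using c k by (simp add: conj_part_def)
    qed
  qed
qed

lemma conj_part_le: "conj_part lam j \<le> length lam"
proof -
  have "conj_part lam j \<le> card {1..length lam}" unfolding conj_part_def by (rule card_mono) auto
  then show ?thesis by simp
qed

lemma conj_part_antimono: "j \<le> j' \<Longrightarrow> conj_part lam j' \<le> conj_part lam j"
  unfolding conj_part_def by (rule card_mono) (auto intro: finite_subset[of _ "{..length lam}"])

text \<open>The hook lengths of row \<open>i\<close> together with the differences \<open>\<beta>\<^sub>i - \<beta>\<^sub>k\<close>, \<open>k > i\<close>, are a permutation of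
  \<open>1, \<dots>, \<beta>\<^sub>i\<close>.\<close>

lemma hook_row:
  assumes lam: "is_partition lam" and i: "i < length lam"
  shows "(\<Prod>j\<in>{1..lam ! i}. hook lam (Suc i) j) * (\<Prod>k\<in>{i<..<length lam}. int (beta_number lam i) - int (beta_number lam k)) = fact (beta_number lam i)"
    "\<And>j. j \<in> {1..lam ! i} \<Longrightarrow> hook lam (Suc i) j > 0"
proof -
  let ?l = "length lam" and ?J = "{1..lam ! i}" and ?K = "{i<..<length lam}"
  let ?h = "\<lambda>j. hook lam (Suc i) j" and ?d = "\<lambda>k. int (beta_number lam i) - int (beta_number lam k)"
  have h: "?h j = int (lam ! i) + int (conj_part lam j) - int i - int j" for j
    using i by (simp add: hook_def part_nth)
  have d: "?d k = int (lam ! i) - int (lam ! k) + int k - int i" if "k \<in> ?K" for k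
    using that i by (simp add: beta_number_def)
  have le: "lam ! k \<le> lam ! i" if "k \<in> ?K" for k
    using part_antimono[OF lam, of "Suc i" "Suc k"] that by (simp add: part_nth)
  have cj: "Suc i \<le> conj_part lam j" if "j \<in> ?J" for j
    using le_conj_part_iff[OF lam, of "Suc i" j] that i by (simp add: part_nth)
  show pos: "?h j > 0" if "j \<in> ?J" for j using cj[OF that] that by (simp add: h)
  have sub: "?h ` ?J \<union> ?d ` ?K \<subseteq> {1..int (beta_number lam i)}"
  proof (intro Un_least subsetI)
    fix y assume "y \<in> ?h ` ?J"
    then obtain j where j: "j \<in> ?J" "y = ?h j" by auto
    then show "y \<in> {1..int (beta_number lam i)}" using pos[OF j(1)] conj_part_le[of lam j] i by (simp add: h beta_number_def)
  next
    fix y assume "y \<in> ?d ` ?K"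
    then obtain k where k: "k \<in> ?K" "y = ?d k" by auto
    then show "y \<in> {1..int (beta_number lam i)}" using le[OF k(1)] d[OF k(1)] by simp
  qed
  have injh: "inj_on ?h ?J"
  proof (rule linorder_inj_onI')
    fix j j' :: nat assume "j < j'"
    then show "?h j \<noteq> ?h j'" using conj_part_antimono[of j j' lam] by (simp add: h)
  qed
  have injd: "inj_on ?d ?K"
  proof (rule linorder_inj_onI')
    fix k k' :: nat assume kk: "k \<in> ?K" "k' \<in> ?K" "k < k'"
    then have "lam ! k' \<le> lam ! k"
      using part_antimono[OF lam, of "Suc k" "Suc k'"] by (simp add: part_nth)
    then show "?d k \<noteq> ?d k'" using d[OF kk(1)] d[OF kk(2)] kk(3) by simp
  qed
  have disj: "?h ` ?J \<inter> ?d ` ?K = {}"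
  proof -
    have "?h j \<noteq> ?d k" if j: "j \<in> ?J" and k: "k \<in> ?K" for j k
    proof -
      \<comment> \<open>Equality would mean \<open>conj_part lam j - j = k - lam ! k\<close>. The
        left side is larger if \<open>j \<le> lam ! k\<close> and smaller otherwise.\<close>
      have "Suc k \<le> conj_part lam j \<longleftrightarrow> j \<le> lam ! k"
        using le_conj_part_iff[OF lam, of "Suc k" j] k by (simp add: part_nth)
      then show ?thesis unfolding h d[OF k] by (cases "j \<le> lam ! k") auto
    qed
    then show ?thesis by blast
  qed
  have "card (?h ` ?J \<union> ?d ` ?K) = card {1..int (beta_number lam i)}"
    using card_Un_disjoint[OF _ _ disj] card_image[OF injh] card_image[OF injd] i by (simp add: beta_number_def)
  then have eq: "?h ` ?J \<union> ?d ` ?K = {1..int (beta_number lam i)}"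
    by (intro card_subset_eq sub) auto
  have "fact (beta_number lam i) = (\<Prod>{1..int (beta_number lam i)})"
  proof -
    have "(fact (beta_number lam i) :: int) = (\<Prod>k\<in>{1..beta_number lam i}. int k)" by (simp add: fact_prod)
    also have "\<dots> = (\<Prod>{1..int (beta_number lam i)})"
      by (rule prod.reindex_bij_witness[of _ nat int]) auto
    finally show ?thesis .
  qed
  also have "\<dots> = (\<Prod>(?h ` ?J)) * (\<Prod>(?d ` ?K))"
    unfolding eq[symmetric] by (rule prod.union_disjoint) (use disj in auto)
  also have "\<dots> = (\<Prod>j\<in>?J. ?h j) * (\<Prod>k\<in>?K. ?d k)"
    using prod.reindex[OF injh, of "\<lambda>y. y"] prod.reindex[OF injd, of "\<lambda>y. y"] by simp
  finally show "(\<Prod>j\<in>?J. ?h j) * (\<Prod>k\<in>?K. ?d k) = fact (beta_number lam i)" ..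
qed

lemma hook_product_rows: "hook_product lam = (\<Prod>i<length lam. \<Prod>j\<in>{1..lam ! i}. hook lam (Suc i) j)"
proof -
  have "young_boxes lam = Sigma {1..length lam} (\<lambda>i. {1..part lam i})" by (auto simp: young_boxes_def)
  then have "hook_product lam = (\<Prod>i\<in>{1..length lam}. \<Prod>j\<in>{1..part lam i}. hook lam i j)"
    unfolding hook_product_def by (simp add: prod.Sigma)
  also have "\<dots> = (\<Prod>i<length lam. \<Prod>j\<in>{1..lam ! i}. hook lam (Suc i) j)"
    by (rule prod.reindex_bij_witness[of _ Suc "\<lambda>i. i - 1"]) (auto simp: part_def)
  finally show ?thesis .
qed

lemma hook_product_pos: "is_partition lam \<Longrightarrow> hook_product lam > 0"
  unfolding hook_product_rows by (intro prod_pos) (use hook_row(2) in auto)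

text \<open>Multiplying \<open>hook_row\<close> over all rows gives the hook product times the
  Vandermonde product as the product of factorials, and \<open>coeff_schur\<close> is the quotient
  of the latter two.\<close>

lemma lead_schur:
  assumes lam: "is_partition lam"
  shows "of_int (hook_product lam) * coeff (schur lam) (sum_list lam) = 1"
proof -
  let ?l = "length lam"
  define V where "V = (\<Prod>i<?l. \<Prod>j\<in>{i<..<?l}. int (beta_number lam i) - int (beta_number lam j))"
  have "hook_product lam * V = (\<Prod>i<?l. fact (beta_number lam i))"
    unfolding hook_product_rows V_def prod.distrib[symmetric]
    by (rule prod.cong) (use hook_row(1)[OF lam] in auto)
  then have "(of_int (hook_product lam * V) :: complex) = of_int (\<Prod>i<?l. fact (beta_number lam i))" by (rule arg_cong)
  then have "of_int (hook_product lam) * of_int V = (\<Prod>i<?l. fact (beta_number lam i) :: complex)" by simp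
  moreover have "of_int V = (\<Prod>i<?l. \<Prod>j\<in>{i<..<?l}. of_nat (beta_number lam i) - of_nat (beta_number lam j) :: complex)"
    by (simp add: V_def)
  moreover have "(\<Prod>i<?l. fact (beta_number lam i) :: complex) \<noteq> 0" by simp
  ultimately show ?thesis unfolding coeff_schur(2) by (simp add: field_simps)
qed

section \<open>Maya diagrams\<close>

text \<open>Signs from reordering rows and columns are not tracked: a nonzero scalar is allowed
  throughout and eliminated at the end by comparing monic polynomials.\<close>

definition proportional :: "complex poly \<Rightarrow> complex poly \<Rightarrow> bool" where
  "proportional p q \<longleftrightarrow> (\<exists>c. c \<noteq> 0 \<and> p = smult c q)"

lemma proportional_trans: "proportional p q \<Longrightarrow> proportional q r \<Longrightarrow> proportional p r"
  unfolding proportional_def by (metis smult_smult mult_eq_0_iff)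

lemma proportional_sign: "proportional (signof f * q) q" "proportional (- q) q" "proportional q q"
    "proportional ((-1) ^ k * q) q"
proof -
  show m: "proportional (- q) q" "proportional q q" for q
    unfolding proportional_def by (rule exI[of _ "-1"], simp) (rule exI[of _ 1], simp)
  show "proportional (signof f * q) q" using m by (simp add: sign_def)
  show "proportional ((-1) ^ k * q) q" using m by (cases "even k") simp_all
qed

lemma wdet_permute:
  assumes "mset hs = mset hs'" shows "proportional (wdet hs) (wdet hs')"
proof -
  obtain p where p: "p permutes {..<length hs'}" "permute_list p hs' = hs"
    using mset_eq_permutation[OF assms] by metis
  let ?n = "length hs'"
  have l: "length hs = ?n" using assms by (metis size_mset)
  have pl: "p i < ?n" if "i < ?n" for i using permutes_in_image[OF p(1), of i] that by simp
  have "wmat hs = mat ?n ?n (\<lambda>(i,j). wmat hs' $$ (p i, j))"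
    using p pl l by (intro eq_matI) (auto simp: wmat_def permute_list_nth)
  then have "wdet hs = signof p * wdet hs'"
    unfolding wdet_def using det_permute_rows[OF wmat_carrier, of p hs'] p(1) by (simp add: lessThan_atLeast0)
  then show ?thesis using proportional_sign by simp
qed

text \<open>The Jacobi-Trudi matrix is the Wronskian matrix of the beta numbers with its columns in
  reverse order; transposition lets the reversal act on rows.\<close>

lemma wdet_beta_number: "proportional (wdet (map (beta_number lam) [0..<length lam])) (schur lam)"
proof -
  let ?n = "length lam" and ?hs = "map (beta_number lam) [0..<length lam]"
  define p where "p i = (if i < ?n then ?n - 1 - i else i)" for i
  have p: "p permutes {0..<?n}"
    by (rule bij_imp_permutes, rule bij_betw_byWitness[of _ p]) (auto simp: p_def)
  let ?S = "mat ?n ?n (\<lambda>(i,j). okp (int (lam ! i) - int i + int j))"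
  have "transpose_mat (wmat ?hs) = mat ?n ?n (\<lambda>(i,j). transpose_mat ?S $$ (p i, j))"
    by (rule eq_matI) (auto simp: wmat_def p_def beta_number_def of_nat_diff algebra_simps)
  then have "det (transpose_mat (wmat ?hs)) = signof p * det (transpose_mat ?S)"
    using det_permute_rows[OF transpose_carrier_mat[THEN iffD2, OF mat_carrier] p] by simp
  then have "wdet ?hs = signof p * schur lam"
    unfolding wdet_def schur_alt by (simp add: det_transpose[of _ ?n] wmat_def)
  then show ?thesis using proportional_sign by simp
qed

text \<open>The row labelled \<open>0\<close> is \<open>(1, 0, ..., 0)\<close>, and removing it with
  the first column lowers all other labels by one.\<close>

lemma wdet_strip: "proportional (wdet (map Suc hs @ [0])) (wdet hs)"
proof -
  let ?n = "length hs" and ?M = "wmat (map Suc hs @ [0])"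
  have M: "?M \<in> carrier_mat (Suc ?n) (Suc ?n)" by (simp add: wmat_def)
  have "mat_delete ?M ?n 0 = wmat hs"
    by (rule eq_matI) (auto simp: mat_delete_def wmat_def nth_append)
  then have c: "cofactor ?M ?n 0 = (-1) ^ ?n * wdet hs" by (simp add: cofactor_def wdet_def)
  have "wdet (map Suc hs @ [0]) = (\<Sum>j<Suc ?n. ?M $$ (?n, j) * cofactor ?M ?n j)"
    unfolding wdet_def by (rule laplace_expansion_row[OF M]) simp
  also have "\<dots> = (\<Sum>j<Suc ?n. if j = 0 then cofactor ?M ?n j else 0)"
    by (rule sum.cong) (auto simp: wmat_def nth_append okp_0 okp_neg)
  also have "\<dots> = (-1) ^ ?n * wdet hs" unfolding c[symmetric] by (subst sum.delta) auto
  finally show ?thesis using proportional_sign by simp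
qed

section \<open>From Maya diagrams to partitions\<close>

lemma maya_elem_of_partition:
  assumes lam: "is_partition lam" and M: "M = range (\<lambda>i. int (part lam (Suc i)) - int i + c)"
  shows "maya_elem M i = int (part lam (Suc i)) - int i + c"
proof -
  define m where "m i = int (part lam (Suc i)) - int i + c" for i
  have mono: "part lam (Suc j) \<le> part lam (Suc i)" if "i \<le> j" for i j
    using part_antimono[OF lam, of "Suc i" "Suc j"] that by (cases "Suc j \<le> length lam") (auto simp: part_def)
  have lt: "m j < m i" if "i < j" for i j using mono[of i j] that by (simp add: m_def)
  have le: "m j \<le> m i" if "i \<le> j" for i j using lt[of i j] that by (cases "i = j") auto
  have Mm: "M = range m" unfolding M m_def ..
  show ?thesis unfolding m_def[symmetric]
  proof (induction i)
    case 0
    have "(GREATEST k. k \<in> M) = m 0" by (rule Greatest_equality) (auto simp: Mm le)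
    then show ?case by simp
  next
    case (Suc i)
    have "(GREATEST k. k \<in> M \<and> k < m i) = m (Suc i)"
    proof (rule Greatest_equality)
      show "m (Suc i) \<in> M \<and> m (Suc i) < m i" by (auto simp: Mm lt)
      fix y assume "y \<in> M \<and> y < m i"
      then obtain j where j: "y = m j" "m j < m i" by (auto simp: Mm)
      then have "i < j" using le[of j i] by (meson not_le)
      then show "y \<le> m (Suc i)" using le[of "Suc i" j] j by simp
    qed
    then show ?case using Suc by simp
  qed
qed

lemma partition_eqI:
  assumes "is_partition lam" "is_partition mu" "\<And>i. part lam (Suc i) = part mu (Suc i)"
  shows "lam = mu"
proof -
  have pos: "part nu (Suc i) > 0 \<longleftrightarrow> i < length nu" if "is_partition nu" for nu i
  proof (cases "i < length nu")
    case True
    then have "nu ! i \<noteq> 0" using that nth_mem[OF True] unfolding is_partition_def by metis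
    then show ?thesis using True by (simp add: part_def)
  qed (simp add: part_def)
  have "i < length lam \<longleftrightarrow> i < length mu" for i using pos assms by metis
  then have "length lam = length mu" by (metis linorder_neqE_nat less_irrefl)
  then show ?thesis using assms(3) part_nth by (metis nth_equalityI)
qed

lemma maya_partition_eqI:
  assumes lam: "is_partition lam" and M: "M = range (\<lambda>i. int (part lam (Suc i)) - int i + c)"
  shows "maya_partition M = lam"
  unfolding maya_partition_def
proof (rule the_equality)
  note e = maya_elem_of_partition[OF assms]
  show "is_partition lam \<and> (\<forall>i\<ge>1. maya_elem M (i - 1) - maya_elem M i = int (part lam i) - int (part lam (i + 1)) + 1)"
  proof (intro conjI allI impI lam)
    fix i :: nat assume "1 \<le> i"
    then obtain j where "i = Suc j" by (cases i) auto
    then show "maya_elem M (i - 1) - maya_elem M i = int (part lam i) - int (part lam (i + 1)) + 1"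
      by (simp add: e del: maya_elem.simps)
  qed
  fix mu assume mu: "is_partition mu \<and> (\<forall>i\<ge>1. maya_elem M (i - 1) - maya_elem M i = int (part mu i) - int (part mu (i + 1)) + 1)"
  have step: "int (part mu (Suc i)) - int (part mu (Suc (Suc i))) = int (part lam (Suc i)) - int (part lam (Suc (Suc i)))" for i
    using mu[THEN conjunct2, rule_format, of "Suc i"] e[of i] e[of "Suc i"] by (simp del: maya_elem.simps)
  have const: "int (part mu (Suc i)) - int (part lam (Suc i)) = int (part mu 1) - int (part lam 1)" for i
  proof (induction i)
    case (Suc i) then show ?case using step[of i] by simp
  qed simp
  \<comment> \<open>The gaps determine the parts up to a common constant; beyond both lengths all
    parts are zero, so the constant is zero.\<close>
  have "int (part mu (Suc i)) - int (part lam (Suc i)) = 0" if "i = length mu + length lam" for i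
    using that by (simp add: part_def)
  then have "part mu (Suc i) = part lam (Suc i)" for i
    using const[of "length mu + length lam"] const[of i] by simp
  then show "mu = lam" using mu lam by (intro partition_eqI) auto
qed

text \<open>The diagram that, shifted up by \<open>s\<close>, is full below zero and equals
  \<open>A\<close> from zero on. A finite set is thereby a window onto an infinite diagram, and the
  window may be chosen in many ways.\<close>

definition maya_of :: "nat set \<Rightarrow> int \<Rightarrow> int set" where
  "maya_of A s = {k. k + s < 0} \<union> {k. k + s \<in> int ` A}"

lemma maya_of_strip: "maya_of (insert 0 (Suc ` A)) s = maya_of A (s - 1)"
proof -
  have "k + s \<in> int ` Suc ` A \<longleftrightarrow> k + s - 1 \<in> int ` A" for k
  proof -
    have "k + s = int (Suc a) \<longleftrightarrow> k + s - 1 = int a" for a by auto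
    then show ?thesis by (auto simp: image_iff simp del: of_nat_Suc)
  qed
  then show ?thesis unfolding maya_of_def by (auto simp: algebra_simps)
qed

text \<open>If position \<open>0\<close> is empty, the elements of \<open>A\<close> in decreasing
  order are exactly the beta numbers of a partition: by \<open>low\<close> the \<open>i\<close>-th
  one is at least \<open>n - i\<close>, which makes every part positive.\<close>

lemma maya_of_positive:
  assumes A: "finite A" "0 \<notin> A"
  obtains lam where "is_partition lam" "maya_partition (maya_of A s) = lam"
    "set (map (beta_number lam) [0..<length lam]) = A" "distinct (map (beta_number lam) [0..<length lam])"
proof -
  define hs where "hs = rev (sorted_list_of_set A)"
  define n where "n = length hs"
  have set: "set hs = A" and dist: "distinct hs" using A by (simp_all add: hs_def)
  have dec: "hs ! j < hs ! i" if "i < j" "j < n" for i j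
  proof -
    have "sorted_wrt (\<lambda>x y. y < x) hs" unfolding hs_def sorted_wrt_rev
      using strict_sorted_list_of_set[of A] by simp
    then show ?thesis using that by (simp add: sorted_wrt_iff_nth_less n_def)
  qed
  have gap: "hs ! j + (j - i) \<le> hs ! i" if "i \<le> j" "j < n" for i j
    using that
  proof (induction "j - i" arbitrary: j)
    case (Suc d)
    then have "hs ! (j - 1) + (j - 1 - i) \<le> hs ! i" by (intro Suc.hyps(1)) auto
    moreover have "hs ! j < hs ! (j - 1)" using Suc by (intro dec) auto
    ultimately show ?case using Suc by linarith
  qed simp
  have pos: "hs ! i > 0" if "i < n" for i using that A set n_def nth_mem[of i hs] by (metis gr0I)
  have low: "hs ! i \<ge> n - i" if "i < n" for i
    using gap[of i "n - 1"] pos[of "n - 1"] that by linarith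
  define lam where "lam = map (\<lambda>i. hs ! i - (n - 1 - i)) [0..<n]"
  have l: "length lam = n" by (simp add: lam_def)
  have li: "lam ! i = hs ! i - (n - 1 - i)" if "i < n" for i using that by (simp add: lam_def)
  have ip: "is_partition lam" unfolding is_partition_def
  proof
    show "sorted_wrt (\<ge>) lam" unfolding sorted_wrt_iff_nth_less l
    proof (intro allI impI)
      fix i j assume "i < j" "j < n"
      then show "lam ! j \<le> lam ! i" using gap[of i j] low[of j] by (simp add: li)
    qed
    show "0 \<notin> set lam"
    proof
      assume "0 \<in> set lam"
      then obtain i where "i < n" "lam ! i = 0" by (metis in_set_conv_nth l)
      then show False using low[of i] by (simp add: li)
    qed
  qed
  have b: "map (beta_number lam) [0..<length lam] = hs"
  proof (rule nth_equalityI)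
    fix i assume "i < length (map (beta_number lam) [0..<length lam])"
    then have "i < n" by (simp add: l)
    then show "map (beta_number lam) [0..<length lam] ! i = hs ! i"
      using low[of i] by (simp add: l beta_number_def li)
  qed (simp add: l n_def)
  have mp: "maya_partition (maya_of A s) = lam"
  proof (rule maya_partition_eqI[OF ip])
    have v: "int (part lam (Suc i)) - int i + (int n - 1 - s) = (if i < n then int (hs ! i) - s else int n - 1 - int i - s)" for i
      using low[of i] by (auto simp: part_def l li)
    show "maya_of A s = range (\<lambda>i. int (part lam (Suc i)) - int i + (int n - 1 - s))"
      unfolding v
    proof (rule equalityI; rule subsetI)
      fix k assume "k \<in> maya_of A s"
      then consider "k + s < 0" | a where "a \<in> A" "k + s = int a" by (auto simp: maya_of_def)
      then show "k \<in> range (\<lambda>i. if i < n then int (hs ! i) - s else int n - 1 - int i - s)"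
      proof cases
        case 1
        then show ?thesis by (intro range_eqI[of _ _ "nat (int n - 1 - s - k)"]) auto
      next
        case 2
        then obtain i where "i < n" "hs ! i = a" using set n_def by (metis in_set_conv_nth)
        then show ?thesis using 2 by (intro range_eqI[of _ _ i]) auto
      qed
    next
      fix k assume "k \<in> range (\<lambda>i. if i < n then int (hs ! i) - s else int n - 1 - int i - s)"
      then obtain i where i: "k = (if i < n then int (hs ! i) - s else int n - 1 - int i - s)" by blast
      then show "k \<in> maya_of A s" using set n_def nth_mem[of i hs]
        by (cases "i < n") (auto simp: maya_of_def)
    qed
  qed
  show ?thesis by (rule that[OF ip mp]) (simp_all only: b set dist)
qed

text \<open>A filled position \<open>0\<close> belongs to the filled sea: dropping it and shifting
  leaves the diagram unchanged, and by \<open>wdet_strip\<close> the determinant up to a scalar.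
  Repetition leads to the case where \<open>0\<close> is empty.\<close>

lemma maya_wdet:
  assumes "finite A"
  shows "is_partition (maya_partition (maya_of A s)) \<and>
    (\<forall>hs. distinct hs \<and> set hs = A \<longrightarrow> proportional (wdet hs) (schur (maya_partition (maya_of A s))))"
  using assms
proof (induction "card A" arbitrary: A s rule: less_induct)
  case less
  show ?case
  proof (cases "0 \<in> A")
    case False
    obtain lam where lam: "is_partition lam" "maya_partition (maya_of A s) = lam"
      "set (map (beta_number lam) [0..<length lam]) = A" "distinct (map (beta_number lam) [0..<length lam])"
      using maya_of_positive[OF less.prems False] .
    have "proportional (wdet hs) (schur lam)" if "distinct hs" "set hs = A" for hs
      using that lam(3,4) proportional_trans[OF wdet_permute wdet_beta_number] by (metis set_eq_iff_mset_eq_distinct)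
    then show ?thesis using lam by auto
  next
    case True
    define B where "B = (\<lambda>a. a - 1) ` (A - {0})"
    have "Suc ` B = A - {0}" unfolding B_def by (force simp: image_image)
    then have A: "A = insert 0 (Suc ` B)" using True by auto
    have fB: "finite B" using less.prems by (simp add: B_def)
    have "card A = Suc (card B)" unfolding A using fB by (subst card_insert_disjoint) (auto simp: card_image)
    then have IH: "is_partition (maya_partition (maya_of B (s - 1)))"
      "\<And>hs. distinct hs \<Longrightarrow> set hs = B \<Longrightarrow> proportional (wdet hs) (schur (maya_partition (maya_of B (s - 1))))"
      using less.hyps[of B "s - 1"] fB by auto
    let ?B = "sorted_list_of_set B"
    have "proportional (wdet hs) (schur (maya_partition (maya_of B (s - 1))))" if hs: "distinct hs" "set hs = A" for hs
    proof -
      have d: "distinct (map Suc ?B @ [0])" "set (map Suc ?B @ [0]) = A" using fB by (auto simp: A distinct_map)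
      have "mset hs = mset (map Suc ?B @ [0])" using hs d by (metis set_eq_iff_mset_eq_distinct)
      then have "proportional (wdet hs) (wdet ?B)" by (rule proportional_trans[OF wdet_permute wdet_strip])
      then show ?thesis using IH(2)[of ?B] fB proportional_trans by simp
    qed
    moreover have "maya_of A s = maya_of B (s - 1)" unfolding A by (rule maya_of_strip)
    ultimately show ?thesis using IH(1) by simp
  qed
qed

section \<open>The Toda equations for Schur functions\<close>

lemma proportional_nz: "proportional p q \<Longrightarrow> p \<noteq> 0 \<longleftrightarrow> q \<noteq> 0"
  by (auto simp: proportional_def)

lemma toda_poly_smult: "toda_poly c (smult a Q) = smult (a * a) (toda_poly c Q)"
  by (simp add: toda_poly_def pderiv_smult smult_add_right smult_diff_right)

definition monic_schur :: "nat list \<Rightarrow> complex poly" where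
  "monic_schur lam = smult (of_int (hook_product lam)) (schur lam)"

lemma monic_schur:
  assumes "is_partition lam"
  shows "lead_coeff (monic_schur lam) = 1" "monic_schur lam \<noteq> 0" "proportional (schur lam) (monic_schur lam)"
proof -
  have l: "of_int (hook_product lam) * coeff (schur lam) (sum_list lam) = 1" by (rule lead_schur[OF assms])
  then have "coeff (schur lam) (sum_list lam) \<noteq> 0" by auto
  then have d: "degree (schur lam) = sum_list lam" using coeff_schur(1)[of lam] le_degree[of "schur lam"] by force
  show "lead_coeff (monic_schur lam) = 1" unfolding monic_schur_def lead_coeff_smult d using l .
  then show "monic_schur lam \<noteq> 0" by auto
  have "hook_product lam \<noteq> 0" using hook_product_pos[OF assms] by simp
  then have "schur lam = smult (inverse (of_int (hook_product lam))) (monic_schur lam)"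
    unfolding monic_schur_def by simp
  then show "proportional (schur lam) (monic_schur lam)"
    unfolding proportional_def using \<open>hook_product lam \<noteq> 0\<close> by (intro exI[of _ "inverse (of_int (hook_product lam))"]) simp
qed

lemma proportional_monic_eq:
  assumes "proportional p q" "lead_coeff p = 1" "lead_coeff q = 1" shows "p = q"
  using assms unfolding proportional_def by (metis lead_coeff_smult mult.right_neutral smult_1_left)

text \<open>Derivatives lower the degree, so \<open>x^2 * Q^2\<close> dominates.\<close>

lemma toda_poly_degree:
  assumes "lead_coeff Q = 1" shows "lead_coeff (toda_poly c Q) = 1" "degree (toda_poly c Q) = 2 * degree Q + 2"
proof -
  let ?d = "degree Q" and ?q = "[:c, 0, 1:]"
  have Q: "Q \<noteq> 0" using assms by auto
  have small: "degree (Q * pderiv (pderiv Q) - pderiv Q * pderiv Q) \<le> 2 * ?d"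
  proof (rule degree_diff_le)
    have "degree (pderiv Q) \<le> ?d" "degree (pderiv (pderiv Q)) \<le> ?d" by (simp_all add: degree_pderiv)
    then show "degree (Q * pderiv (pderiv Q)) \<le> 2 * ?d" "degree (pderiv Q * pderiv Q) \<le> 2 * ?d"
      using degree_mult_le[of Q "pderiv (pderiv Q)"] degree_mult_le[of "pderiv Q" "pderiv Q"] by linarith+
  qed
  have big: "degree (?q * (Q * Q)) = 2 * ?d + 2" using Q by (simp add: degree_mult_eq del: mult_pCons_left)
  have lc: "lead_coeff (?q * (Q * Q)) = 1" by (simp add: lead_coeff_mult assms del: mult_pCons_left)
  have lt: "degree (Q * pderiv (pderiv Q) - pderiv Q * pderiv Q) < degree (?q * (Q * Q))"
    unfolding big using small by linarith
  show "degree (toda_poly c Q) = 2 * ?d + 2" unfolding toda_poly_def degree_add_eq_right[OF lt] big ..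
  show "lead_coeff (toda_poly c Q) = 1" unfolding toda_poly_def lead_coeff_add_le[OF lt] lc ..
qed

definition monic_wdet :: "nat set \<Rightarrow> int \<Rightarrow> complex poly" where
  "monic_wdet A s = monic_schur (maya_partition (maya_of A s))"

lemma wdet_monic_wdet:
  assumes "finite A" "distinct hs" "set hs = A"
  shows "proportional (wdet hs) (monic_wdet A s)" "lead_coeff (monic_wdet A s) = 1" "wdet hs \<noteq> 0"
proof -
  have m: "is_partition (maya_partition (maya_of A s))"
    "proportional (wdet hs) (schur (maya_partition (maya_of A s)))" using maya_wdet[OF assms(1), of s] assms by auto
  show p: "proportional (wdet hs) (monic_wdet A s)" unfolding monic_wdet_def
    using proportional_trans[OF m(2) monic_schur(3)[OF m(1)]] .
  show "lead_coeff (monic_wdet A s) = 1" unfolding monic_wdet_def by (rule monic_schur[OF m(1)])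
  then show "wdet hs \<noteq> 0" using proportional_nz[OF p] by auto
qed

lemma monic_wdet_toda:
  assumes fin: "finite A" and f: "f \<in> A" "f + 3 \<notin> A" "f \<noteq> h1" "f \<noteq> h2" and A: "{0, 1, 2} \<subseteq> A"
    and next3: "\<And>h. h \<in> A \<Longrightarrow> h \<noteq> f \<Longrightarrow> h = h1 \<or> h = h2 \<or> h + 3 \<in> A"
  shows "monic_wdet (insert (f + 3) A) s * monic_wdet (A - {f}) s
    = toda_poly (2 * of_nat (card A) - 4 - of_nat h1 - of_nat h2) (monic_wdet A s)"
proof -
  define B where "B = sorted_list_of_set (A - {f})"
  have B: "distinct B" "set B = A - {f}" using fin by (simp_all add: B_def)
  have lB: "length B = card A - 1" "card A \<ge> 1" using fin f(1) by (auto simp: B_def card_gt_0_iff Suc_le_eq)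
  have Bf: "distinct (B @ [f])" "set (B @ [f]) = A" using B f(1) by auto
  have Bff: "distinct (B @ [f, f + 3])" "set (B @ [f, f + 3]) = insert (f + 3) A" using B f by auto
  define c where "c = (2 * of_nat (card A) - 4 - of_nat h1 - of_nat h2 :: complex)"
  define \<kappa> where "\<kappa> = (of_nat f - of_nat h1) * (of_nat f - of_nat h2 :: complex)"
  have \<kappa>: "\<kappa> \<noteq> 0" using f by (simp add: \<kappa>_def)
  define W where "W = wdet (B @ [f])"
  define G where "G = [:0, c, 0, 1/3:]"
  have dG: "pderiv G = [:c, 0, 1:]" by (simp add: G_def pderiv_pCons)
  have "2 * of_nat (length B) - 2 - of_nat h1 - of_nat h2 = c"
    using lB by (simp add: c_def of_nat_diff)
  then have raise: "smult \<kappa> (wdet (B @ [f + 3])) = pderiv W + G * W"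
    using wdet_raise[of B f h1 h2] Bf(2) A next3 B(2) by (auto simp: \<kappa>_def W_def G_def)
  have nz: "wdet (B @ [f, f + 3]) \<noteq> 0" using wdet_monic_wdet(3)[OF _ Bff] fin by simp
  have "smult \<kappa> (wdet (B @ [f, f + 3]) * wdet B)
     = W * pderiv (smult \<kappa> (wdet (B @ [f + 3]))) - pderiv W * smult \<kappa> (wdet (B @ [f + 3]))"
    unfolding wdet_jacobi[OF nz] W_def by (simp add: pderiv_smult smult_diff_right)
  \<comment> \<open>With \<open>U = pderiv W + G * W\<close>, the terms containing
    \<open>G * W * pderiv W\<close> cancel in \<open>W * pderiv U - pderiv W * U\<close>, and
    \<open>pderiv G\<close> supplies the quadratic polynomial of \<open>toda_poly\<close>.\<close>
  also have "\<dots> = toda_poly c W"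
    unfolding raise toda_poly_def dG[symmetric] by (simp add: pderiv_add pderiv_mult algebra_simps)
  finally have main: "smult \<kappa> (wdet (B @ [f, f + 3]) * wdet B) = toda_poly c W" .
  obtain a where a: "a \<noteq> 0" "wdet (B @ [f, f + 3]) = smult a (monic_wdet (insert (f + 3) A) s)"
    using wdet_monic_wdet(1)[OF _ Bff, of s] fin by (auto simp: proportional_def)
  obtain b where b: "b \<noteq> 0" "wdet B = smult b (monic_wdet (A - {f}) s)"
    using wdet_monic_wdet(1)[OF _ B, of s] fin by (auto simp: proportional_def)
  obtain d where d: "d \<noteq> 0" "W = smult d (monic_wdet A s)"
    using wdet_monic_wdet(1)[OF fin Bf, of s] by (auto simp: proportional_def W_def)
  have e: "smult (\<kappa> * a * b) (monic_wdet (insert (f + 3) A) s * monic_wdet (A - {f}) s) = smult (d * d) (toda_poly c (monic_wdet A s))"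
    using main unfolding a b d toda_poly_smult by (simp add: mult_ac)
  have "proportional (monic_wdet (insert (f + 3) A) s * monic_wdet (A - {f}) s) (toda_poly c (monic_wdet A s))"
    unfolding proportional_def
  proof (intro exI conjI)
    show "d * d / (\<kappa> * a * b) \<noteq> 0" using \<kappa> a b d by simp
    have "monic_wdet (insert (f + 3) A) s * monic_wdet (A - {f}) s
      = smult (1 / (\<kappa> * a * b)) (smult (\<kappa> * a * b) (monic_wdet (insert (f + 3) A) s * monic_wdet (A - {f}) s))"
      using \<kappa> a b by simp
    also have "\<dots> = smult (d * d / (\<kappa> * a * b)) (toda_poly c (monic_wdet A s))" unfolding e by simp
    finally show "monic_wdet (insert (f + 3) A) s * monic_wdet (A - {f}) s = smult (d * d / (\<kappa> * a * b)) (toda_poly c (monic_wdet A s))" .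
  qed
  moreover have "lead_coeff (monic_wdet (insert (f + 3) A) s * monic_wdet (A - {f}) s) = 1"
    using wdet_monic_wdet(2)[OF _ Bff, of s] wdet_monic_wdet(2)[OF _ B, of s] fin by (simp add: lead_coeff_mult)
  moreover have "lead_coeff (toda_poly c (monic_wdet A s)) = 1"
    by (rule toda_poly_degree) (rule wdet_monic_wdet(2)[OF fin Bf])
  ultimately show ?thesis unfolding c_def by (rule proportional_monic_eq)
qed

text \<open>The part of the Maya diagram \<open>M(m,n)\<close> above \<open>-3s\<close>, shifted to start at \<open>0\<close>, is \<open>runs a b c\<close> with
  \<open>a = m + s\<close>, \<open>b = n + s\<close>, \<open>c = s\<close>.\<close>

definition runs :: "nat \<Rightarrow> nat \<Rightarrow> nat \<Rightarrow> nat set" where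
  "runs a b c = (\<lambda>k. 3 * k) ` {..<a} \<union> (\<lambda>k. 3 * k + 1) ` {..<b} \<union> (\<lambda>k. 3 * k + 2) ` {..<c}"

lemma finite_runs: "finite (runs a b c)" by (simp add: runs_def)

lemma mem_runs: "h \<in> runs a b c \<longleftrightarrow>
    (h mod 3 = 0 \<and> h div 3 < a) \<or> (h mod 3 = 1 \<and> h div 3 < b) \<or> (h mod 3 = 2 \<and> h div 3 < c)"
proof -
  have "h \<in> (\<lambda>k. 3 * k) ` {..<a} \<longleftrightarrow> h mod 3 = 0 \<and> h div 3 < a" by (auto simp: image_iff intro: bexI[of _ "h div 3"])
  moreover have "h \<in> (\<lambda>k. 3 * k + 1) ` {..<b} \<longleftrightarrow> h mod 3 = 1 \<and> h div 3 < b"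
    by (auto simp: image_iff div_mult2_eq intro!: bexI[of _ "h div 3"]) presburger+
  moreover have "h \<in> (\<lambda>k. 3 * k + 2) ` {..<c} \<longleftrightarrow> h mod 3 = 2 \<and> h div 3 < c"
    by (auto simp: image_iff intro!: bexI[of _ "h div 3"]) presburger+
  ultimately show ?thesis unfolding runs_def Un_iff by simp
qed

lemma card_runs: "card (runs a b c) = a + b + c"
proof -
  have 1: "((\<lambda>k. 3 * k) ` {..<a} \<union> (\<lambda>k. 3 * k + 1) ` {..<b}) \<inter> (\<lambda>k. 3 * k + 2) ` {..<c} = {}"
    by auto presburger+
  have 2: "(\<lambda>k. 3 * k) ` {..<a} \<inter> (\<lambda>k. 3 * k + 1) ` {..<b} = {}"
    by auto presburger+
  show ?thesis unfolding runs_def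
    by (subst card_Un_disjoint[OF _ _ 1], simp, simp, subst card_Un_disjoint[OF _ _ 2])
      (auto simp: card_image inj_on_def)
qed

lemma maya_of_runs:
  assumes "int a = m + int s" "int b = n + int s"
  shows "maya_mn m n = maya_of (runs a b s) (3 * int s)"
proof -
  have "k \<in> maya_mn m n \<longleftrightarrow> k \<in> maya_of (runs a b s) (3 * int s)" for k
  proof -
    have D: "k \<in> maya_mn m n \<longleftrightarrow> (k mod 3 = 0 \<and> k div 3 < m) \<or> (k mod 3 = 1 \<and> k div 3 < n) \<or> (k mod 3 = 2 \<and> k div 3 < 0)"
    proof -
      have "k \<in> (\<lambda>k. 3 * k) ` D_set m \<longleftrightarrow> k mod 3 = 0 \<and> k div 3 < m"
        by (auto simp: image_iff D_set_def intro!: exI[of _ "k div 3"])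
      moreover have "k \<in> (\<lambda>k. 3 * k + 1) ` D_set n \<longleftrightarrow> k mod 3 = 1 \<and> k div 3 < n"
        by (auto simp: image_iff D_set_def intro!: exI[of _ "k div 3"]) presburger+
      moreover have "k \<in> (\<lambda>k. 3 * k + 2) ` D_set 0 \<longleftrightarrow> k mod 3 = 2 \<and> k div 3 < 0"
        by (auto simp: image_iff D_set_def intro!: exI[of _ "k div 3"]) presburger+
      ultimately show ?thesis unfolding maya_mn_def Un_iff by simp
    qed
    show ?thesis
    proof (cases "k + 3 * int s < 0")
      case True
      then show ?thesis unfolding D maya_of_def using assms by auto
    next
      case False
      define h where "h = nat (k + 3 * int s)"
      have h: "k = int h - 3 * int s" using False by (simp add: h_def)
      have "k \<in> maya_of (runs a b s) (3 * int s) \<longleftrightarrow> h \<in> runs a b s"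
        unfolding maya_of_def h by auto
      moreover have e: "k mod 3 = int (h mod 3)" "k div 3 = int (h div 3) - int s"
      proof -
        have "k = int h + 3 * (- int s)" by (simp add: h)
        then have "k mod 3 = int h mod 3" "k div 3 = - int s + int h div 3"
          by (simp_all only: mod_mult_self2 div_mult_self2[of 3 "int h" "- int s", simplified])
        then show "k mod 3 = int (h mod 3)" "k div 3 = int (h div 3) - int s" by (simp_all add: zmod_int zdiv_int)
      qed
      have "int (h div 3) - int s < m \<longleftrightarrow> h div 3 < a" "int (h div 3) - int s < n \<longleftrightarrow> h div 3 < b"
        "int (h div 3) - int s < 0 \<longleftrightarrow> h div 3 < s"
        "int (h mod 3) = 0 \<longleftrightarrow> h mod 3 = 0" "int (h mod 3) = 1 \<longleftrightarrow> h mod 3 = 1" "int (h mod 3) = 2 \<longleftrightarrow> h mod 3 = 2"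
        using assms by linarith+
      ultimately show ?thesis unfolding D e mem_runs by (simp only:)
    qed
  qed
  then show ?thesis by blast
qed

definition okamoto_schur :: "int \<Rightarrow> int \<Rightarrow> complex poly" where
  "okamoto_schur m n = monic_schur (lambda_mn m n)"

lemma okamoto_schur_eq: "int a = m + int s \<Longrightarrow> int b = n + int s \<Longrightarrow> okamoto_schur m n = monic_wdet (runs a b s) (3 * int s)"
  by (simp add: okamoto_schur_def lambda_mn_def monic_wdet_def maya_of_runs)

lemma lambda_mn_partition: "is_partition (lambda_mn m n)"
proof -
  define s where "s = nat (max (- m) (max (- n) 0))"
  have "maya_mn m n = maya_of (runs (nat (m + s)) (nat (n + s)) s) (3 * int s)"
    by (rule maya_of_runs) (auto simp: s_def)
  then show ?thesis unfolding lambda_mn_def using maya_wdet[OF finite_runs] by simp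
qed

lemma okamoto_schur_monic: "lead_coeff (okamoto_schur m n) = 1" "okamoto_schur m n \<noteq> 0"
  unfolding okamoto_schur_def using monic_schur[OF lambda_mn_partition] by auto

lemma runs_Suc:
  "runs (Suc a) b c = insert (3 * a) (runs a b c)" "runs a (Suc b) c = insert (3 * b + 1) (runs a b c)"
  by (auto simp: runs_def lessThan_Suc)

lemma not_mem_runs: "3 * a \<notin> runs a b c" "3 * b + 1 \<notin> runs a b c"
  by (auto simp: mem_runs)

lemma runs_raise:
  assumes "h \<in> runs (Suc a) (Suc b) (Suc c)"
  shows "h = 3 * a \<or> h = 3 * b + 1 \<or> h = 3 * c + 2 \<or> h + 3 \<in> runs (Suc a) (Suc b) (Suc c)"
proof -
  define q where "q = h div 3"
  define r where "r = h mod 3"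
  have h: "h = 3 * q + r" by (simp add: q_def r_def)
  have m: "(h + 3) mod 3 = r" "(h + 3) div 3 = Suc q" by (simp_all add: q_def r_def)
  from assms have "(r = 0 \<and> q < Suc a) \<or> (r = 1 \<and> q < Suc b) \<or> (r = 2 \<and> q < Suc c)"
    by (simp only: mem_runs q_def r_def)
  then show ?thesis unfolding mem_runs m h by (auto simp: less_Suc_eq)
qed

lemma okamoto_schur_toda:
  "okamoto_schur (m + 1) n * okamoto_schur (m - 1) n = toda_poly (of_int (2 * m - n - 1)) (okamoto_schur m n)"
  "okamoto_schur m (n + 1) * okamoto_schur m (n - 1) = toda_poly (of_int (2 * n - m)) (okamoto_schur m n)"
proof -
  define s where "s = nat (\<bar>m\<bar> + \<bar>n\<bar>)"
  define a where "a = nat (m + s)"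
  define b where "b = nat (n + s)"
  have ab: "int a = m + int s" "int b = n + int s"
    by (simp_all add: a_def b_def s_def)
  \<comment> \<open>One extra element per run: each run then contains its starting point, as
    \<open>monic_wdet_toda\<close> demands, and all four neighbours can be written with the same
    cut-off.\<close>
  let ?A = "runs (Suc a) (Suc b) (Suc s)"
  have sub: "{0, 1, 2} \<subseteq> ?A" by (simp add: mem_runs)
  have R: "okamoto_schur (m + (int i - 1)) (n + (int j - 1)) = monic_wdet (runs (a + i) (b + j) (Suc s)) (3 * int (Suc s))" for i j
    by (rule okamoto_schur_eq) (simp_all add: ab)
  have Rs: "okamoto_schur m n = monic_wdet ?A (3 * int (Suc s))" "okamoto_schur (m + 1) n = monic_wdet (runs (Suc (Suc a)) (Suc b) (Suc s)) (3 * int (Suc s))"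
    "okamoto_schur (m - 1) n = monic_wdet (runs a (Suc b) (Suc s)) (3 * int (Suc s))"
    "okamoto_schur m (n + 1) = monic_wdet (runs (Suc a) (Suc (Suc b)) (Suc s)) (3 * int (Suc s))"
    "okamoto_schur m (n - 1) = monic_wdet (runs (Suc a) b (Suc s)) (3 * int (Suc s))"
    using R[of 1 1] R[of 2 1] R[of 0 1] R[of 1 2] R[of 1 0] by (simp_all add: numeral_2_eq_2)
  have c: "(2 * of_nat (card ?A) - 4 - of_nat p - of_nat q :: complex) = of_int (2 * int (a + b + s) + 2 - int p - int q)" for p q
    by (simp add: card_runs)
  have "monic_wdet (insert (3 * a + 3) ?A) (3 * int (Suc s)) * monic_wdet (?A - {3 * a}) (3 * int (Suc s))
    = toda_poly (2 * of_nat (card ?A) - 4 - of_nat (3 * b + 1) - of_nat (3 * s + 2)) (monic_wdet ?A (3 * int (Suc s)))"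
  proof (rule monic_wdet_toda[OF finite_runs _ _ _ _ sub])
    show "3 * a \<in> ?A" "3 * a + 3 \<notin> ?A" by (auto simp: mem_runs)
    show "3 * a \<noteq> 3 * b + 1" "3 * a \<noteq> 3 * s + 2" by presburger+
  qed (use runs_raise in blast)
  moreover have "insert (3 * a + 3) ?A = runs (Suc (Suc a)) (Suc b) (Suc s)" "?A - {3 * a} = runs a (Suc b) (Suc s)"
    using not_mem_runs(1)[of a "Suc b" "Suc s"] by (simp_all add: runs_Suc(1) add.commute)
  \<comment> \<open>The expression equals \<open>2 * a - b - s - 1\<close>, from which the cut-off
    \<open>s\<close> cancels after inserting \<open>a = m + s\<close> and
    \<open>b = n + s\<close>.\<close>
  moreover have "2 * int (a + b + s) + 2 - int (3 * b + 1) - int (3 * s + 2) = 2 * m - n - 1" using ab by simp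
  ultimately show "okamoto_schur (m + 1) n * okamoto_schur (m - 1) n = toda_poly (of_int (2 * m - n - 1)) (okamoto_schur m n)"
    by (simp only: Rs c)
  have "monic_wdet (insert (3 * b + 1 + 3) ?A) (3 * int (Suc s)) * monic_wdet (?A - {3 * b + 1}) (3 * int (Suc s))
    = toda_poly (2 * of_nat (card ?A) - 4 - of_nat (3 * a) - of_nat (3 * s + 2)) (monic_wdet ?A (3 * int (Suc s)))"
  proof (rule monic_wdet_toda[OF finite_runs _ _ _ _ sub])
    show "3 * b + 1 \<in> ?A" "3 * b + 1 + 3 \<notin> ?A" by (auto simp: mem_runs)
    show "3 * b + 1 \<noteq> 3 * a" "3 * b + 1 \<noteq> 3 * s + 2" by presburger+
  qed (use runs_raise in blast)
  moreover have "insert (3 * b + 1 + 3) ?A = runs (Suc a) (Suc (Suc b)) (Suc s)" "?A - {3 * b + 1} = runs (Suc a) b (Suc s)"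
    using not_mem_runs(2)[of b "Suc a" "Suc s"] by (simp_all add: runs_Suc(2) add.commute)
  moreover have "2 * int (a + b + s) + 2 - int (3 * a) - int (3 * s + 2) = 2 * n - m" using ab by simp
  ultimately show "okamoto_schur m (n + 1) * okamoto_schur m (n - 1) = toda_poly (of_int (2 * n - m)) (okamoto_schur m n)"
    by (simp only: Rs c)
qed

lemma okamoto_schur_start: "okamoto_schur 0 0 = 1" "okamoto_schur 1 0 = 1" "okamoto_schur 1 1 = 1" "okamoto_schur 0 1 = [:0, 1:]"
proof -
  have *: "okamoto_schur (int a) (int b) = Q" if "distinct hs" "set hs = runs a b 0" "proportional (wdet hs) Q" "lead_coeff Q = 1" for a b hs Q
  proof -
    note T = that
    have p: "proportional (wdet hs) (monic_wdet (runs a b 0) 0)" "lead_coeff (monic_wdet (runs a b 0) 0) = 1"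
      using wdet_monic_wdet[OF finite_runs that(1,2)] by auto
    have "proportional (monic_wdet (runs a b 0) 0) Q"
    proof -
      obtain c where c: "c \<noteq> 0" "wdet hs = smult c (monic_wdet (runs a b 0) 0)"
        using p(1) unfolding proportional_def by blast
      obtain d where d: "d \<noteq> 0" "wdet hs = smult d Q"
        using T(3) unfolding proportional_def by blast
      have "monic_wdet (runs a b 0) 0 = smult (1 / c) (smult c (monic_wdet (runs a b 0) 0))" using c by simp
      also have "\<dots> = smult (d / c) Q" unfolding c(2)[symmetric] d(2) by simp
      finally have "monic_wdet (runs a b 0) 0 = smult (d / c) Q" .
      then show ?thesis using c d unfolding proportional_def by (intro exI[of _ "d / c"]) simp
    qed
    then have "monic_wdet (runs a b 0) 0 = Q" using p(2) that(4) by (rule proportional_monic_eq)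
    then show ?thesis using okamoto_schur_eq[of a "int a" 0 b "int b"] by simp
  qed
  have w0: "wdet [] = 1" and w1: "wdet [k] = okp (int k)" for k
    by (simp_all add: wdet_def wmat_def det_single)
  have w2: "wdet [0, 1] = 1"
    unfolding wdet_def by (subst det_two) (auto simp: wmat_def okp_0 okp_neg)
  show "okamoto_schur 0 0 = 1" using *[of "[]" 0 0 1] w0 proportional_sign(3) by (simp add: runs_def)
  show "okamoto_schur 1 0 = 1" using *[of "[0]" 1 0 1] w1[of 0] proportional_sign(3) by (simp add: runs_def okp_0 lessThan_Suc)
  show "okamoto_schur 0 1 = [:0, 1:]" using *[of "[1]" 0 1 "[:0,1:]"] w1[of 1] proportional_sign(3) by (simp add: runs_def okp_1 lessThan_Suc)
  show "okamoto_schur 1 1 = 1" using *[of "[0, 1]" 1 1 1] w2 proportional_sign(3) by (simp add: runs_def lessThan_Suc insert_commute)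
qed

section \<open>Degree, integrality and conclusion\<close>

lemma lattice_induct:
  fixes P :: "int \<Rightarrow> int \<Rightarrow> bool"
  assumes "P 0 0" "P 1 0" "P 0 1" "P 1 1"
    and "\<And>m n. P m n \<Longrightarrow> P m (n - 1) \<Longrightarrow> P m (n + 1)" "\<And>m n. P m n \<Longrightarrow> P m (n + 1) \<Longrightarrow> P m (n - 1)"
    and "\<And>m n. P m n \<Longrightarrow> P (m - 1) n \<Longrightarrow> P (m + 1) n" "\<And>m n. P m n \<Longrightarrow> P (m + 1) n \<Longrightarrow> P (m - 1) n"
  shows "P m n"
proof -
  have "P 0 n" "P 1 n" by (rule two_sided_induct; use assms in blast)+
  then show ?thesis by (rule two_sided_induct[where P = "\<lambda>m. P m n"]) (use assms in blast)+
qed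

text \<open>The Toda equation gives the degree second difference \<open>2\<close> in each lattice
  direction. The quadratic form has the same differences and the same values on the unit
  square.\<close>

lemma okamoto_schur_degree: "int (degree (okamoto_schur m n)) = m^2 + n^2 - m*n - m"
proof (rule lattice_induct[where P = "\<lambda>m n. int (degree (okamoto_schur m n)) = m^2 + n^2 - m*n - m"])
  have 1: "int (degree (okamoto_schur m (n + 1))) + int (degree (okamoto_schur m (n - 1))) = 2 * int (degree (okamoto_schur m n)) + 2" for m n
    using arg_cong[OF okamoto_schur_toda(2), of degree m n] toda_poly_degree(2)[OF okamoto_schur_monic(1)] okamoto_schur_monic(2)
    by (simp add: degree_mult_eq)
  have 2: "int (degree (okamoto_schur (m + 1) n)) + int (degree (okamoto_schur (m - 1) n)) = 2 * int (degree (okamoto_schur m n)) + 2" for m n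
    using arg_cong[OF okamoto_schur_toda(1), of degree m n] toda_poly_degree(2)[OF okamoto_schur_monic(1)] okamoto_schur_monic(2)
    by (simp add: degree_mult_eq)
  fix m n :: int
  let ?P = "\<lambda>m n. int (degree (okamoto_schur m n)) = m^2 + n^2 - m*n - m"
  show "?P m (n - 1) \<Longrightarrow> ?P m (n + 1)" if "?P m n" using that 1[of m n] by (simp add: power2_eq_square algebra_simps)
  show "?P m (n + 1) \<Longrightarrow> ?P m (n - 1)" if "?P m n" using that 1[of m n] by (simp add: power2_eq_square algebra_simps)
  show "?P (m - 1) n \<Longrightarrow> ?P (m + 1) n" if "?P m n" using that 2[of m n] by (simp add: power2_eq_square algebra_simps)
  show "?P (m + 1) n \<Longrightarrow> ?P (m - 1) n" if "?P m n" using that 2[of m n] by (simp add: power2_eq_square algebra_simps)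
qed (simp_all add: okamoto_schur_start)

definition int_poly :: "complex poly \<Rightarrow> bool" where "int_poly p \<longleftrightarrow> (\<forall>k. coeff p k \<in> \<int>)"

lemma int_poly_mult: "int_poly p \<Longrightarrow> int_poly q \<Longrightarrow> int_poly (p * q)"
  by (auto simp: int_poly_def coeff_mult intro!: Ints_sum Ints_mult)

lemma int_poly_toda_poly: assumes "int_poly Q" shows "int_poly (toda_poly (of_int c) Q)"
proof -
  have d: "int_poly (pderiv q)" if "int_poly q" for q
    using that by (auto simp: int_poly_def coeff_pderiv simp del: of_nat_Suc intro!: Ints_mult)
  have x: "int_poly [:of_int c, 0, 1:]" by (auto simp: int_poly_def coeff_pCons split: nat.split)
  have s: "int_poly (p + q)" "int_poly (p - q)" if "int_poly p" "int_poly q" for p q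
    using that by (auto simp: int_poly_def)
  show ?thesis unfolding toda_poly_def by (intro s int_poly_mult d x assms)
qed

text \<open>Descending induction: as \<open>q\<close> is monic, coefficient
  \<open>n + degree q\<close> of the product is \<open>coeff r n\<close> plus integer multiples of
  higher coefficients of \<open>r\<close>.\<close>

lemma int_poly_quotient:
  assumes p: "int_poly (r * q)" and q: "int_poly q" "lead_coeff q = 1" shows "int_poly r"
proof -
  let ?d = "degree q"
  have "coeff r n \<in> \<int>" for n
  proof (induction "degree r - n" arbitrary: n rule: less_induct)
    case less
    show ?case
    proof (cases "n > degree r")
      case False
      have "coeff (r * q) (n + ?d) = (\<Sum>i\<le>n + ?d. coeff r i * coeff q (n + ?d - i))" by (rule coeff_mult)
      also have "\<dots> = (\<Sum>i\<in>{n..n + ?d}. coeff r i * coeff q (n + ?d - i))"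
        by (rule sum.mono_neutral_right) (auto simp: coeff_eq_0)
      also have "\<dots> = coeff r n + (\<Sum>i\<in>{n<..n + ?d}. coeff r i * coeff q (n + ?d - i))"
        by (subst sum.head) (simp_all add: q(2))
      finally have "coeff r n = coeff (r * q) (n + ?d) - (\<Sum>i\<in>{n<..n + ?d}. coeff r i * coeff q (n + ?d - i))" by simp
      moreover have "coeff r i \<in> \<int>" if "i > n" for i
        using less[of i] that False by (cases "i > degree r") (auto simp: coeff_eq_0)
      ultimately show ?thesis using p q(1) by (auto simp: int_poly_def intro!: Ints_diff Ints_sum Ints_mult)
    qed (simp add: coeff_eq_0)
  qed
  then show ?thesis by (simp add: int_poly_def)
qed

lemma okamoto_schur_int: "int_poly (okamoto_schur m n)"
proof (rule lattice_induct[where P = "\<lambda>m n. int_poly (okamoto_schur m n)"])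
  have 1: "int_poly (1 :: complex poly)" "int_poly [:0, 1:]"
    by (auto simp: int_poly_def coeff_pCons one_pCons split: nat.split)
  then show "int_poly (okamoto_schur 0 0)" "int_poly (okamoto_schur 1 0)" "int_poly (okamoto_schur 0 1)" "int_poly (okamoto_schur 1 1)"
    by (simp_all add: okamoto_schur_start)
  fix m n
  have t1: "int_poly (okamoto_schur m (n + 1) * okamoto_schur m (n - 1))" "int_poly (okamoto_schur (m + 1) n * okamoto_schur (m - 1) n)" if "int_poly (okamoto_schur m n)"
    unfolding okamoto_schur_toda by (rule int_poly_toda_poly[OF that])+
  have t2: "int_poly (okamoto_schur m (n - 1) * okamoto_schur m (n + 1))" "int_poly (okamoto_schur (m - 1) n * okamoto_schur (m + 1) n)" if "int_poly (okamoto_schur m n)"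
    using t1[OF that] by (simp_all only: mult.commute)
  show "int_poly (okamoto_schur m (n - 1)) \<Longrightarrow> int_poly (okamoto_schur m (n + 1))" if "int_poly (okamoto_schur m n)"
    by (rule int_poly_quotient[OF t1(1)[OF that] _ okamoto_schur_monic(1)])
  show "int_poly (okamoto_schur m (n + 1)) \<Longrightarrow> int_poly (okamoto_schur m (n - 1))" if "int_poly (okamoto_schur m n)"
    by (rule int_poly_quotient[OF t2(1)[OF that] _ okamoto_schur_monic(1)])
  show "int_poly (okamoto_schur (m - 1) n) \<Longrightarrow> int_poly (okamoto_schur (m + 1) n)" if "int_poly (okamoto_schur m n)"
    by (rule int_poly_quotient[OF t1(2)[OF that] _ okamoto_schur_monic(1)])
  show "int_poly (okamoto_schur (m + 1) n) \<Longrightarrow> int_poly (okamoto_schur (m - 1) n)" if "int_poly (okamoto_schur m n)"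
    by (rule int_poly_quotient[OF t2(2)[OF that] _ okamoto_schur_monic(1)])
qed

theorem theorem4p5:
  fixes m n :: int
  shows "evaluates_to (tau_mn m n) (okamoto_Q m n)
     \<and> lead_coeff (okamoto_Q m n) = 1
     \<and> int (degree (okamoto_Q m n)) = m^2 + n^2 - m*n - m
     \<and> (\<forall>k. coeff (okamoto_Q m n) k \<in> \<int>)
     \<and> hook_product (lambda_mn m n) > 0
     \<and> okamoto_Q m n = smult (of_int (hook_product (lambda_mn m n))) (schur (lambda_mn m n))"
proof -
  have ev: "evaluates_to (tau_mn m n) (okamoto_schur m n)"
    by (rule evaluates_to_tau_mn[OF okamoto_schur_monic(2) okamoto_schur_start okamoto_schur_toda])
  then have Q: "okamoto_Q m n = okamoto_schur m n"
    unfolding okamoto_Q_def by (rule the_equality) (rule evaluates_to_unique[OF _ ev])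
  show ?thesis unfolding Q
    using ev okamoto_schur_monic okamoto_schur_degree okamoto_schur_int hook_product_pos[OF lambda_mn_partition]
    by (simp add: int_poly_def) (simp add: okamoto_schur_def monic_schur_def)
qed

end
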